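(* Let $s\in(0,1)$, $p>1$ and let $\Omega\subset\mathbb{R}^N$ be a bounded domain. Assume that $g\in W_0^{s,p}(\Omega)^*\cap L^q(\Omega)$ for some $q\ge1$, and that $u$ is the weak solution of $$(-\Delta)_p^su=g(x)\ \text{in }\Omega,\qquad u=0\ \text{in }\mathbb{R}^N\setminus\Omega.$$ Then there exist constants $C=C(\Omega,p,s,q,r)$ such that: (i) If $q=1$, then for any $0<r<\frac{N(p-1)}{N-sp}$ when $N>sp$, or any $r\ge1$ when $N=sp$, $$\|u\|_r\le C\|g\|_1^{\frac1{p-1}}.$$ (ii) If $q\in(1,\frac N{sp})$ (hence $N>sp$), $$\|u\|_{\frac{N(p-1)q}{N-spq}}\le C\|g\|_q^{\frac1{p-1}}.$$ (iii) If $q=\frac N{sp}>1$, then for any $\alpha_0<\frac N{N-sp}\left(\frac{p^pS}{\|g\|_{N/(sp)}}\right)^{\frac1{p-1}}$, $$\int_\Omega e^{\alpha_0|u|}\,dx<\infty,$$ where $S$ is the best Sobolev embedding constant. (iv) If $q>\frac N{sp}\ge1$, $$\|u\|_\infty\le C\|g\|_q^{\frac1{p-1}}.$$ (v) If $q\ge1>\frac N{sp}$ and $\alpha=\frac{sp-N}p$, $$\|u\|_{C^\alpha(\overline\Omega)}\le C\|g\|_q^{\frac1{p-1}}.$$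
   Context: Function space: $[u]_{s,p}=\left(\int_{\mathbb{R}^{2N}}\frac{|u(x)-u(y)|^p}{|x-y|^{N+sp}}\,dx\,dy\right)^{1/p}$, $W^{s,p}(\mathbb{R}^N)=\{u\in L^p(\mathbb{R}^N):[u]_{s,p}<\infty\}$, and $W_0^{s,p}(\Omega)=\{u\in W^{s,p}(\mathbb{R}^N): u=0 \text{ a.e. in }\mathbb{R}^N\setminus\Omega\}$ with norm $\|u\|_{W_0^{s,p}(\Omega)}=[u]_{s,p}$; $W_0^{s,p}(\Omega)^*$ is its dual. For a function $g$ on $\Omega$, $g\in W_0^{s,p}(\Omega)^*$ means that for every $v\in W_0^{s,p}(\Omega)$, $gv\in L^1(\Omega)$ and $|\int_\Omega gv\,dx|\le C\|v\|_{W_0^{s,p}(\Omega)}$ with $C$ independent of $v$. Operator: for $u,v\in W_0^{s,p}(\Omega)$, $\langle(-\Delta)_p^s u,v\rangle=\int_{\mathbb{R}^{2N}}\frac{|u(x)-u(y)|^{p-2}(u(x)-u(y))(v(x)-v(y))}{|x-y|^{N+sp}}\,dx\,dy$ (integrand read as $0$ when $u(x)=u(y)$). Weak solution: $u\in W_0^{s,p}(\Omega)$ with $\langle(-\Delta)_p^su,v\rangle=\int_\Omega gv\,dx$ for all $v\in W_0^{s,p}(\Omega)$, $v\ge0$; it exists and is unique for $g\in W_0^{s,p}(\Omega)^*$. Notation: $\|u\|_r=(\int|u|^r)^{1/r}$ (also for $0<r<1$). For $N>sp$, $p_s^*=\frac{Np}{N-sp}$, $D^{s,p}(\mathbb{R}^N)=\{u\in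 L^{p_s^*}(\mathbb{R}^N):[u]_{s,p}<\infty\}$, and $$S=\inf_{u\in D^{s,p}(\mathbb{R}^N)\setminus\{0\}}\frac{[u]_{s,p}^p}{\|u\|_{p_s^*}^p}.$$ In (iii), if $g=0$ the upper bound on $\alpha_0$ is read as $+\infty$. *)

theory Defs
  imports "HOL-Analysis.Analysis" "HOL-Probability.Essential_Supremum"
begin

text \<open>
  Functions are not quotiented by equality almost everywhere: an element of a function space is
  any representative of its class. A function on a set \<open>\<Omega>\<close> is a total function whose values
  outside \<open>\<Omega>\<close> are ignored, by integrating with respect to \<^term>\<open>lebesgue_on \<Omega>\<close>.
\<close>

text \<open>The exponent is any \<open>r > 0\<close>, so for \<open>r < 1\<close> the following is not a norm.\<close>

definition Lp_space :: "'a measure \<Rightarrow> real \<Rightarrow> ('a \<Rightarrow> real) set" where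
  "Lp_space M r = {f \<in> borel_measurable M. integrable M (\<lambda>x. \<bar>f x\<bar> powr r)}"

definition Lp_norm :: "'a measure \<Rightarrow> real \<Rightarrow> ('a \<Rightarrow> real) \<Rightarrow> real" where
  "Lp_norm M r f = (\<integral>x. \<bar>f x\<bar> powr r \<partial>M) powr (1 / r)"

definition Linf_norm :: "'a measure \<Rightarrow> ('a \<Rightarrow> real) \<Rightarrow> ereal" where
  "Linf_norm M f = esssup M (\<lambda>x. ereal \<bar>f x\<bar>)"

text \<open>The \<open>C\<^sup>\<alpha>\<close> norm, with value \<open>\<infinity>\<close> if \<open>f\<close> is not bounded and \<open>\<alpha>\<close>-Hoelder on \<open>A\<close>.\<close>

definition holder_norm :: "'a::metric_space set \<Rightarrow> real \<Rightarrow> ('a \<Rightarrow> real) \<Rightarrow> ennreal" where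
  "holder_norm A \<alpha> f =
     (SUP x\<in>A. ennreal \<bar>f x\<bar>) +
     (SUP x\<in>A. SUP y\<in>A - {x}. ennreal (\<bar>f x - f y\<bar> / dist x y powr \<alpha>))"

definition gagliardo_integrand ::
    "real \<Rightarrow> real \<Rightarrow> ('a::euclidean_space \<Rightarrow> real) \<Rightarrow> 'a \<times> 'a \<Rightarrow> real" where
  "gagliardo_integrand s p u =
     (\<lambda>(x, y). \<bar>u x - u y\<bar> powr p / norm (x - y) powr (real DIM('a) + s * p))"

definition finite_gagliardo :: "real \<Rightarrow> real \<Rightarrow> ('a::euclidean_space \<Rightarrow> real) \<Rightarrow> bool" where
  "finite_gagliardo s p u \<longleftrightarrow> integrable lebesgue (gagliardo_integrand s p u)"

text \<open>This is meaningful only under \<^const>\<open>finite_gagliardo\<close>; otherwise it is \<open>0\<close>.\<close>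

definition gagliardo :: "real \<Rightarrow> real \<Rightarrow> ('a::euclidean_space \<Rightarrow> real) \<Rightarrow> real" where
  "gagliardo s p u = (\<integral>z. gagliardo_integrand s p u z \<partial>lebesgue) powr (1 / p)"

definition Wsp :: "real \<Rightarrow> real \<Rightarrow> ('a::euclidean_space \<Rightarrow> real) set" where
  "Wsp s p = {u \<in> Lp_space lebesgue p. finite_gagliardo s p u}"

definition Wsp0 :: "real \<Rightarrow> real \<Rightarrow> 'a::euclidean_space set \<Rightarrow> ('a \<Rightarrow> real) set" where
  "Wsp0 s p \<Omega> = {u \<in> Wsp s p. AE x in lebesgue. x \<notin> \<Omega> \<longrightarrow> u x = 0}"

definition Wsp0_dual :: "real \<Rightarrow> real \<Rightarrow> 'a::euclidean_space set \<Rightarrow> ('a \<Rightarrow> real) set" where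
  "Wsp0_dual s p \<Omega> = {g. \<exists>K. \<forall>v\<in>Wsp0 s p \<Omega>.
     integrable (lebesgue_on \<Omega>) (\<lambda>x. g x * v x) \<and>
     \<bar>\<integral>x. g x * v x \<partial>lebesgue_on \<Omega>\<bar> \<le> K * gagliardo s p v}"

text \<open>The pairing \<open>\<langle>(-\<Delta>)\<^sub>p\<^sup>s u, v\<rangle>\<close>; where \<open>u x = u y\<close> the integrand is \<open>0\<close>, also for \<open>p < 2\<close>.\<close>

definition frac_plap ::
    "real \<Rightarrow> real \<Rightarrow> ('a::euclidean_space \<Rightarrow> real) \<Rightarrow> ('a \<Rightarrow> real) \<Rightarrow> real" where
  "frac_plap s p u v =
     (\<integral>(x, y). \<bar>u x - u y\<bar> powr (p - 2) * (u x - u y) * (v x - v y)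
        / norm (x - y) powr (real DIM('a) + s * p) \<partial>lebesgue)"

definition weak_solution ::
    "real \<Rightarrow> real \<Rightarrow> 'a::euclidean_space set \<Rightarrow> ('a \<Rightarrow> real) \<Rightarrow> ('a \<Rightarrow> real) \<Rightarrow> bool" where
  "weak_solution s p \<Omega> g u \<longleftrightarrow> u \<in> Wsp0 s p \<Omega> \<and>
     (\<forall>v\<in>Wsp0 s p \<Omega>. (AE x in lebesgue. 0 \<le> v x) \<longrightarrow>
        frac_plap s p u v = (\<integral>x. g x * v x \<partial>lebesgue_on \<Omega>))"

definition sobolev_exponent :: "'a::euclidean_space itself \<Rightarrow> real \<Rightarrow> real \<Rightarrow> real" where
  "sobolev_exponent _ s p = real DIM('a) * p / (real DIM('a) - s * p)"

definition Dsp :: "real \<Rightarrow> real \<Rightarrow> ('a::euclidean_space \<Rightarrow> real) set" where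
  "Dsp s p = {u \<in> Lp_space lebesgue (sobolev_exponent TYPE('a) s p). finite_gagliardo s p u}"

text \<open>
  The best Sobolev constant \<open>S\<close>, for \<open>s * p < DIM('a)\<close>. Since \<open>0\<close> in \<^const>\<open>Dsp\<close> is the class
  of functions vanishing almost everywhere, all of these are excluded from the infimum.
\<close>

definition sobolev_const :: "'a::euclidean_space itself \<Rightarrow> real \<Rightarrow> real \<Rightarrow> real" where
  "sobolev_const _ s p =
     (INF u \<in> {u \<in> Dsp s p. \<not> (AE x::'a in lebesgue. u x = 0)}.
        gagliardo s p u powr p / Lp_norm lebesgue (sobolev_exponent TYPE('a) s p) u powr p)"

end

theory Submission
  imports Defs
begin

text \<open>
  Let \<open>\<phi>\<close> be nondecreasing and \<open>\<phi>' = (G')\<^sup>p\<close>. Testing the equation with \<open>\<phi>(u)\<close> bounds the \<open>p\<close>-th power of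
  the Gagliardo seminorm of \<open>G(u)\<close> by \<open>\<integral> g \<phi>(u)\<close>. The Sobolev inequality on the left and the Hoelder
  inequality on the right turn this into an inequality between integrals of \<open>u\<close>, and each claim is a choice
  of \<open>\<phi>\<close>: a power of \<open>1 + u / m\<close> for (i) and (ii), an exponential for (iii), where the ratio of \<open>G\<^sup>p\<close> to \<open>\<phi>\<close>
  at infinity gives the sharp constant, and a truncation of \<open>u - k\<close> for (iv), followed by Stampacchia's
  iteration. For (v), \<open>\<phi>(u)\<close> is the positive part of \<open>u\<close>, and the Morrey inequality replaces the Sobolev
  inequality.
\<close>

section \<open>The energy of a Borel function\<close>

text \<open>The equation may be tested only with nonnegative functions of finite energy, and a power
  or an exponential of u need not have finite energy. So every \<phi> vanishes on the negative axis
  and is Lipschitz, unbounded choices being cut at a level k; the bounds are uniform in k and pass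
  to the limit by Fatou's lemma. Cutting also makes all integrals finite, so that a term on both
  sides can be absorbed. Let q' be conjugate to q. The estimate is sublinear, linear or superlinear
  according as the Sobolev exponent t is below, at or above p q', which separates (ii), (iii) and
  (iv). Constants must not depend on g, so u is measured in units m slightly above the norm of g to
  the power 1 / (p - 1); strictness keeps m positive when g = 0. Only (iii) needs the sharp constant
  S; elsewhere a cruder one is proved directly. Tonelli's theorem is applied to Borel functions, so
  u is first replaced by a Borel representative.\<close>

lemma integral_Holder_powr:
  fixes f h :: "'a \<Rightarrow> real"
  assumes pq: "p > 1" "q > 1" "1/p + 1/q = 1"
    and [measurable]: "f \<in> borel_measurable M" "h \<in> borel_measurable M"
    and f: "integrable M (\<lambda>x. \<bar>f x\<bar> powr p)" and h: "integrable M (\<lambda>x. \<bar>h x\<bar> powr q)"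
  shows "integrable M (\<lambda>x. f x * h x)"
    and "(\<integral>x. \<bar>f x * h x\<bar> \<partial>M) \<le> (\<integral>x. \<bar>f x\<bar> powr p \<partial>M) powr (1/p) * (\<integral>x. \<bar>h x\<bar> powr q \<partial>M) powr (1/q)"
proof -
  have young: "\<bar>f x * h x\<bar> \<le> \<bar>f x\<bar> powr p / p + \<bar>h x\<bar> powr q / q" for x
    using Youngs_inequality[OF pq, of "\<bar>f x\<bar>" "\<bar>h x\<bar>"] by (simp add: abs_mult)
  have int: "integrable M (\<lambda>x. \<bar>f x\<bar> powr p / p + \<bar>h x\<bar> powr q / q)"
    using f h by simp
  show fh: "integrable M (\<lambda>x. f x * h x)"
    by (rule Bochner_Integration.integrable_bound[OF int]) (use young in \<open>auto intro!: AE_I2 order_trans[OF young]\<close>)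
  define A where "A = (\<integral>x. \<bar>f x\<bar> powr p \<partial>M)"
  define B where "B = (\<integral>x. \<bar>h x\<bar> powr q \<partial>M)"
  have A0: "A \<ge> 0" and B0: "B \<ge> 0" by (auto simp: A_def B_def)
  show "(\<integral>x. \<bar>f x * h x\<bar> \<partial>M) \<le> A powr (1/p) * B powr (1/q)"
  proof (cases "A = 0 \<or> B = 0")
    case True
    have "AE x in M. f x * h x = 0"
    proof (cases "A = 0")
      case True
      then have "AE x in M. \<bar>f x\<bar> powr p = 0"
        using integral_nonneg_eq_0_iff_AE[OF f] by (simp add: A_def)
      then show ?thesis by eventually_elim auto
    next
      case False
      then have "AE x in M. \<bar>h x\<bar> powr q = 0"
        using integral_nonneg_eq_0_iff_AE[OF h] True by (simp add: B_def)
      then show ?thesis by eventually_elim auto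
    qed
    then have "AE x in M. \<bar>f x * h x\<bar> = 0" by eventually_elim auto
    then have "(\<integral>x. \<bar>f x * h x\<bar> \<partial>M) = 0"
      by (rule integral_eq_zero_AE)
    then show ?thesis by simp
  next
    case False
    then have A: "A > 0" and B: "B > 0" using A0 B0 by auto
    define a where "a = A powr (1/p)"
    define b where "b = B powr (1/q)"
    have ab: "a > 0" "b > 0" using A B by (auto simp: a_def b_def)
    have ap: "a powr p = A" "b powr q = B"
      using A B pq by (auto simp: a_def b_def powr_powr)
    have y: "\<bar>f x * h x\<bar> \<le> a * b * (\<bar>f x\<bar> powr p / (A * p) + \<bar>h x\<bar> powr q / (B * q))" for x
    proof -
      have "(\<bar>f x\<bar>/a) * (\<bar>h x\<bar>/b) \<le> (\<bar>f x\<bar>/a) powr p / p + (\<bar>h x\<bar>/b) powr q / q"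
        using ab by (intro Youngs_inequality pq) auto
      also have "\<dots> = \<bar>f x\<bar> powr p / (A * p) + \<bar>h x\<bar> powr q / (B * q)"
        using ab by (simp add: powr_divide ap)
      finally show ?thesis using ab by (simp add: abs_mult field_simps)
    qed
    have int2: "integrable M (\<lambda>x. a * b * (\<bar>f x\<bar> powr p / (A * p) + \<bar>h x\<bar> powr q / (B * q)))"
      using f h by simp
    have "(\<integral>x. \<bar>f x * h x\<bar> \<partial>M) \<le> (\<integral>x. a * b * (\<bar>f x\<bar> powr p / (A * p) + \<bar>h x\<bar> powr q / (B * q)) \<partial>M)"
      using fh int2 y by (intro integral_mono) auto
    also have "\<dots> = a * b * (A / (A * p) + B / (B * q))"
      using f h by (simp add: A_def B_def)
    also have "\<dots> = a * b" using A B pq by simp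
    finally show ?thesis by (simp add: a_def b_def)
  qed
qed

text \<open>The p-th power of the seminorm, kept in \<open>ennreal\<close> because
  \<open>gagliardo\<close> is \<open>0\<close> for infinite energy, and taken over
  \<open>lborel\<close> so that Tonelli's theorem applies to the product.\<close>

definition nonlocal_energy :: "real \<Rightarrow> real \<Rightarrow> ('a::euclidean_space \<Rightarrow> real) \<Rightarrow> ennreal" where
  "nonlocal_energy s p u = (\<integral>\<^sup>+z. ennreal (gagliardo_integrand s p u z) \<partial>lborel)"

text \<open>The inner integral of Tonelli's theorem. Both embeddings rest on it: Sobolev bounds it
  from below at every point, Morrey selects points where it is small.\<close>

definition point_energy :: "real \<Rightarrow> real \<Rightarrow> ('a::euclidean_space \<Rightarrow> real) \<Rightarrow> 'a \<Rightarrow> ennreal" where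
  "point_energy s p u x = (\<integral>\<^sup>+y. ennreal (gagliardo_integrand s p u (x, y)) \<partial>lborel)"

lemma gagliardo_integrand_nonneg [simp]: "0 \<le> gagliardo_integrand s p u z"
  by (auto simp: gagliardo_integrand_def split: prod.splits)

lemma gagliardo_integrand_measurable [measurable]:
  assumes [measurable]: "u \<in> borel_measurable borel"
  shows "gagliardo_integrand s p u \<in> borel_measurable borel"
  unfolding gagliardo_integrand_def borel_prod[symmetric] by measurable

lemma nonlocal_energy_eq_point_energy:
  fixes u :: "'a::euclidean_space \<Rightarrow> real"
  assumes [measurable]: "u \<in> borel_measurable borel"
  shows "nonlocal_energy s p u = (\<integral>\<^sup>+x. point_energy s p u x \<partial>lborel)"
    and "point_energy s p u \<in> borel_measurable borel"
proof -
  have m: "(\<lambda>z. ennreal (gagliardo_integrand s p u z)) \<in> borel_measurable (lborel \<Otimes>\<^sub>M lborel)"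
    unfolding lborel_prod by simp
  show "nonlocal_energy s p u = (\<integral>\<^sup>+x. point_energy s p u x \<partial>lborel)"
    unfolding nonlocal_energy_def point_energy_def
    using lborel.nn_integral_fst[OF m] by (simp add: lborel_prod)
  show "point_energy s p u \<in> borel_measurable borel"
    unfolding point_energy_def[abs_def]
    using lborel.borel_measurable_nn_integral_fst[OF m] by simp
qed

section \<open>Almost-everywhere changes and Borel representatives\<close>

text \<open>A null set \<open>N\<close> spoils only the pairs in the strips
  \<open>N \<times> UNIV\<close> and \<open>UNIV \<times> N\<close>, both null. Hence functions may
  be changed on null sets inside double integrals.\<close>

lemma AE_lborel_prod_fst_snd:
  fixes P :: "'a::euclidean_space \<Rightarrow> bool"
  assumes "AE x in lborel. P x"
  shows "AE z in (lborel :: ('a \<times> 'a) measure). P (fst z) \<and> P (snd z)"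
proof -
  obtain N where N: "{x. \<not> P x} \<subseteq> N" "N \<in> null_sets lborel"
    using assms by (auto simp: eventually_ae_filter)
  have [measurable]: "N \<in> sets borel" using N by auto
  have "emeasure (lborel \<Otimes>\<^sub>M lborel) (N \<times> (UNIV::'a set)) = 0" "emeasure (lborel \<Otimes>\<^sub>M lborel) ((UNIV::'a set) \<times> N) = 0"
    using N by (auto simp: lborel.emeasure_pair_measure_Times)
  then have "N \<times> (UNIV::'a set) \<in> null_sets lborel" "(UNIV::'a set) \<times> N \<in> null_sets lborel"
    by (auto simp: lborel_prod null_sets_def borel_prod[symmetric])
  then have "(N \<times> (UNIV::'a set)) \<union> ((UNIV::'a set) \<times> N) \<in> null_sets lborel" by blast
  then show ?thesis
    by (rule AE_I') (use N in auto)
qed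

text \<open>Transfers Bochner integrals over the completion to nonnegative integrals of a Borel
  version. Completeness makes \<open>f\<close> measurable; in the second claim both sides are
  \<open>0\<close> when the integral is infinite.\<close>

lemma integrable_lebesgue_nonneg_cong:
  fixes f f' :: "'a::euclidean_space \<Rightarrow> real"
  assumes [measurable]: "f' \<in> borel_measurable borel" and eq: "AE x in lborel. f x = f' x" and nn: "\<And>x. 0 \<le> f' x"
  shows "integrable lebesgue f \<longleftrightarrow> (\<integral>\<^sup>+x. ennreal (f' x) \<partial>lborel) < \<infinity>"
    and "(\<integral>x. f x \<partial>lebesgue) = enn2real (\<integral>\<^sup>+x. ennreal (f' x) \<partial>lborel)"
proof -
  have eq': "AE x in lebesgue. f x = f' x" using eq by (rule AE_completion)
  have f'm: "f' \<in> borel_measurable lebesgue" by (simp add: measurable_completion)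
  have f: "f \<in> borel_measurable lebesgue"
    by (rule borel_measurable_AE[OF f'm]) (use eq' in auto)
  have "integrable lebesgue f \<longleftrightarrow> integrable lebesgue f'"
    by (rule integrable_cong_AE[OF f f'm eq'])
  also have "\<dots> \<longleftrightarrow> integrable lborel f'" by (simp add: integrable_completion)
  also have "\<dots> \<longleftrightarrow> (\<integral>\<^sup>+x. ennreal (f' x) \<partial>lborel) < \<infinity>"
    using nn by (simp add: integrable_iff_bounded)
  finally show "integrable lebesgue f \<longleftrightarrow> (\<integral>\<^sup>+x. ennreal (f' x) \<partial>lborel) < \<infinity>" .
  have "(\<integral>x. f x \<partial>lebesgue) = (\<integral>x. f' x \<partial>lebesgue)"
    by (rule integral_cong_AE[OF f f'm eq'])
  also have "\<dots> = (\<integral>x. f' x \<partial>lborel)" by (simp add: integral_completion)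
  also have "\<dots> = enn2real (\<integral>\<^sup>+x. ennreal (f' x) \<partial>lborel)"
    using nn by (simp add: integral_eq_nn_integral)
  finally show "(\<integral>x. f x \<partial>lebesgue) = enn2real (\<integral>\<^sup>+x. ennreal (f' x) \<partial>lborel)" .
qed

lemma AE_eq_imp_gagliardo_integrand_AE_eq:
  assumes "AE x in lborel. u x = u' x"
  shows "AE z in lborel. gagliardo_integrand s p u z = gagliardo_integrand s p u' z"
  using AE_lborel_prod_fst_snd[OF assms] by eventually_elim (auto simp: gagliardo_integrand_def split: prod.splits)

lemma finite_gagliardo_iff:
  assumes "u' \<in> borel_measurable borel" "AE x in lborel. u x = u' x"
  shows "finite_gagliardo s p u \<longleftrightarrow> nonlocal_energy s p u' < \<infinity>"
  unfolding finite_gagliardo_def nonlocal_energy_def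
  by (rule integrable_lebesgue_nonneg_cong)
    (use assms AE_eq_imp_gagliardo_integrand_AE_eq in auto)

lemma gagliardo_powr:
  assumes "u' \<in> borel_measurable borel" "AE x in lborel. u x = u' x" "p > 0"
  shows "gagliardo s p u powr p = enn2real (nonlocal_energy s p u')"
proof -
  have "(\<integral>z. gagliardo_integrand s p u z \<partial>lebesgue) = enn2real (nonlocal_energy s p u')"
    unfolding nonlocal_energy_def
    by (rule integrable_lebesgue_nonneg_cong)
      (use assms AE_eq_imp_gagliardo_integrand_AE_eq in auto)
  then show ?thesis using \<open>p > 0\<close> by (simp add: gagliardo_def powr_powr)
qed

lemma borel_representative:
  fixes u :: "'a::euclidean_space \<Rightarrow> real"
  assumes "u \<in> borel_measurable lebesgue"
  obtains u' where "u' \<in> borel_measurable borel" "AE x in lborel. u x = u' x"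
  using completion_ex_borel_measurable_real[OF assms] by auto

lemma Wsp0_borelD:
  fixes u :: "'a::euclidean_space \<Rightarrow> real"
  assumes "u \<in> Wsp0 s p \<Omega>" "u \<in> borel_measurable borel"
  shows "nonlocal_energy s p u < \<infinity>" "AE x in lborel. x \<notin> \<Omega> \<longrightarrow> u x = 0"
    "(\<integral>\<^sup>+x. ennreal (\<bar>u x\<bar> powr p) \<partial>lborel) < \<infinity>"
proof -
  show "nonlocal_energy s p u < \<infinity>"
    using assms finite_gagliardo_iff[OF assms(2), of u] by (auto simp: Wsp0_def Wsp_def)
  show "AE x in lborel. x \<notin> \<Omega> \<longrightarrow> u x = 0"
    using assms by (auto simp: Wsp0_def AE_completion_iff)
  have "integrable lebesgue (\<lambda>x. \<bar>u x\<bar> powr p)"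
    using assms by (auto simp: Wsp0_def Wsp_def Lp_space_def)
  then show "(\<integral>\<^sup>+x. ennreal (\<bar>u x\<bar> powr p) \<partial>lborel) < \<infinity>"
    using assms(2) integrable_lebesgue_nonneg_cong(1)[of "\<lambda>x. \<bar>u x\<bar> powr p" "\<lambda>x. \<bar>u x\<bar> powr p"] by auto
qed

lemma Wsp0_borelI:
  fixes u :: "'a::euclidean_space \<Rightarrow> real"
  assumes "u \<in> borel_measurable borel" "nonlocal_energy s p u < \<infinity>" "AE x in lborel. x \<notin> \<Omega> \<longrightarrow> u x = 0"
    "(\<integral>\<^sup>+x. ennreal (\<bar>u x\<bar> powr p) \<partial>lborel) < \<infinity>"
  shows "u \<in> Wsp0 s p \<Omega>"
proof -
  have "integrable lebesgue (\<lambda>x. \<bar>u x\<bar> powr p)"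
    using assms integrable_lebesgue_nonneg_cong(1)[of "\<lambda>x. \<bar>u x\<bar> powr p" "\<lambda>x. \<bar>u x\<bar> powr p"] by auto
  then show ?thesis
    using assms finite_gagliardo_iff[OF assms(1), of u]
    by (auto simp: Wsp0_def Wsp_def Lp_space_def AE_completion_iff measurable_completion)
qed

lemma Wsp0_AE_cong:
  assumes "u \<in> Wsp0 s p \<Omega>" "AE x in lborel. u x = u' x"
  shows "u' \<in> Wsp0 s p \<Omega>"
proof -
  have u: "u \<in> borel_measurable lebesgue" "integrable lebesgue (\<lambda>x. \<bar>u x\<bar> powr p)"
      "finite_gagliardo s p u" "AE x in lebesgue. x \<notin> \<Omega> \<longrightarrow> u x = 0"
    using assms by (auto simp: Wsp0_def Wsp_def Lp_space_def)
  have eq: "AE x in lebesgue. u x = u' x" using assms by (simp add: AE_completion_iff)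
  have m: "u' \<in> borel_measurable lebesgue"
    using borel_measurable_AE[OF u(1) eq] .
  have "integrable lebesgue (\<lambda>x. \<bar>u' x\<bar> powr p)"
  proof (rule integrable_cong_AE_imp[OF u(2)])
    show "(\<lambda>x. \<bar>u' x\<bar> powr p) \<in> borel_measurable lebesgue" using m by measurable
    show "AE x in lebesgue. \<bar>u x\<bar> powr p = \<bar>u' x\<bar> powr p" using eq by eventually_elim auto
  qed
  moreover obtain v where v: "v \<in> borel_measurable borel" "AE x in lborel. u x = v x"
    using borel_representative[OF u(1)] .
  moreover have "AE x in lborel. u' x = v x" using v(2) assms(2) by eventually_elim auto
  ultimately have "finite_gagliardo s p u'"
    using u(3) finite_gagliardo_iff[OF v(1)] by metis
  moreover have "AE x in lebesgue. x \<notin> \<Omega> \<longrightarrow> u' x = 0"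
    using u(4) eq by eventually_elim auto
  ultimately show ?thesis using m \<open>integrable lebesgue (\<lambda>x. \<bar>u' x\<bar> powr p)\<close>
    by (auto simp: Wsp0_def Wsp_def Lp_space_def)
qed

text \<open>Only \<open>u\<close> changes, but \<open>v\<close> gets a Borel representative as well:
  it makes one Borel integrand \<open>F u0 v0\<close> that both given integrands equal almost
  everywhere, so that both are measurable.\<close>

lemma frac_plap_cong:
  assumes "AE x in lborel. u x = u' x" and u: "u \<in> borel_measurable lebesgue" and v: "v \<in> borel_measurable lebesgue"
  shows "frac_plap s p u v = frac_plap s p u' v"
proof -
  define F where "F u v = (\<lambda>(x, y). \<bar>u x - u y\<bar> powr (p - 2) * (u x - u y) * (v x - v y)
        / norm (x - y) powr (real DIM('a) + s * p))" for u v :: "'a \<Rightarrow> real"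
  obtain u0 where u0: "u0 \<in> borel_measurable borel" "AE x in lborel. u x = u0 x"
    using borel_representative[OF u] .
  obtain v0 where v0: "v0 \<in> borel_measurable borel" "AE x in lborel. v x = v0 x"
    using borel_representative[OF v] .
  have "AE x in lborel. u x = u' x \<and> u x = u0 x \<and> v x = v0 x"
    using assms(1) u0(2) v0(2) by eventually_elim auto
  from AE_lborel_prod_fst_snd[OF this]
  have ae: "AE z in lebesgue. F u0 v0 z = F u v z" "AE z in lebesgue. F u0 v0 z = F u' v z"
    unfolding AE_completion_iff by (eventually_elim, auto simp: F_def split: prod.splits)+
  have [measurable]: "u0 \<in> borel_measurable borel" "v0 \<in> borel_measurable borel" by fact+
  have "F u0 v0 \<in> borel_measurable borel"
    unfolding F_def borel_prod[symmetric] by measurable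
  then have m: "F u0 v0 \<in> borel_measurable lebesgue" by (simp add: measurable_completion)
  have "integral\<^sup>L lebesgue (F u v) = integral\<^sup>L lebesgue (F u0 v0)"
    using ae(1) borel_measurable_AE[OF m ae(1)] m by (intro integral_cong_AE) auto
  also have "\<dots> = integral\<^sup>L lebesgue (F u' v)"
    using ae(2) borel_measurable_AE[OF m ae(2)] m by (intro integral_cong_AE) auto
  finally show ?thesis by (simp add: frac_plap_def F_def)
qed

lemma weak_solution_AE_cong:
  assumes "weak_solution s p \<Omega> g u" "AE x in lborel. u x = u' x"
  shows "weak_solution s p \<Omega> g u'"
  unfolding weak_solution_def
proof (intro conjI ballI impI)
  show "u' \<in> Wsp0 s p \<Omega>" using assms by (auto simp: weak_solution_def intro: Wsp0_AE_cong)
  fix v assume v: "v \<in> Wsp0 s p \<Omega>" "AE x in lebesgue. 0 \<le> v x"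
  have "frac_plap s p u v = frac_plap s p u' v"
    using assms v by (intro frac_plap_cong) (auto simp: weak_solution_def Wsp0_def Wsp_def Lp_space_def)
  then show "frac_plap s p u' v = (\<integral>x. g x * v x \<partial>lebesgue_on \<Omega>)"
    using assms(1) v by (auto simp: weak_solution_def)
qed

lemma frac_plap_minus: "frac_plap s p (\<lambda>x. - u x) v = - frac_plap s p u v"
proof -
  have "\<bar>- a - - b\<bar> powr (p - 2) * (- a - - b) * c / d = - (\<bar>a - b\<bar> powr (p - 2) * (a - b) * c / d)" for a b c d :: real
  proof -
    have "- a - - b = - (a - b)" by simp
    then show ?thesis by (simp only: abs_minus_cancel mult_minus_left mult_minus_right minus_divide_left)
  qed
  then show ?thesis
    unfolding frac_plap_def by (simp only: case_prod_unfold Bochner_Integration.integral_minus)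
qed

lemma weak_solution_minus:
  assumes "weak_solution s p \<Omega> g u"
  shows "weak_solution s p \<Omega> (\<lambda>x. - g x) (\<lambda>x. - u x)"
proof -
  have "gagliardo_integrand s p (\<lambda>x. - u x) = gagliardo_integrand s p u"
    by (auto simp: gagliardo_integrand_def fun_eq_iff abs_minus_commute)
  then have "(\<lambda>x. - u x) \<in> Wsp0 s p \<Omega>"
    using assms by (auto simp: weak_solution_def Wsp0_def Wsp_def Lp_space_def finite_gagliardo_def)
  then show ?thesis using assms by (auto simp: weak_solution_def frac_plap_minus)
qed

section \<open>The fractional Sobolev inequality\<close>

text \<open>
  If \<open>|B|\<close> is a suitable multiple of \<open>A / |v x| powr t\<close> for a ball \<open>B\<close> about \<open>x\<close>, then by Chebyshev's inequality
  \<open>|v y| < |v x| / 2\<close> on at least half of \<open>B\<close>.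
\<close>

lemma point_energy_ge:
  fixes v :: "'a::euclidean_space \<Rightarrow> real" and s p t A N \<omega> :: real
  defines "N \<equiv> real DIM('a)" and "\<omega> \<equiv> unit_ball_vol (real DIM('a))"
  assumes [measurable]: "v \<in> borel_measurable borel"
    and sp: "0 < s" "0 < p" "0 < t" and A: "0 < A"
    and vA: "(\<integral>\<^sup>+y. ennreal (\<bar>v y\<bar> powr t) \<partial>lborel) \<le> ennreal A"
  shows "ennreal (\<omega> / 2 powr (p + 1) * (2 powr (t + 1) * A / \<omega>) powr (- (s * p / N)) * \<bar>v x\<bar> powr (p + t * s * p / N))
     \<le> point_energy s p v x"
proof (cases "v x = 0")
  case False
  define a where "a = \<bar>v x\<bar>"
  have a: "a > 0" using False by (simp add: a_def)
  have N: "N > 0" by (simp add: N_def)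
  have om: "\<omega> > 0" by (simp add: \<omega>_def)
  \<comment> \<open>\<open>b\<close> is Chebyshev's bound for the measure of \<open>T\<close>, and
    \<open>\<rho>\<close> gives the ball measure \<open>2 * b\<close>, so that measure at least
    \<open>b\<close> remains for \<open>S\<close>.\<close>
  define b where "b = A / (a / 2) powr t"
  have b: "b > 0" using A a by (simp add: b_def)
  define \<rho> where "\<rho> = (2 * b / \<omega>) powr (1 / N)"
  have rho: "\<rho> > 0" using b om by (simp add: \<rho>_def)
  have "\<rho> ^ DIM('a) = \<rho> powr N" using rho by (simp add: N_def powr_realpow)
  also have "\<dots> = 2 * b / \<omega>" using N b om by (simp add: \<rho>_def powr_powr)
  finally have rhoN: "\<omega> * \<rho> ^ DIM('a) = 2 * b" "\<rho> powr N = 2 * b / \<omega>"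
    using om \<open>\<rho> ^ DIM('a) = \<rho> powr N\<close> by auto
  define T where "T = {y. \<bar>v y\<bar> \<ge> a / 2}"
  define S where "S = ball x \<rho> - T"
  have [measurable]: "T \<in> sets borel" unfolding T_def by measurable
  have [measurable]: "S \<in> sets borel" unfolding S_def by measurable
  have "ennreal ((a/2) powr t) * emeasure lborel T = (\<integral>\<^sup>+y. ennreal ((a/2) powr t) * indicator T y \<partial>lborel)"
    by (simp add: nn_integral_cmult_indicator)
  also have "\<dots> \<le> (\<integral>\<^sup>+y. ennreal (\<bar>v y\<bar> powr t) \<partial>lborel)"
    using sp a by (intro nn_integral_mono) (auto simp: T_def indicator_def intro!: ennreal_leI powr_mono2)
  also have "\<dots> \<le> ennreal A" by (rule vA)
  finally have T1: "ennreal ((a/2) powr t) * emeasure lborel T \<le> ennreal A" .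
  have T: "emeasure lborel T \<le> ennreal b"
  proof -
    have "emeasure lborel T = ennreal (1 / (a/2) powr t) * (ennreal ((a/2) powr t) * emeasure lborel T)"
      using a by (simp add: mult.assoc[symmetric] ennreal_mult[symmetric])
    also have "\<dots> \<le> ennreal (1 / (a/2) powr t) * ennreal A" using T1 by (rule mult_left_mono) auto
    also have "\<dots> = ennreal b" using a A by (simp add: ennreal_mult[symmetric] b_def)
    finally show ?thesis .
  qed
  have "ennreal (2 * b) = emeasure lborel (ball x \<rho>)"
    using rhoN emeasure_ball[of \<rho> x] rho by (simp add: \<omega>_def)
  also have "\<dots> \<le> emeasure lborel (S \<union> T)" by (intro emeasure_mono) (auto simp: S_def)
  also have "\<dots> \<le> emeasure lborel S + emeasure lborel T" by (intro emeasure_subadditive) auto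
  also have "\<dots> \<le> emeasure lborel S + ennreal b" using T by (intro add_left_mono)
  finally have "ennreal (2 * b) \<le> emeasure lborel S + ennreal b" .
  then have S: "ennreal b \<le> emeasure lborel S"
    using b by (cases "emeasure lborel S") (auto simp: ennreal_plus[symmetric] simp del: ennreal_plus)
  have ptw: "(a/2) powr p / \<rho> powr (N + s * p) \<le> gagliardo_integrand s p v (x, y)" if "y \<in> S" for y
  proof -
    have y: "\<bar>v y\<bar> < a/2" "dist x y < \<rho>" using that by (auto simp: S_def T_def)
    have xy: "x \<noteq> y" using y a by (auto simp: a_def)
    have "a / 2 \<le> \<bar>v x - v y\<bar>" using y(1) unfolding a_def by linarith
    then have 1: "(a/2) powr p \<le> \<bar>v x - v y\<bar> powr p" using a sp by (intro powr_mono2) auto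
    have 2: "norm (x - y) powr (N + s * p) \<le> \<rho> powr (N + s * p)"
      using y(2) sp N by (intro powr_mono2) (auto simp: dist_norm)
    show ?thesis using 1 2 xy rho
      by (auto simp: gagliardo_integrand_def N_def intro!: frac_le)
  qed
  have "ennreal ((a/2) powr p / \<rho> powr (N + s * p) * b) = ennreal ((a/2) powr p / \<rho> powr (N + s * p)) * ennreal b"
    using b by (simp add: ennreal_mult[symmetric])
  also have "\<dots> \<le> ennreal ((a/2) powr p / \<rho> powr (N + s * p)) * emeasure lborel S"
    using S by (rule mult_left_mono) auto
  also have "\<dots> = (\<integral>\<^sup>+y. ennreal ((a/2) powr p / \<rho> powr (N + s * p)) * indicator S y \<partial>lborel)"
    by (simp add: nn_integral_cmult_indicator)
  also have "\<dots> \<le> point_energy s p v x" unfolding point_energy_def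
    using ptw by (intro nn_integral_mono) (auto simp: indicator_def intro!: ennreal_leI)
  finally have fin: "ennreal ((a/2) powr p / \<rho> powr (N + s * p) * b) \<le> point_energy s p v x" .
  have bb: "2 * b / \<omega> = (2 powr (t + 1) * A / \<omega>) * a powr (- t)"
    using a by (simp add: b_def powr_divide powr_add powr_minus field_simps)
  have "(a/2) powr p / \<rho> powr (N + s * p) * b = (a/2) powr p * (\<rho> powr (- (s * p))) * (b / \<rho> powr N)"
    using rho by (simp add: powr_add powr_minus divide_simps)
  also have "b / \<rho> powr N = \<omega> / 2" using b om by (simp add: rhoN(2))
  also have "\<rho> powr (- (s * p)) = ((2 powr (t + 1) * A / \<omega>) * a powr (- t)) powr (- (s * p / N))"
    unfolding \<rho>_def powr_powr bb[symmetric] by simp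
  also have "\<dots> = (2 powr (t + 1) * A / \<omega>) powr (- (s * p / N)) * a powr (t * s * p / N)"
    using a A om by (subst powr_mult) (auto simp: powr_powr mult.assoc)
  also have "(a/2) powr p * ((2 powr (t + 1) * A / \<omega>) powr (- (s * p / N)) * a powr (t * s * p / N)) * (\<omega> / 2) =
      \<omega> / 2 powr (p + 1) * (2 powr (t + 1) * A / \<omega>) powr (- (s * p / N)) * a powr (p + t * s * p / N)"
  proof -
    have "(a/2) powr p * (Z * W) * (\<omega> / 2) = \<omega> / 2 powr (p + 1) * Z * (a powr p * W)" for Z W
      using a by (simp add: powr_divide powr_add)
    then show ?thesis by (simp only: powr_add)
  qed
  finally have eq: "(a/2) powr p / \<rho> powr (N + s * p) * b =
      \<omega> / 2 powr (p + 1) * (2 powr (t + 1) * A / \<omega>) powr (- (s * p / N)) * a powr (p + t * s * p / N)" .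
  show ?thesis using fin unfolding eq unfolding a_def .
qed simp

text \<open>Integrating \<open>point_energy_ge\<close> over x bounds the integral of |v|^t1, t1 = p
  + t s p / N, by a multiple of A^(s p / N) times the energy, where A is the integral of |v|^t. The
  hypothesis on t says exactly t \<le> t1, so on a set of finite measure the power t is controlled
  by the power t1 and a constant. Boundedness of v makes A finite, hence half of A can be
  absorbed.\<close>

lemma Sobolev_bounded:
  fixes s p t \<mu> N :: real and \<Omega> :: "'a::euclidean_space set"
  defines "N \<equiv> real DIM('a)"
  assumes sp: "0 < s" "0 < p" "0 < t" "t * (N - s * p) \<le> N * p"
    and Om[measurable]: "\<Omega> \<in> sets borel" and mu: "0 < \<mu>" "emeasure lborel \<Omega> \<le> ennreal \<mu>"
  shows "\<exists>K>0. \<forall>v\<in>borel_measurable borel. (\<exists>k. \<forall>x. \<bar>v x\<bar> \<le> k) \<longrightarrow> (AE x in lborel. x \<notin> \<Omega> \<longrightarrow> v x = 0) \<longrightarrow>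
     nonlocal_energy s p v < \<infinity> \<longrightarrow>
     enn2real (\<integral>\<^sup>+x. ennreal (\<bar>v x\<bar> powr t) \<partial>lborel) powr (p / t) \<le> K * enn2real (nonlocal_energy s p v)"
proof -
  define \<omega> where "\<omega> = unit_ball_vol (real DIM('a))"
  define c where "c = \<omega> / 2 powr (p + 1) * (2 powr (t + 1) / \<omega>) powr (- (s * p / N))"
  define t1 where "t1 = p + t * s * p / N"
  define K where "K = 2 * (2 * \<mu>) powr (p / t + s * p / N - 1) / c"
  have N: "N > 0" by (simp add: N_def)
  have om: "\<omega> > 0" by (simp add: \<omega>_def)
  have c: "c > 0" using om by (simp add: c_def)
  have K: "K > 0" using mu c by (simp add: K_def)
  have "t1 * N = p * N + t * s * p" using N by (simp add: t1_def distrib_right)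
  then have "t * N \<le> t1 * N" using sp(4) by (simp add: right_diff_distrib mult_ac)
  then have t1: "t1 \<ge> t" using N by simp
  show ?thesis
  proof (intro exI[of _ K] conjI K ballI impI)
    fix v :: "'a \<Rightarrow> real" assume v[measurable]: "v \<in> borel_measurable borel" and "\<exists>k. \<forall>x. \<bar>v x\<bar> \<le> k"
      and v0: "AE x in lborel. x \<notin> \<Omega> \<longrightarrow> v x = 0" and E: "nonlocal_energy s p v < \<infinity>"
    then obtain k where k: "\<And>x. \<bar>v x\<bar> \<le> k" by auto
    define I where "I = (\<integral>\<^sup>+x. ennreal (\<bar>v x\<bar> powr t) \<partial>lborel)"
    define A where "A = enn2real I"
    have "I \<le> (\<integral>\<^sup>+x. ennreal (k powr t) * indicator \<Omega> x \<partial>lborel)"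
      unfolding I_def
    proof (rule nn_integral_mono_AE)
      show "AE x in lborel. ennreal (\<bar>v x\<bar> powr t) \<le> ennreal (k powr t) * indicator \<Omega> x"
        using v0 by eventually_elim (use k sp in \<open>auto simp: indicator_def intro!: ennreal_leI powr_mono2\<close>)
    qed
    also have "\<dots> = ennreal (k powr t) * emeasure lborel \<Omega>" by (simp add: nn_integral_cmult_indicator)
    also have "\<dots> \<le> ennreal (k powr t) * ennreal \<mu>" using mu by (intro mult_left_mono) auto
    also have "\<dots> < \<infinity>" by (simp add: ennreal_mult_less_top)
    finally have I: "I = ennreal A" "I < \<infinity>" by (auto simp: A_def)
    have "A powr (p / t) \<le> K * enn2real (nonlocal_energy s p v)"
    proof (cases "A = 0")
      case False
      then have A: "A > 0" by (simp add: A_def less_le)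
      define d where "d = c * A powr (- (s * p / N))"
      have d: "d > 0" using c A by (simp add: d_def)
      define e where "e = enn2real (nonlocal_energy s p v)"
      have e: "nonlocal_energy s p v = ennreal e" "e \<ge> 0" using E by (auto simp: e_def)
      have pe: "ennreal (d * \<bar>v x\<bar> powr t1) \<le> point_energy s p v x" for x
      proof -
        have "(2 powr (t + 1) * A / \<omega>) powr (- (s * p / N)) = (2 powr (t + 1) / \<omega>) powr (- (s * p / N)) * A powr (- (s * p / N))"
          using A om by (subst powr_mult[symmetric]) auto
        then show ?thesis
          using point_energy_ge[OF v sp(1-3) A, of x] I
          by (simp add: d_def c_def t1_def I_def \<omega>_def N_def mult.assoc)
      qed
      have "ennreal d * (\<integral>\<^sup>+x. ennreal (\<bar>v x\<bar> powr t1) \<partial>lborel) = (\<integral>\<^sup>+x. ennreal (d * \<bar>v x\<bar> powr t1) \<partial>lborel)"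
        using d by (simp add: nn_integral_cmult ennreal_mult)
      also have "\<dots> \<le> (\<integral>\<^sup>+x. point_energy s p v x \<partial>lborel)" by (intro nn_integral_mono pe)
      also have "\<dots> = ennreal e" using nonlocal_energy_eq_point_energy(1)[OF v, of s p] e by simp
      finally have J: "ennreal d * (\<integral>\<^sup>+x. ennreal (\<bar>v x\<bar> powr t1) \<partial>lborel) \<le> ennreal e" .
      have J': "(\<integral>\<^sup>+x. ennreal (\<bar>v x\<bar> powr t1) \<partial>lborel) \<le> ennreal (e / d)"
      proof -
        have "(\<integral>\<^sup>+x. ennreal (\<bar>v x\<bar> powr t1) \<partial>lborel) = ennreal (1 / d) * (ennreal d * (\<integral>\<^sup>+x. ennreal (\<bar>v x\<bar> powr t1) \<partial>lborel))"
          using d by (simp add: mult.assoc[symmetric] ennreal_mult[symmetric])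
        also have "\<dots> \<le> ennreal (1 / d) * ennreal e" using J by (rule mult_left_mono) auto
        also have "\<dots> = ennreal (e / d)" using d e by (simp add: ennreal_mult[symmetric])
        finally show ?thesis .
      qed
      \<comment> \<open>The level at which splitting costs \<open>l powr t * \<mu> = A / 2\<close>,
        the half of \<open>A\<close> that is absorbed.\<close>
      define l where "l = (A / (2 * \<mu>)) powr (1 / t)"
      have l: "l > 0" using A mu by (simp add: l_def)
      have lt: "l powr t = A / (2 * \<mu>)" using A mu sp by (simp add: l_def powr_powr)
      have ptw: "y powr t \<le> l powr t + l powr (t - t1) * y powr t1" if "y \<ge> 0" for y
      proof (cases "y \<le> l")
        case True
        then have "y powr t \<le> l powr t" using that sp by (intro powr_mono2) auto
        then show ?thesis by (simp add: add_increasing2)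
      next
        case False
        then have "y powr (t - t1) \<le> l powr (t - t1)" using l t1 by (intro powr_mono2') auto
        then have "y powr (t - t1) * y powr t1 \<le> l powr (t - t1) * y powr t1" by (intro mult_right_mono) auto
        moreover have "y powr (t - t1) * y powr t1 = y powr t" using False l by (simp add: powr_add[symmetric])
        moreover have "l powr t \<ge> 0" by simp
        ultimately show ?thesis by linarith
      qed
      have "I \<le> (\<integral>\<^sup>+x. ennreal (l powr t) * indicator \<Omega> x + ennreal (l powr (t - t1)) * ennreal (\<bar>v x\<bar> powr t1) \<partial>lborel)"
        unfolding I_def
      proof (rule nn_integral_mono_AE)
        show "AE x in lborel. ennreal (\<bar>v x\<bar> powr t)
           \<le> ennreal (l powr t) * indicator \<Omega> x + ennreal (l powr (t - t1)) * ennreal (\<bar>v x\<bar> powr t1)"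
          using v0
        proof eventually_elim
          case (elim x)
          show ?case
          proof (cases "x \<in> \<Omega>")
            case True
            have "ennreal (\<bar>v x\<bar> powr t) \<le> ennreal (l powr t + l powr (t - t1) * \<bar>v x\<bar> powr t1)"
              using ptw[of "\<bar>v x\<bar>"] by (intro ennreal_leI) auto
            then show ?thesis using True by (simp add: ennreal_mult)
          qed (use elim in auto)
        qed
      qed
      also have "\<dots> = ennreal (l powr t) * emeasure lborel \<Omega> + ennreal (l powr (t - t1)) * (\<integral>\<^sup>+x. ennreal (\<bar>v x\<bar> powr t1) \<partial>lborel)"
        by (simp add: nn_integral_add nn_integral_cmult nn_integral_cmult_indicator)
      also have "\<dots> \<le> ennreal (l powr t) * ennreal \<mu> + ennreal (l powr (t - t1)) * ennreal (e / d)"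
        using mu J' by (intro add_mono mult_left_mono) auto
      also have "\<dots> = ennreal (l powr t * \<mu> + l powr (t - t1) * (e / d))"
        using mu e(2) d by (subst ennreal_plus) (auto simp: ennreal_mult[symmetric])
      finally have "ennreal A \<le> ennreal (l powr t * \<mu> + l powr (t - t1) * (e / d))"
        by (simp only: I(1)[symmetric])
      moreover have "0 \<le> l powr t * \<mu> + l powr (t - t1) * (e / d)"
        using mu(1) e(2) d by (intro add_nonneg_nonneg mult_nonneg_nonneg) auto
      ultimately have "A \<le> l powr t * \<mu> + l powr (t - t1) * (e / d)"
        by (simp only: ennreal_le_iff)
      moreover have "l powr t * \<mu> = A / 2" using mu(1) by (simp add: lt)
      ultimately have "A / 2 \<le> l powr (t - t1) * (e / d)" by linarith
      also have "l powr (t - t1) = (A / (2 * \<mu>)) powr (1 - p / t - s * p / N)"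
      proof -
        have "1 / t * (t - t1) = 1 - p / t - s * p / N" using sp(3) N by (simp add: t1_def field_simps)
        then show ?thesis by (simp only: l_def powr_powr)
      qed
      also have "\<dots> = A powr (1 - p / t - s * p / N) * (2 * \<mu>) powr (- (1 - p / t - s * p / N))"
        using A mu(1) powr_minus_divide[of "2 * \<mu>" "1 - p / t - s * p / N"] powr_divide[of A "2 * \<mu>"] by simp
      also have "- (1 - p / t - s * p / N) = p / t + s * p / N - 1" by simp
      also have "e / d = e * A powr (s * p / N) / c"
        by (simp add: d_def powr_minus divide_simps)
      finally have "A / 2 \<le> (A powr (1 - p / t - s * p / N) * A powr (s * p / N)) * (K * e) / 2"
        by (simp add: K_def mult_ac)
      also have "A powr (1 - p / t - s * p / N) * A powr (s * p / N) = A / A powr (p / t)"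
      proof -
        have "A powr (1 - p / t - s * p / N) * A powr (s * p / N) = A powr (1 - p / t)"
          by (simp add: powr_add[symmetric])
        also have "\<dots> = A / A powr (p / t)" using A by (simp add: powr_diff)
        finally show ?thesis .
      qed
      finally have "A * 1 \<le> A * (K * e / A powr (p / t))" by simp
      then have "1 \<le> K * e / A powr (p / t)" using A by (simp only: mult_le_cancel_left_pos)
      then have "A powr (p / t) \<le> K * e" using A by (simp add: le_divide_eq)
      then show ?thesis by (simp only: e_def)
    qed (use K in simp)
    then show "enn2real (\<integral>\<^sup>+x. ennreal (\<bar>v x\<bar> powr t) \<partial>lborel) powr (p / t) \<le> K * enn2real (nonlocal_energy s p v)"
      by (simp add: A_def I_def)
  qed
qed

section \<open>Test functions\<close>

lemma gagliardo_integrand_Lipschitz: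
  assumes L: "\<And>a b. \<bar>f a - f b\<bar> \<le> L * \<bar>a - b\<bar>" "L \<ge> 0" and "p > 0"
  shows "gagliardo_integrand s p (\<lambda>x. f (u x)) z \<le> L powr p * gagliardo_integrand s p u z"
proof -
  have "\<bar>f a - f b\<bar> powr p \<le> L powr p * \<bar>a - b\<bar> powr p" for a b
    using powr_mono2[OF _ _ L(1), of p a b] assms by (simp add: powr_mult)
  then show ?thesis
    by (auto simp: gagliardo_integrand_def split: prod.splits intro!: divide_right_mono)
qed

lemma Lipschitz_borel_measurable:
  fixes f :: "real \<Rightarrow> real"
  assumes L: "\<And>a b. \<bar>f a - f b\<bar> \<le> L * \<bar>a - b\<bar>" "L \<ge> 0"
  shows "f \<in> borel_measurable borel"
proof (rule borel_measurable_continuous_onI)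
  have "L-lipschitz_on UNIV f"
    using L by (auto simp: lipschitz_on_def dist_real_def)
  then show "continuous_on UNIV f" by (rule lipschitz_on_continuous_on)
qed

lemma Wsp0_Lipschitz:
  fixes u :: "'a::euclidean_space \<Rightarrow> real"
  assumes L: "\<And>a b. \<bar>f a - f b\<bar> \<le> L * \<bar>a - b\<bar>" "L \<ge> 0" and f0: "f 0 = 0" and p: "p > 0"
    and u: "u \<in> Wsp0 s p \<Omega>" and [measurable]: "u \<in> borel_measurable borel"
  shows "(\<lambda>x. f (u x)) \<in> Wsp0 s p \<Omega>"
proof (rule Wsp0_borelI)
  note uD = Wsp0_borelD[OF u assms(6)]
  have [measurable]: "f \<in> borel_measurable borel" using L by (rule Lipschitz_borel_measurable)
  show "(\<lambda>x. f (u x)) \<in> borel_measurable borel" by measurable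
  show "AE x in lborel. x \<notin> \<Omega> \<longrightarrow> f (u x) = 0"
    using uD(2) by eventually_elim (auto simp: f0)
  have "nonlocal_energy s p (\<lambda>x. f (u x)) \<le> (\<integral>\<^sup>+z. ennreal (L powr p) * ennreal (gagliardo_integrand s p u z) \<partial>lborel)"
    unfolding nonlocal_energy_def
    using gagliardo_integrand_Lipschitz[where f=f, OF L p]
    by (intro nn_integral_mono) (auto simp: ennreal_mult[symmetric] intro!: ennreal_leI)
  also have "\<dots> = ennreal (L powr p) * nonlocal_energy s p u"
    unfolding nonlocal_energy_def by (intro nn_integral_cmult) auto
  also have "\<dots> < \<infinity>" using uD(1) by (simp add: ennreal_mult_less_top)
  finally show "nonlocal_energy s p (\<lambda>x. f (u x)) < \<infinity>" .
  have "\<bar>f a\<bar> powr p \<le> L powr p * \<bar>a\<bar> powr p" for a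
    using powr_mono2[OF _ _ L(1), of p a 0] L p f0 by (simp add: powr_mult)
  then have "(\<integral>\<^sup>+x. ennreal (\<bar>f (u x)\<bar> powr p) \<partial>lborel) \<le> (\<integral>\<^sup>+x. ennreal (L powr p) * ennreal (\<bar>u x\<bar> powr p) \<partial>lborel)"
    by (intro nn_integral_mono) (auto simp: ennreal_mult[symmetric] intro!: ennreal_leI)
  also have "\<dots> = ennreal (L powr p) * (\<integral>\<^sup>+x. ennreal (\<bar>u x\<bar> powr p) \<partial>lborel)"
    by (intro nn_integral_cmult) auto
  also have "\<dots> < \<infinity>" using uD(3) by (simp add: ennreal_mult_less_top)
  finally show "(\<integral>\<^sup>+x. ennreal (\<bar>f (u x)\<bar> powr p) \<partial>lborel) < \<infinity>" .
qed

text \<open>The difference form of \<phi>' = (G')^p, since a nonlocal operator sees only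
  differences: the last inequality is what Hoelder's inequality gives for the integral of G' over
  [b, a]. The Lipschitz bound keeps \<phi>(u) in the energy space; vanishing on the negative axis
  and monotonicity make it nonnegative, hence admissible.\<close>

definition test_pair :: "real \<Rightarrow> (real \<Rightarrow> real) \<Rightarrow> (real \<Rightarrow> real) \<Rightarrow> bool" where
  "test_pair p \<phi> G \<longleftrightarrow> (\<forall>x\<le>0. \<phi> x = 0) \<and> G 0 = 0 \<and>
     (\<exists>L. \<forall>a b. b \<le> a \<longrightarrow> 0 \<le> \<phi> a - \<phi> b \<and> \<phi> a - \<phi> b \<le> L * (a - b) \<and>
        \<bar>G a - G b\<bar> powr p \<le> (a - b) powr (p - 1) * (\<phi> a - \<phi> b))"

text \<open>Inserting the Lipschitz bound of \<phi> into the last inequality of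
  \<open>test_pair\<close> shows that G is Lipschitz too, with constant L^(1/p).\<close>

lemma test_pair_Lipschitz:
  assumes "test_pair p \<phi> G" "p > 1"
  obtains L M where "L \<ge> 0" "M \<ge> 0" "\<And>a b. \<bar>\<phi> a - \<phi> b\<bar> \<le> L * \<bar>a - b\<bar>" "\<And>a b. \<bar>G a - G b\<bar> \<le> M * \<bar>a - b\<bar>"
proof -
  obtain L0 where L0: "\<And>a b. b \<le> a \<Longrightarrow> 0 \<le> \<phi> a - \<phi> b \<and> \<phi> a - \<phi> b \<le> L0 * (a - b) \<and>
        \<bar>G a - G b\<bar> powr p \<le> (a - b) powr (p - 1) * (\<phi> a - \<phi> b)"
    using assms unfolding test_pair_def by blast
  define L where "L = \<bar>L0\<bar>"
  have L: "\<phi> a - \<phi> b \<le> L * (a - b)" if "b \<le> a" for a b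
    using L0[OF that] mult_right_mono[of L0 L "a - b"] that unfolding L_def by linarith
  have 1: "\<bar>\<phi> a - \<phi> b\<bar> \<le> L * \<bar>a - b\<bar>" for a b
    using L[of a b] L[of b a] L0[of a b] L0[of b a] by (cases "b \<le> a") auto
  define M where "M = L powr (1 / p)"
  have G: "\<bar>G a - G b\<bar> \<le> M * (a - b)" if "b \<le> a" for a b
  proof -
    have "\<bar>G a - G b\<bar> powr p \<le> (a - b) powr (p - 1) * (\<phi> a - \<phi> b)" using L0[OF that] by simp
    also have "\<dots> \<le> (a - b) powr (p - 1) * (L * (a - b))" using L[OF that] by (rule mult_left_mono) auto
    also have "\<dots> = L * (a - b) powr p"
      using that by (cases "a = b") (auto simp: powr_diff)
    finally have "(\<bar>G a - G b\<bar> powr p) powr (1 / p) \<le> (L * (a - b) powr p) powr (1 / p)"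
      using assms by (intro powr_mono2) auto
    then show ?thesis using assms that by (simp add: powr_powr powr_mult M_def L_def)
  qed
  have 2: "\<bar>G a - G b\<bar> \<le> M * \<bar>a - b\<bar>" for a b
    using G[of a b] G[of b a] by (cases "b \<le> a") (auto simp: abs_minus_commute)
  show thesis using that[of L M] 1 2 by (auto simp: L_def M_def)
qed

text \<open>Divided by |x - y|^(N + s p), the inequality of \<open>test_pair\<close> puts the
  Gagliardo integrand of G(u) pointwise below the integrand of the pairing of u with \<phi>(u), and
  the equation gives the value of that pairing.\<close>

lemma test_pair_energy_le:
  fixes u :: "'a::euclidean_space \<Rightarrow> real"
  assumes p: "p > 1" and ws: "weak_solution s p \<Omega> g u" and um[measurable]: "u \<in> borel_measurable borel"
    and tp: "test_pair p \<phi> G"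
  shows "nonlocal_energy s p (\<lambda>x. G (u x)) \<le> ennreal (\<integral>x. g x * \<phi> (u x) \<partial>lebesgue_on \<Omega>)"
    and "0 \<le> (\<integral>x. g x * \<phi> (u x) \<partial>lebesgue_on \<Omega>)"
    and "(\<lambda>x. \<phi> (u x)) \<in> Wsp0 s p \<Omega>" and "(\<lambda>x. G (u x)) \<in> Wsp0 s p \<Omega>"
proof -
  obtain L M where L: "L \<ge> 0" "\<And>a b. \<bar>\<phi> a - \<phi> b\<bar> \<le> L * \<bar>a - b\<bar>"
    and M: "M \<ge> 0" "\<And>a b. \<bar>G a - G b\<bar> \<le> M * \<bar>a - b\<bar>"
    using test_pair_Lipschitz[OF tp p] by metis
  have mono: "0 \<le> \<phi> a - \<phi> b" and GG: "\<bar>G a - G b\<bar> powr p \<le> (a - b) powr (p - 1) * (\<phi> a - \<phi> b)" if "b \<le> a" for a b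
    using tp that unfolding test_pair_def by blast+
  have z: "\<phi> x = 0" if "x \<le> 0" for x using tp that by (auto simp: test_pair_def)
  have G0: "G 0 = 0" using tp by (simp add: test_pair_def)
  have nn: "\<phi> x \<ge> 0" for x using mono[of 0 x] z[of 0] z[of x] by (cases "x \<le> 0") auto
  have [measurable]: "\<phi> \<in> borel_measurable borel" "G \<in> borel_measurable borel"
    using Lipschitz_borel_measurable[OF L(2,1)] Lipschitz_borel_measurable[OF M(2,1)] by auto
  have u: "u \<in> Wsp0 s p \<Omega>" using ws by (simp add: weak_solution_def)
  show \<phi>u: "(\<lambda>x. \<phi> (u x)) \<in> Wsp0 s p \<Omega>"
    using Wsp0_Lipschitz[of \<phi>, OF L(2,1) _ _ u um] z p by auto
  show "(\<lambda>x. G (u x)) \<in> Wsp0 s p \<Omega>"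
    using Wsp0_Lipschitz[of G, OF M(2,1) _ _ u um] G0 p by auto
  define F where "F = (\<lambda>(x, y). \<bar>u x - u y\<bar> powr (p - 2) * (u x - u y) * (\<phi> (u x) - \<phi> (u y))
        / norm (x - y) powr (real DIM('a) + s * p))"
  have key: "\<bar>G a - G b\<bar> powr p \<le> \<bar>a - b\<bar> powr (p - 2) * (a - b) * (\<phi> a - \<phi> b) \<and>
      \<bar>a - b\<bar> powr (p - 2) * (a - b) * (\<phi> a - \<phi> b) \<le> L * \<bar>a - b\<bar> powr p" for a b
  proof -
    have *: "\<bar>G a - G b\<bar> powr p \<le> \<bar>a - b\<bar> powr (p - 2) * (a - b) * (\<phi> a - \<phi> b) \<and>
      \<bar>a - b\<bar> powr (p - 2) * (a - b) * (\<phi> a - \<phi> b) \<le> L * \<bar>a - b\<bar> powr p" if "b \<le> a" for a b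
    proof (cases "a = b")
      case False
      then have d: "a - b > 0" using that by simp
      have 1: "\<bar>a - b\<bar> powr (p - 2) * (a - b) = (a - b) powr (p - 1)"
        using d powr_mult_base[of "a - b" "p - 2"] by (simp add: mult.commute)
      have "(a - b) powr (p - 1) * (\<phi> a - \<phi> b) \<le> (a - b) powr (p - 1) * (L * (a - b))"
        using L(2)[of a b] d by (intro mult_left_mono) auto
      also have "\<dots> = L * ((a - b) * (a - b) powr (p - 1))" by simp
      also have "(a - b) * (a - b) powr (p - 1) = (a - b) powr p"
        using d powr_mult_base[of "a - b" "p - 1"] by simp
      finally have "(a - b) powr (p - 1) * (\<phi> a - \<phi> b) \<le> L * \<bar>a - b\<bar> powr p" using d by simp
      then show ?thesis using GG[OF that] by (simp only: 1)
    qed simp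
    show ?thesis
    proof (cases "b \<le> a")
      case False
      then have "a \<le> b" by simp
      have "(b - a) * (\<phi> b - \<phi> a) = (a - b) * (\<phi> a - \<phi> b)" by (simp add: algebra_simps)
      then have "\<bar>b - a\<bar> powr (p - 2) * (b - a) * (\<phi> b - \<phi> a) = \<bar>a - b\<bar> powr (p - 2) * (a - b) * (\<phi> a - \<phi> b)"
        by (simp only: mult.assoc abs_minus_commute)
      then show ?thesis using *[OF \<open>a \<le> b\<close>] by (simp only: abs_minus_commute)
    qed (use * in blast)
  qed
  have F1: "gagliardo_integrand s p (\<lambda>x. G (u x)) z \<le> F z" for z
    using key by (cases z) (auto simp: F_def gagliardo_integrand_def intro!: divide_right_mono)
  \<comment> \<open>This upper bound makes \<open>F\<close> integrable. Otherwise
    \<open>frac_plap\<close> would be the default value \<open>0\<close> and carry no information on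
    the energy.\<close>
  have F2: "F z \<le> L * gagliardo_integrand s p u z" for z
    using key by (cases z) (auto simp: F_def gagliardo_integrand_def times_divide_eq_right intro!: divide_right_mono)
  have F0: "0 \<le> F z" for z using F1[of z] order_trans[OF gagliardo_integrand_nonneg F1] by auto
  have Fm[measurable]: "F \<in> borel_measurable borel"
    unfolding F_def borel_prod[symmetric] by measurable
  have "(\<integral>\<^sup>+z. ennreal (F z) \<partial>lborel) \<le> (\<integral>\<^sup>+z. ennreal L * ennreal (gagliardo_integrand s p u z) \<partial>lborel)"
    using F2 L(1) by (intro nn_integral_mono) (auto simp: ennreal_mult[symmetric] intro!: ennreal_leI)
  also have "\<dots> = ennreal L * nonlocal_energy s p u"
    unfolding nonlocal_energy_def by (intro nn_integral_cmult) auto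
  also have "\<dots> < \<infinity>" using Wsp0_borelD(1)[OF u um] by (simp add: ennreal_mult_less_top)
  finally have fin: "(\<integral>\<^sup>+z. ennreal (F z) \<partial>lborel) < \<infinity>" .
  have "(\<integral>x. g x * \<phi> (u x) \<partial>lebesgue_on \<Omega>) = frac_plap s p u (\<lambda>x. \<phi> (u x))"
    using ws \<phi>u nn by (auto simp: weak_solution_def)
  also have "\<dots> = (\<integral>z. F z \<partial>lebesgue)" by (simp add: frac_plap_def F_def)
  also have "\<dots> = enn2real (\<integral>\<^sup>+z. ennreal (F z) \<partial>lborel)"
    by (rule integrable_lebesgue_nonneg_cong) (use F0 in auto)
  finally have eq: "(\<integral>x. g x * \<phi> (u x) \<partial>lebesgue_on \<Omega>) = enn2real (\<integral>\<^sup>+z. ennreal (F z) \<partial>lborel)" .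
  show "0 \<le> (\<integral>x. g x * \<phi> (u x) \<partial>lebesgue_on \<Omega>)" unfolding eq by simp
  have "nonlocal_energy s p (\<lambda>x. G (u x)) \<le> (\<integral>\<^sup>+z. ennreal (F z) \<partial>lborel)"
    unfolding nonlocal_energy_def using F1 by (intro nn_integral_mono ennreal_leI)
  then show "nonlocal_energy s p (\<lambda>x. G (u x)) \<le> ennreal (\<integral>x. g x * \<phi> (u x) \<partial>lebesgue_on \<Omega>)"
    unfolding eq using fin by simp
qed

section \<open>From the weak formulation to inequalities on \<Omega>\<close>

lemma lebesgue_on_integral_eq:
  fixes v :: "'a::euclidean_space \<Rightarrow> real"
  assumes [measurable]: "v \<in> borel_measurable borel" and \<Omega>: "\<Omega> \<in> sets borel"
    and v0: "AE x in lborel. x \<notin> \<Omega> \<longrightarrow> v x = 0" and nn: "\<And>x. 0 \<le> v x"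
  shows "(\<integral>x. v x \<partial>lebesgue_on \<Omega>) = enn2real (\<integral>\<^sup>+x. ennreal (v x) \<partial>lborel)"
proof -
  have "(\<integral>x. v x \<partial>lebesgue_on \<Omega>) = (\<integral>x. indicator \<Omega> x *\<^sub>R v x \<partial>lebesgue)"
    using \<Omega> by (subst integral_restrict_space) auto
  also have "\<dots> = enn2real (\<integral>\<^sup>+x. ennreal (v x) \<partial>lborel)"
  proof (rule integrable_lebesgue_nonneg_cong)
    show "AE x in lborel. indicator \<Omega> x *\<^sub>R v x = v x"
      using v0 by eventually_elim (auto simp: indicator_def)
  qed (use nn in auto)
  finally show ?thesis .
qed

text \<open>
  \<open>energy_bound\<close> is all that the integral estimates use of the equation: the test-function
  inequality combined with the Sobolev inequality.
\<close>

definition energy_bound ::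
    "'a measure \<Rightarrow> real \<Rightarrow> real \<Rightarrow> real \<Rightarrow> ('a \<Rightarrow> real) \<Rightarrow> ('a \<Rightarrow> real) \<Rightarrow> bool" where
  "energy_bound M p t \<Lambda> g u \<longleftrightarrow> (\<forall>\<phi> G. test_pair p \<phi> G \<longrightarrow> (\<exists>k. \<forall>x. \<bar>G x\<bar> \<le> k) \<longrightarrow>
     \<Lambda> * (\<integral>x. \<bar>G (u x)\<bar> powr t \<partial>M) powr (p / t) \<le> (\<integral>x. g x * \<phi> (u x) \<partial>M))"

lemma Sobolev_energy_bound:
  fixes s p t N :: real and \<Omega> :: "'a::euclidean_space set"
  defines "N \<equiv> real DIM('a)"
  assumes sp: "0 < s" "1 < p" "0 < t" "t * (N - s * p) \<le> N * p" and \<Omega>: "open \<Omega>" "bounded \<Omega>"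
  shows "\<exists>\<Lambda>>0. \<forall>g u. weak_solution s p \<Omega> g u \<longrightarrow> u \<in> borel_measurable borel \<longrightarrow>
     energy_bound (lebesgue_on \<Omega>) p t \<Lambda> g u"
proof -
  \<comment> \<open>The summand \<open>1\<close> makes \<open>\<mu>\<close> positive, as
    \<open>Sobolev_bounded\<close> demands.\<close>
  define \<mu> where "\<mu> = measure lborel \<Omega> + 1"
  have fin: "emeasure lborel \<Omega> < \<infinity>" using \<Omega> emeasure_bounded_finite by blast
  then have mu: "0 < \<mu>" "emeasure lborel \<Omega> \<le> ennreal \<mu>"
    by (auto simp: \<mu>_def emeasure_eq_ennreal_measure add_nonneg_pos intro!: ennreal_leI)
  have \<Omega>b: "\<Omega> \<in> sets borel" using \<Omega> by simp
  obtain K where K: "K > 0" and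
    emb: "\<And>v. v\<in>borel_measurable borel \<Longrightarrow> \<exists>k. \<forall>x. \<bar>v x\<bar> \<le> k \<Longrightarrow> AE x in lborel. x \<notin> \<Omega> \<longrightarrow> v x = 0 \<Longrightarrow>
     nonlocal_energy s p v < \<infinity> \<Longrightarrow>
     enn2real (\<integral>\<^sup>+x. ennreal (\<bar>v x\<bar> powr t) \<partial>lborel) powr (p / t) \<le> K * enn2real (nonlocal_energy s p v)"
    using Sobolev_bounded[of s p t \<Omega> \<mu>] sp \<Omega>b mu unfolding N_def by auto
  show ?thesis unfolding energy_bound_def
  proof (intro exI[of _ "1 / K"] conjI allI impI)
    show "1 / K > 0" using K by simp
    fix g u assume ws: "weak_solution s p \<Omega> g u" and um[measurable]: "u \<in> borel_measurable borel"
    fix \<phi> G assume tp: "test_pair p \<phi> G" and bd: "\<exists>k. \<forall>x. \<bar>G x\<bar> \<le> (k::real)"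
    let ?v = "\<lambda>x. G (u x)"
    have [measurable]: "G \<in> borel_measurable borel"
      using test_pair_Lipschitz[OF tp sp(2)] Lipschitz_borel_measurable by metis
    have vW: "?v \<in> Wsp0 s p \<Omega>" using test_pair_energy_le(4)[OF sp(2) ws um tp] .
    have vm: "?v \<in> borel_measurable borel" by measurable
    note vD = Wsp0_borelD[OF vW vm]
    have "(\<integral>x. \<bar>G (u x)\<bar> powr t \<partial>lebesgue_on \<Omega>) = enn2real (\<integral>\<^sup>+x. ennreal (\<bar>?v x\<bar> powr t) \<partial>lborel)"
    proof (rule lebesgue_on_integral_eq)
      show "AE x in lborel. x \<notin> \<Omega> \<longrightarrow> \<bar>?v x\<bar> powr t = 0" using vD(2) by eventually_elim auto
    qed (use \<Omega>b in auto)
    then have "(\<integral>x. \<bar>G (u x)\<bar> powr t \<partial>lebesgue_on \<Omega>) powr (p / t) \<le> K * enn2real (nonlocal_energy s p ?v)"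
      using emb[OF vm _ vD(2,1)] bd by metis
    also have "enn2real (nonlocal_energy s p ?v) \<le> (\<integral>x. g x * \<phi> (u x) \<partial>lebesgue_on \<Omega>)"
      using test_pair_energy_le(1,2)[OF sp(2) ws um tp] enn2real_leI by blast
    finally show "1 / K * (\<integral>x. \<bar>G (u x)\<bar> powr t \<partial>lebesgue_on \<Omega>) powr (p / t) \<le> (\<integral>x. g x * \<phi> (u x) \<partial>lebesgue_on \<Omega>)"
      using K by (simp add: field_simps)
  qed
qed

text \<open>Makes G(u) a candidate in the infimum defining S. Its critical integrability comes from
  G being bounded and \<Omega> having finite measure, so that nothing about S is
  presupposed.\<close>

lemma test_pair_in_Dsp:
  fixes s p t :: real and \<Omega> :: "'a::euclidean_space set"
  defines "t \<equiv> sobolev_exponent TYPE('a) s p"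
  assumes sp: "1 < p" "s * p < real DIM('a)" and \<Omega>: "open \<Omega>" "bounded \<Omega>"
    and ws: "weak_solution s p \<Omega> g u" and um[measurable]: "u \<in> borel_measurable borel"
    and tp: "test_pair p \<phi> G" and bd: "\<exists>k. \<forall>x. \<bar>G x\<bar> \<le> k"
  shows "(\<lambda>x. G (u x)) \<in> Dsp s p"
    and "integrable lebesgue (\<lambda>x. \<bar>G (u x)\<bar> powr t)"
    and "(\<integral>x. \<bar>G (u x)\<bar> powr t \<partial>lebesgue_on \<Omega>) = (\<integral>x. \<bar>G (u x)\<bar> powr t \<partial>lebesgue)"
proof -
  have t: "t > 0" using sp by (simp add: t_def sobolev_exponent_def)
  let ?v = "\<lambda>x. G (u x)"
  have \<Omega>b: "\<Omega> \<in> sets borel" using \<Omega> by simp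
  have [measurable]: "G \<in> borel_measurable borel"
    using test_pair_Lipschitz[OF tp sp(1)] Lipschitz_borel_measurable by metis
  have vW: "?v \<in> Wsp0 s p \<Omega>" using test_pair_energy_le(4)[OF sp(1) ws um tp] .
  have vm: "?v \<in> borel_measurable borel" by measurable
  note vD = Wsp0_borelD[OF vW vm]
  obtain k where k: "\<And>x. \<bar>G x\<bar> \<le> k" using bd by auto
  have "(\<integral>\<^sup>+x. ennreal (\<bar>?v x\<bar> powr t) \<partial>lborel) \<le> (\<integral>\<^sup>+x. ennreal (k powr t) * indicator \<Omega> x \<partial>lborel)"
  proof (rule nn_integral_mono_AE)
    show "AE x in lborel. ennreal (\<bar>?v x\<bar> powr t) \<le> ennreal (k powr t) * indicator \<Omega> x"
      using vD(2) by eventually_elim (use k t in \<open>auto simp: indicator_def intro!: ennreal_leI powr_mono2\<close>)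
  qed
  also have "\<dots> = ennreal (k powr t) * emeasure lborel \<Omega>" using \<Omega>b by (simp add: nn_integral_cmult_indicator)
  also have "\<dots> < \<infinity>" using emeasure_bounded_finite[OF \<Omega>(2)] by (simp add: ennreal_mult_less_top)
  finally have fin: "(\<integral>\<^sup>+x. ennreal (\<bar>?v x\<bar> powr t) \<partial>lborel) < \<infinity>" .
  show int: "integrable lebesgue (\<lambda>x. \<bar>?v x\<bar> powr t)"
    using fin integrable_lebesgue_nonneg_cong(1)[of "\<lambda>x. \<bar>?v x\<bar> powr t" "\<lambda>x. \<bar>?v x\<bar> powr t"] by auto
  have "(\<integral>x. \<bar>G (u x)\<bar> powr t \<partial>lebesgue_on \<Omega>) = enn2real (\<integral>\<^sup>+x. ennreal (\<bar>?v x\<bar> powr t) \<partial>lborel)"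
  proof (rule lebesgue_on_integral_eq)
    show "AE x in lborel. x \<notin> \<Omega> \<longrightarrow> \<bar>?v x\<bar> powr t = 0" using vD(2) by eventually_elim auto
  qed (use \<Omega>b in auto)
  then show "(\<integral>x. \<bar>G (u x)\<bar> powr t \<partial>lebesgue_on \<Omega>) = (\<integral>x. \<bar>G (u x)\<bar> powr t \<partial>lebesgue)"
    using integrable_lebesgue_nonneg_cong(2)[of "\<lambda>x. \<bar>?v x\<bar> powr t" "\<lambda>x. \<bar>?v x\<bar> powr t"] by auto
  show "?v \<in> Dsp s p"
    using int vW by (auto simp: Dsp_def Lp_space_def t_def Wsp0_def Wsp_def measurable_completion)
qed

text \<open>The sharp counterpart of \<open>Sobolev_energy_bound\<close>, for (iii). If G(u)
  vanishes almost everywhere it is no candidate for the infimum, but then the left side is 0.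
  Positivity of S is not asserted.\<close>

lemma sobolev_const_energy_bound:
  fixes s p t :: real and \<Omega> :: "'a::euclidean_space set"
  defines "t \<equiv> sobolev_exponent TYPE('a) s p"
  assumes sp: "1 < p" "s * p < real DIM('a)" and \<Omega>: "open \<Omega>" "bounded \<Omega>"
    and ws: "weak_solution s p \<Omega> g u" and um[measurable]: "u \<in> borel_measurable borel"
  shows "energy_bound (lebesgue_on \<Omega>) p t (sobolev_const TYPE('a) s p) g u"
  unfolding energy_bound_def
proof (intro allI impI)
  fix \<phi> G assume tp: "test_pair p \<phi> G" and bd: "\<exists>k. \<forall>x. \<bar>G x\<bar> \<le> (k::real)"
  let ?v = "\<lambda>x. G (u x)"
  have [measurable]: "G \<in> borel_measurable borel"
    using test_pair_Lipschitz[OF tp sp(1)] Lipschitz_borel_measurable by metis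
  have vm: "?v \<in> borel_measurable borel" by measurable
  define I where "I = (\<integral>x. \<bar>G (u x)\<bar> powr t \<partial>lebesgue_on \<Omega>)"
  note D = test_pair_in_Dsp[OF sp \<Omega> ws um tp bd, folded t_def]
  have I2: "I = (\<integral>x. \<bar>?v x\<bar> powr t \<partial>lebesgue)" unfolding I_def by (rule D(3))
  have E: "gagliardo s p ?v powr p \<le> (\<integral>x. g x * \<phi> (u x) \<partial>lebesgue_on \<Omega>)"
    using gagliardo_powr[OF vm, of ?v p s] sp test_pair_energy_le(1,2)[OF sp(1) ws um tp] enn2real_leI by auto
  have "sobolev_const TYPE('a) s p * I powr (p / t) \<le> gagliardo s p ?v powr p"
  proof (cases "AE x in lebesgue. ?v x = 0")
    case True
    then have "AE x in lebesgue. \<bar>?v x\<bar> powr t = 0" by eventually_elim auto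
    then have "I = 0" unfolding I2 by (rule integral_eq_zero_AE)
    then show ?thesis by simp
  next
    case False
    have S: "sobolev_const TYPE('a) s p \<le> gagliardo s p ?v powr p / Lp_norm lebesgue t ?v powr p"
      unfolding sobolev_const_def t_def using False D(1)
      by (intro cINF_lower bdd_belowI2[of _ 0]) auto
    have "I \<noteq> 0"
    proof
      assume "I = 0"
      then have "AE x in lebesgue. \<bar>?v x\<bar> powr t = 0"
        using integral_nonneg_eq_0_iff_AE[OF D(2)] I2 by auto
      then have "AE x in lebesgue. ?v x = 0" by eventually_elim auto
      then show False using False by simp
    qed
    moreover have "I \<ge> 0" by (simp add: I_def)
    ultimately have "I > 0" by simp
    have "Lp_norm lebesgue t ?v powr p = I powr (p / t)"
      by (simp add: Lp_norm_def I2 powr_powr)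
    then show ?thesis using S \<open>I > 0\<close> by (simp add: pos_le_divide_eq)
  qed
  then show "sobolev_const TYPE('a) s p * (\<integral>x. \<bar>G (u x)\<bar> powr t \<partial>lebesgue_on \<Omega>) powr (p / t)
     \<le> (\<integral>x. g x * \<phi> (u x) \<partial>lebesgue_on \<Omega>)"
    using E by (simp add: I_def)
qed

section \<open>Constructing test pairs\<close>

text \<open>For the piecewise linear truncations of (iv) and (v). With c = \<phi> a - \<phi> b \<le>
  a - b the inequality is c^p \<le> (a - b)^(p - 1) c; no derivative enters, so corners are
  allowed.\<close>

lemma test_pair_contraction:
  assumes z: "\<And>x. x \<le> 0 \<Longrightarrow> \<phi> x = 0" and p: "p > 1"
    and m: "\<And>a b. b \<le> a \<Longrightarrow> \<phi> b \<le> \<phi> a \<and> \<phi> a - \<phi> b \<le> a - b"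
  shows "test_pair p \<phi> \<phi>"
  unfolding test_pair_def
proof (intro conjI allI impI exI[of _ 1])
  fix a b :: real assume ab: "b \<le> a"
  have "\<bar>\<phi> a - \<phi> b\<bar> powr p = (\<phi> a - \<phi> b) powr (p - 1) * (\<phi> a - \<phi> b)"
    using m[OF ab] powr_mult_base[of "\<phi> a - \<phi> b" "p - 1"] by (simp add: mult.commute)
  also have "\<dots> \<le> (a - b) powr (p - 1) * (\<phi> a - \<phi> b)"
    using m[OF ab] p by (intro mult_right_mono powr_mono2) auto
  finally show "\<bar>\<phi> a - \<phi> b\<bar> powr p \<le> (a - b) powr (p - 1) * (\<phi> a - \<phi> b)" .
qed (use z m in auto)

text \<open>Hoelder's inequality for the integral of G' over [b, a], obtained by monotonicity
  instead of integration. With l the mean slope of G on [b, a], convexity gives c^p \<ge> p l^(p-1)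
  c - (p-1) l^p; taking c = G' x and comparing increments yields \<phi> a - \<phi> b \<ge> l^p (a -
  b). Clamping the argument to [0, k] preserves the inequality because it is a nondecreasing
  contraction.\<close>

lemma test_pair_truncation:
  fixes \<phi> G G' :: "real \<Rightarrow> real"
  assumes p: "p > 1" and k: "k > 0" and z: "\<phi> 0 = 0" "G 0 = 0"
    and dG: "\<And>x. 0 \<le> x \<Longrightarrow> x \<le> k \<Longrightarrow> (G has_real_derivative G' x) (at x)"
    and d\<phi>: "\<And>x. 0 \<le> x \<Longrightarrow> x \<le> k \<Longrightarrow> (\<phi> has_real_derivative (G' x powr p)) (at x)"
    and G': "\<And>x. 0 \<le> x \<Longrightarrow> x \<le> k \<Longrightarrow> 0 \<le> G' x \<and> G' x \<le> B"
  shows "test_pair p (\<lambda>x. \<phi> (min (max x 0) k)) (\<lambda>x. G (min (max x 0) k))"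
proof -
  have core: "0 \<le> \<phi> a - \<phi> b \<and> \<phi> a - \<phi> b \<le> B powr p * (a - b) \<and>
      \<bar>G a - G b\<bar> powr p \<le> (a - b) powr (p - 1) * (\<phi> a - \<phi> b)" if ab: "0 \<le> b" "b < a" "a \<le> k" for a b
  proof -
    obtain x where x: "b < x" "x < a" "\<phi> a - \<phi> b = (a - b) * G' x powr p"
      using MVT2[of b a \<phi> "\<lambda>x. G' x powr p"] d\<phi> ab by auto
    have 1: "0 \<le> \<phi> a - \<phi> b" using x ab by auto
    have "G' x powr p \<le> B powr p" using G'[of x] x ab p by (intro powr_mono2) auto
    then have 2: "\<phi> a - \<phi> b \<le> B powr p * (a - b)"
      using x ab by (simp add: mult.commute mult_left_mono)
    obtain y where y: "b < y" "y < a" "G a - G b = (a - b) * G' y"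
      using MVT2[of b a G G'] dG ab by auto
    define l where "l = G' y"
    have l: "l \<ge> 0" using G'[of y] y ab by (auto simp: l_def)
    \<comment> \<open>The tangent to c^p at c = l lies below the graph; Young's inequality with
      exponents p and p / (p - 1) is the same statement.\<close>
    have young: "p * l powr (p - 1) * c \<le> c powr p + (p - 1) * l powr p" if "c \<ge> 0" for c
    proof -
      have "c * l powr (p - 1) \<le> c powr p / p + (l powr (p - 1)) powr (p / (p - 1)) / (p / (p - 1))"
        using that p by (intro Youngs_inequality) (auto simp: field_simps)
      also have "(l powr (p - 1)) powr (p / (p - 1)) = l powr p" using p by (simp add: powr_powr)
      finally have "p * (c * l powr (p - 1)) \<le> p * (c powr p / p + l powr p / (p / (p - 1)))"
        using p by (intro mult_left_mono) auto
      also have "\<dots> = c powr p + (p - 1) * l powr p" using p by (simp add: distrib_left)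
      finally show ?thesis by (simp add: mult_ac)
    qed
    \<comment> \<open>The derivative of \<open>h\<close> is the difference of the two sides of
      \<open>young\<close> at c = G' x, so \<open>h\<close> is nondecreasing.\<close>
    define h where "h = (\<lambda>x. \<phi> x - p * l powr (p - 1) * G x + (p - 1) * l powr p * x)"
    have "h b \<le> h a"
    proof (rule DERIV_nonneg_imp_nondecreasing[where f = h])
      show "b \<le> a" using ab by simp
      fix x assume "b \<le> x" "x \<le> a"
      then have x: "0 \<le> x" "x \<le> k" using ab by auto
      have "(h has_real_derivative (G' x powr p - p * l powr (p - 1) * G' x + (p - 1) * l powr p)) (at x)"
        unfolding h_def using dG[OF x] d\<phi>[OF x] by (auto intro!: derivative_eq_intros)
      moreover have "0 \<le> G' x powr p - p * l powr (p - 1) * G' x + (p - 1) * l powr p"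
        using young[of "G' x"] G'[OF x] by linarith
      ultimately show "\<exists>y. (h has_real_derivative y) (at x) \<and> y \<ge> 0" by blast
    qed
    then have "p * l powr (p - 1) * (G a - G b) - (p - 1) * l powr p * (a - b) \<le> \<phi> a - \<phi> b"
      by (simp add: h_def algebra_simps)
    moreover have "l powr (p - 1) * (G a - G b) = l powr p * (a - b)"
      using l powr_mult_base[of l "p - 1"] y(3) by (simp add: l_def mult_ac)
    ultimately have "p * (l powr p * (a - b)) - (p - 1) * (l powr p * (a - b)) \<le> \<phi> a - \<phi> b"
      by (simp add: mult.assoc)
    then have 3: "l powr p * (a - b) \<le> \<phi> a - \<phi> b" by (simp add: left_diff_distrib)
    have "\<bar>G a - G b\<bar> powr p = (a - b) powr p * l powr p"
      using y(3) ab l by (simp add: powr_mult abs_mult l_def)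
    also have "(a - b) powr p = (a - b) powr (p - 1) * (a - b)"
      using ab powr_mult_base[of "a - b" "p - 1"] by (simp add: mult.commute)
    also have "(a - b) powr (p - 1) * (a - b) * l powr p = (a - b) powr (p - 1) * (l powr p * (a - b))" by simp
    also have "\<dots> \<le> (a - b) powr (p - 1) * (\<phi> a - \<phi> b)"
      using 3 by (rule mult_left_mono) auto
    finally show ?thesis using 1 2 by blast
  qed
  show ?thesis unfolding test_pair_def
  proof (intro conjI allI impI exI[of _ "B powr p"])
    fix a b :: real assume ab: "b \<le> a"
    define a' b' where "a' = min (max a 0) k" and "b' = min (max b 0) k"
    have le: "0 \<le> b'" "b' \<le> a'" "a' \<le> k" "a' - b' \<le> a - b" using ab k by (auto simp: a'_def b'_def)
    have "0 \<le> \<phi> a' - \<phi> b' \<and> \<phi> a' - \<phi> b' \<le> B powr p * (a' - b') \<and>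
      \<bar>G a' - G b'\<bar> powr p \<le> (a' - b') powr (p - 1) * (\<phi> a' - \<phi> b')"
      using core[of b' a'] le by (cases "a' = b'") auto
    moreover have "B powr p * (a' - b') \<le> B powr p * (a - b)" using le by (intro mult_left_mono) auto
    moreover have "(a' - b') powr (p - 1) \<le> (a - b) powr (p - 1)" using le p by (intro powr_mono2) auto
    ultimately have "0 \<le> \<phi> a' - \<phi> b'" "\<phi> a' - \<phi> b' \<le> B powr p * (a - b)"
      "\<bar>G a' - G b'\<bar> powr p \<le> (a - b) powr (p - 1) * (\<phi> a' - \<phi> b')"
      by (auto intro: order_trans order_trans[OF _ mult_right_mono])
    then show "0 \<le> \<phi> (min (max a 0) k) - \<phi> (min (max b 0) k)"
      "\<phi> (min (max a 0) k) - \<phi> (min (max b 0) k) \<le> B powr p * (a - b)"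
      "\<bar>G (min (max a 0) k) - G (min (max b 0) k)\<bar> powr p
        \<le> (a - b) powr (p - 1) * (\<phi> (min (max a 0) k) - \<phi> (min (max b 0) k))"
      unfolding a'_def b'_def by auto
  qed (use z k in auto)
qed

section \<open>Limits and elementary inequalities for powers\<close>

text \<open>Fatou's lemma; it carries bounds that are uniform in the truncation level over to the
  untruncated function.\<close>

lemma integral_bound_of_tendsto:
  fixes F :: "nat \<Rightarrow> 'a \<Rightarrow> real"
  assumes F: "\<And>n. integrable M (F n)" "\<And>n x. 0 \<le> F n x" "\<And>x. (\<lambda>n. F n x) \<longlonglongrightarrow> f x"
    and B: "\<And>n. (\<integral>x. F n x \<partial>M) \<le> B"
  shows "integrable M f" "(\<integral>x. f x \<partial>M) \<le> B"
proof -
  have [measurable]: "F n \<in> borel_measurable M" for n using F(1) by auto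
  have fm[measurable]: "f \<in> borel_measurable M"
    by (rule borel_measurable_LIMSEQ_real[OF F(3)]) auto
  have f0: "f x \<ge> 0" for x using LIMSEQ_le_const[OF F(3), of 0 x] F(2) by blast
  have "0 \<le> (\<integral>x. F 0 x \<partial>M)" using F(2) by simp
  then have B0: "B \<ge> 0" using B[of 0] by linarith
  have "(\<integral>\<^sup>+x. ennreal (f x) \<partial>M) = (\<integral>\<^sup>+x. liminf (\<lambda>n. ennreal (F n x)) \<partial>M)"
  proof (rule nn_integral_cong)
    fix x show "ennreal (f x) = liminf (\<lambda>n. ennreal (F n x))"
      using tendsto_ennrealI[OF F(3)] by (intro lim_imp_Liminf[symmetric]) auto
  qed
  also have "\<dots> \<le> liminf (\<lambda>n. \<integral>\<^sup>+x. ennreal (F n x) \<partial>M)" by (intro nn_integral_liminf) auto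
  also have "\<dots> \<le> liminf (\<lambda>n::nat. ennreal B)"
    using B F by (intro Liminf_mono always_eventually) (auto simp: nn_integral_eq_integral intro!: ennreal_leI)
  also have "\<dots> = ennreal B" by (simp add: Liminf_const)
  finally have le: "(\<integral>\<^sup>+x. ennreal (f x) \<partial>M) \<le> ennreal B" .
  show int: "integrable M f"
    using le f0 by (auto simp: integrable_iff_bounded intro: le_less_trans)
  show "(\<integral>x. f x \<partial>M) \<le> B"
    using le B0 f0 by (simp add: nn_integral_eq_integral[OF int] ennreal_le_iff)
qed

text \<open>Right continuity of the power at m0. It covers m0 = 0, which occurs for g = 0, where
  dividing by m0 is impossible.\<close>

lemma le_powr_of_gt:
  fixes I C m0 r :: real
  assumes "\<And>m. m > m0 \<Longrightarrow> I \<le> C * m powr r" "m0 \<ge> 0" "r > 0"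
  shows "I \<le> C * m0 powr r"
proof (rule tendsto_lowerbound)
  show "((\<lambda>m. C * m powr r) \<longlongrightarrow> C * m0 powr r) (at_right m0)"
    using assms by (intro tendsto_mult tendsto_powr' tendsto_const tendsto_ident_at)
      (auto intro: eventually_mono[OF eventually_at_right_less])
  show "eventually (\<lambda>m. I \<le> C * m powr r) (at_right m0)"
    using assms(1) by (intro eventually_mono[OF eventually_at_right_less]) auto
qed auto

text \<open>Either X \<le> 2 b, or a X^\<theta> is at least half of X and the factor X^\<theta>
  cancels.\<close>

lemma sublinear_absorb:
  fixes X :: real
  assumes X: "X \<le> a * X powr \<theta> + b" "X \<ge> 0" "a \<ge> 0" "b \<ge> 0" "\<theta> < 1"
  shows "X \<le> 2 * b + (2 * a) powr (1 / (1 - \<theta>))"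
proof (cases "X \<le> 2 * b")
  case False
  then have X0: "X > 0" using assms by simp
  have "X \<le> 2 * a * X powr \<theta>" using X(1) False by simp
  then have "X powr \<theta> * X powr (1 - \<theta>) \<le> X powr \<theta> * (2 * a)"
    using X0 by (simp add: powr_add[symmetric] mult_ac)
  then have "X powr (1 - \<theta>) \<le> 2 * a" using X0 by simp
  then have "(X powr (1 - \<theta>)) powr (1 / (1 - \<theta>)) \<le> (2 * a) powr (1 / (1 - \<theta>))"
    using assms by (intro powr_mono2) auto
  then show ?thesis using X0 assms by (simp add: powr_powr)
qed (use assms in \<open>auto intro: add_increasing2\<close>)

text \<open>G must vanish at 0, so it is a power minus 1; this recovers the full power at the price
  of a factor 2^t and a constant.\<close>

lemma powr_le_shift:
  fixes x t :: real assumes "x \<ge> 1" "t > 0"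
  shows "x powr t \<le> 2 powr t * ((x - 1) powr t + 1)"
proof (cases "x \<le> 2")
  case True
  then have "x powr t \<le> 2 powr t * 1" using assms by (simp add: powr_mono2)
  also have "\<dots> \<le> 2 powr t * ((x - 1) powr t + 1)" by (intro mult_left_mono) auto
  finally show ?thesis .
next
  case False
  then have "x powr t \<le> (2 * (x - 1)) powr t" using assms by (intro powr_mono2) auto
  also have "\<dots> = 2 powr t * (x - 1) powr t" by (rule powr_mult)
  also have "\<dots> \<le> 2 powr t * ((x - 1) powr t + 1)" by (intro mult_left_mono) auto
  finally show ?thesis .
qed

text \<open>
  The scale \<open>m\<close> will be the norm of \<open>g\<close> to the power \<open>1 / (p - 1)\<close>, which absorbs the dependence
  on \<open>g\<close>. Then \<open>e < 0\<close>, so that \<open>\<phi>\<close> is bounded, for data in \<open>L\<^sup>1\<close>, and \<open>e > 0\<close> for data in \<open>L\<^sup>q\<close>.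
\<close>

lemma test_pair_power:
  fixes \<gamma> m k e p :: real
  assumes p: "p > 1" and "\<gamma> > 0" "m > 0" "k > 0" and e: "e = (\<gamma> - 1) * p + 1" "e \<noteq> 0"
  shows "test_pair p (\<lambda>x. (\<gamma> / m) powr p * (m / e) * ((1 + min (max x 0) k / m) powr e - 1))
    (\<lambda>x. (1 + min (max x 0) k / m) powr \<gamma> - 1)"
proof (rule test_pair_truncation[where G' = "\<lambda>x. \<gamma> / m * (1 + x / m) powr (\<gamma> - 1)"
      and B = "\<gamma> / m * (1 + (1 + k / m) powr (\<gamma> - 1))"])
  fix x :: real assume x: "0 \<le> x" "x \<le> k"
  then have V: "1 + x / m \<ge> 1" using assms by simp
  show "((\<lambda>x. (1 + x / m) powr \<gamma> - 1) has_real_derivative \<gamma> / m * (1 + x / m) powr (\<gamma> - 1)) (at x)"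
    using V assms by (auto intro!: derivative_eq_intros simp: field_simps)
  \<comment> \<open>Since e - 1 = (\<gamma> - 1) p, this is an antiderivative of the p-th power of
    G'; e \<noteq> 0 excludes the logarithm.\<close>
  have "((\<lambda>x. (\<gamma> / m) powr p * (m / e) * ((1 + x / m) powr e - 1)) has_real_derivative
     (\<gamma> / m) powr p * (m / e) * (e * (1 + x / m) powr (e - 1) * (1 / m))) (at x)"
    using V assms(1-4) by (auto intro!: derivative_eq_intros)
  also have "(\<gamma> / m) powr p * (m / e) * (e * (1 + x / m) powr (e - 1) * (1 / m)) = (\<gamma> / m) powr p * (1 + x / m) powr (e - 1)"
    using e(2) assms by simp
  also have "\<dots> = (\<gamma> / m * (1 + x / m) powr (\<gamma> - 1)) powr p"
    using powr_mult[of "\<gamma> / m" "(1 + x / m) powr (\<gamma> - 1)" p] V assms by (simp add: powr_powr)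
  finally show "((\<lambda>x. (\<gamma> / m) powr p * (m / e) * ((1 + x / m) powr e - 1)) has_real_derivative
     (\<gamma> / m * (1 + x / m) powr (\<gamma> - 1)) powr p) (at x)" .
  \<comment> \<open>The two summands serve the two signs of \<gamma> - 1: the power is increasing
    for \<gamma> \<ge> 1 and at most 1 otherwise.\<close>
  have "(1 + x / m) powr (\<gamma> - 1) \<le> 1 + (1 + k / m) powr (\<gamma> - 1)"
  proof (cases "\<gamma> \<ge> 1")
    case True
    then have "(1 + x / m) powr (\<gamma> - 1) \<le> (1 + k / m) powr (\<gamma> - 1)"
      using V x assms by (intro powr_mono2) (auto simp: divide_right_mono)
    then show ?thesis by simp
  next
    case False
    then have "(1 + x / m) powr (\<gamma> - 1) \<le> 1" using V powr_mono[of "\<gamma> - 1" 0 "1 + x / m"] by simp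
    then show ?thesis by (simp add: add_increasing2)
  qed
  then have "\<gamma> / m * (1 + x / m) powr (\<gamma> - 1) \<le> \<gamma> / m * (1 + (1 + k / m) powr (\<gamma> - 1))"
    using assms by (intro mult_left_mono) auto
  then show "0 \<le> \<gamma> / m * (1 + x / m) powr (\<gamma> - 1) \<and> \<gamma> / m * (1 + x / m) powr (\<gamma> - 1)
      \<le> \<gamma> / m * (1 + (1 + k / m) powr (\<gamma> - 1))"
    using assms by auto
qed (use assms in auto)

section \<open>Estimates from the energy bound\<close>

lemma (in finite_measure) integrable_bounded:
  fixes f :: "'a \<Rightarrow> real"
  assumes "f \<in> borel_measurable M" "\<And>x. 0 \<le> f x" "\<And>x. f x \<le> B"
  shows "integrable M f"
  using assms by (intro integrable_const_bound[of _ B]) auto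

text \<open>The sequence is eventually constant. The levels \<open>Suc n\<close> are positive, as
  the truncated test pairs require.\<close>

lemma tendsto_truncation:
  fixes y :: real
  shows "(\<lambda>n::nat. f (min (max y 0) (real (Suc n)))) \<longlonglongrightarrow> f (max y 0)"
proof -
  obtain n0 :: nat where n0: "max y 0 \<le> real n0" using real_arch_simple by blast
  have "eventually (\<lambda>n. f (min (max y 0) (real (Suc n))) = f (max y 0)) sequentially"
    using eventually_ge_at_top[of n0]
  proof eventually_elim
    case (elim n)
    then have "max y 0 \<le> real (Suc n)" using n0 by simp
    then show ?case by (simp only: min_absorb1)
  qed
  then show ?thesis by (rule tendsto_eventually)
qed

text \<open>Two limits in a fixed order: k tends to infinity with m fixed, by Fatou's lemma, and
  then m decreases to m0. The factor m^r comes from w \<le> m (1 + w / m) for the truncated function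
  w.\<close>

lemma (in finite_measure) power_estimate_limit:
  fixes u :: "'a \<Rightarrow> real"
  assumes [measurable]: "u \<in> borel_measurable M" and r: "r > 0" and m0: "m0 \<ge> 0"
    and B: "\<And>m k. m > m0 \<Longrightarrow> k > 0 \<Longrightarrow> (\<integral>x. (1 + min (max (u x) 0) k / m) powr r \<partial>M) \<le> C"
  shows "integrable M (\<lambda>x. max (u x) 0 powr r) \<and> (\<integral>x. max (u x) 0 powr r \<partial>M) \<le> C * m0 powr r"
proof -
  have *: "integrable M (\<lambda>x. max (u x) 0 powr r)" "(\<integral>x. max (u x) 0 powr r \<partial>M) \<le> C * m powr r"
    if m: "m > m0" for m
  proof -
    define F where "F = (\<lambda>n x. (min (max (u x) 0) (real (Suc n))) powr r)"
    have int: "integrable M (F n)" for n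
      unfolding F_def using r by (intro integrable_bounded[where B = "real (Suc n) powr r"]) (auto intro!: powr_mono2)
    have mpos: "m > 0" using m m0 by simp
    have bd: "(\<integral>x. F n x \<partial>M) \<le> C * m powr r" for n
    proof -
      let ?w = "\<lambda>x. min (max (u x) 0) (real (Suc n))"
      have "integrable M (\<lambda>x. (1 + ?w x / m) powr r)"
        using r mpos by (intro integrable_bounded[where B = "(1 + real (Suc n) / m) powr r"])
          (auto intro!: powr_mono2 divide_right_mono)
      moreover have "F n x \<le> m powr r * (1 + ?w x / m) powr r" for x
      proof -
        have "?w x = m * (?w x / m)" using mpos by simp
        then have "F n x = (m * (?w x / m)) powr r" by (simp add: F_def)
        also have "\<dots> = m powr r * (?w x / m) powr r" by (rule powr_mult)
        also have "\<dots> \<le> m powr r * (1 + ?w x / m) powr r"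
          using mpos r by (intro mult_left_mono powr_mono2) auto
        finally show ?thesis .
      qed
      ultimately have "(\<integral>x. F n x \<partial>M) \<le> (\<integral>x. m powr r * (1 + ?w x / m) powr r \<partial>M)"
        using int by (intro integral_mono) auto
      also have "\<dots> = m powr r * (\<integral>x. (1 + ?w x / m) powr r \<partial>M)" by simp
      also have "\<dots> \<le> m powr r * C" using B[OF m, of "real (Suc n)"] by (intro mult_left_mono) auto
      finally show ?thesis by (simp add: mult.commute)
    qed
    have lim: "(\<lambda>n. F n x) \<longlonglongrightarrow> max (u x) 0 powr r" for x
      unfolding F_def by (rule tendsto_truncation)
    have nn: "0 \<le> F n x" for n x by (simp add: F_def)
    show "integrable M (\<lambda>x. max (u x) 0 powr r)" "(\<integral>x. max (u x) 0 powr r \<partial>M) \<le> C * m powr r"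
      using integral_bound_of_tendsto[OF int nn lim bd] by auto
  qed
  show ?thesis
    using *(1)[of "m0 + 1"] le_powr_of_gt[OF *(2) m0 r] by auto
qed

lemma (in finite_measure) integral_shift_le:
  fixes V :: "'a \<Rightarrow> real"
  assumes [measurable]: "V \<in> borel_measurable M" and V: "\<And>x. 1 \<le> V x" "\<And>x. V x \<le> B" and "\<gamma> > 0" "t > 0"
  shows "(\<integral>x. V x powr (\<gamma> * t) \<partial>M) \<le> 2 powr t * ((\<integral>x. (V x powr \<gamma> - 1) powr t \<partial>M) + measure M (space M))"
proof -
  have V1: "V x powr \<gamma> \<ge> 1" for x using V(1)[of x] assms(4) by (simp add: ge_one_powr_ge_zero)
  have V2: "V x powr \<gamma> \<le> B powr \<gamma>" for x using V(1,2)[of x] assms(4) by (intro powr_mono2) auto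
  have i1: "integrable M (\<lambda>x. (V x powr \<gamma> - 1) powr t)"
  proof (rule integrable_bounded[where B = "(B powr \<gamma>) powr t"])
    fix x
    have "0 \<le> V x powr \<gamma> - 1" "V x powr \<gamma> - 1 \<le> B powr \<gamma>" using V1[of x] V2[of x] by linarith+
    then show "(V x powr \<gamma> - 1) powr t \<le> (B powr \<gamma>) powr t" using assms(5) by (intro powr_mono2) auto
  qed auto
  have i2: "integrable M (\<lambda>x. V x powr (\<gamma> * t))"
  proof (rule integrable_bounded[where B = "B powr (\<gamma> * t)"])
    fix x show "V x powr (\<gamma> * t) \<le> B powr (\<gamma> * t)"
      using V(1,2)[of x] assms(4,5) by (intro powr_mono2) auto
  qed auto
  have "(\<integral>x. V x powr (\<gamma> * t) \<partial>M) \<le> (\<integral>x. 2 powr t * ((V x powr \<gamma> - 1) powr t + 1) \<partial>M)"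
    using i1 i2 V1 powr_le_shift[OF V1 assms(5)] by (intro integral_mono) (auto simp: powr_powr)
  also have "\<dots> = 2 powr t * ((\<integral>x. (V x powr \<gamma> - 1) powr t \<partial>M) + measure M (space M))"
    using i1 by simp
  finally show ?thesis .
qed

text \<open>Shared by (i) and (ii), which differ only in K: a constant for L1 data, a multiple of a
  power of the integral on the left for Lq data.\<close>

lemma (in finite_measure) power_energy_estimate:
  fixes g u :: "'a \<Rightarrow> real"
  assumes p: "p > 1" and L: "\<Lambda> > 0" and t: "t > 0" and \<gamma>: "\<gamma> > 0" and mk: "m > 0" "k > 0"
    and e: "e = (\<gamma> - 1) * p + 1" "e \<noteq> 0"
    and um[measurable]: "u \<in> borel_measurable M" and eb: "energy_bound M p t \<Lambda> g u"
  defines "V \<equiv> \<lambda>x. 1 + min (max (u x) 0) k / m"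
  assumes K: "(\<integral>x. g x * ((\<gamma> / m) powr p * (m / e) * (V x powr e - 1)) \<partial>M) \<le> K"
  shows "(\<integral>x. V x powr (\<gamma> * t) \<partial>M) \<le> 2 powr t * ((K / \<Lambda>) powr (t / p) + measure M (space M))"
proof -
  have W: "1 \<le> 1 + min (max x 0) k / m" "1 + min (max x 0) k / m \<le> 1 + k / m" for x :: real
    using mk by (auto simp: divide_right_mono)
  have W\<gamma>: "1 \<le> (1 + min (max x 0) k / m) powr \<gamma>" "(1 + min (max x 0) k / m) powr \<gamma> \<le> (1 + k / m) powr \<gamma>" for x
    using W[of x] \<gamma> by (simp_all add: ge_one_powr_ge_zero powr_mono2)
  have "\<bar>(1 + min (max x 0) k / m) powr \<gamma> - 1\<bar> \<le> (1 + k / m) powr \<gamma>" for x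
    using W\<gamma>[of x] by linarith
  then have "\<Lambda> * (\<integral>x. \<bar>V x powr \<gamma> - 1\<bar> powr t \<partial>M) powr (p / t) \<le>
      (\<integral>x. g x * ((\<gamma> / m) powr p * (m / e) * (V x powr e - 1)) \<partial>M)"
    using eb test_pair_power[OF p \<gamma> mk e] unfolding energy_bound_def V_def by blast
  then have "(\<integral>x. \<bar>V x powr \<gamma> - 1\<bar> powr t \<partial>M) powr (p / t) \<le> K / \<Lambda>"
    using L K by (simp add: pos_le_divide_eq mult.commute)
  then have "((\<integral>x. \<bar>V x powr \<gamma> - 1\<bar> powr t \<partial>M) powr (p / t)) powr (t / p) \<le> (K / \<Lambda>) powr (t / p)"
    using p t by (intro powr_mono2) auto
  then have le: "(\<integral>x. (V x powr \<gamma> - 1) powr t \<partial>M) \<le> (K / \<Lambda>) powr (t / p)"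
    using p t W\<gamma> by (simp add: powr_powr V_def)
  have "(\<integral>x. V x powr (\<gamma> * t) \<partial>M) \<le> 2 powr t * ((\<integral>x. (V x powr \<gamma> - 1) powr t \<partial>M) + measure M (space M))"
    using W \<gamma> t unfolding V_def by (intro integral_shift_le[where B = "1 + k / m"]) auto
  also have "\<dots> \<le> 2 powr t * ((K / \<Lambda>) powr (t / p) + measure M (space M))"
    using le by (intro mult_left_mono) auto
  finally show ?thesis .
qed

section \<open>Power estimates for data in L1 and Lq\<close>

text \<open>With \<gamma> = r / t the Sobolev side carries the power r of V. The strict bound on r /
  t is equivalent to e < 0; then V^e \<le> 1, so \<phi> is at most C1 m^(1 - p), and pairing it with
  g costs only the L1 norm.\<close>

lemma (in finite_measure) L1_estimate:
  assumes p: "p > 1" and r: "r > 0" "t > 0" "r / t < (p - 1) / p" and L: "\<Lambda> > 0"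
  shows "\<exists>C>0. \<forall>g u. integrable M g \<longrightarrow> u \<in> borel_measurable M \<longrightarrow> energy_bound M p t \<Lambda> g u \<longrightarrow>
     integrable M (\<lambda>x. max (u x) 0 powr r) \<and>
     (\<integral>x. max (u x) 0 powr r \<partial>M) \<le> C * (\<integral>x. \<bar>g x\<bar> \<partial>M) powr (r / (p - 1))"
proof -
  define \<gamma> where "\<gamma> = r / t"
  define e where "e = (\<gamma> - 1) * p + 1"
  have g0: "\<gamma> > 0" using r by (simp add: \<gamma>_def)
  have "\<gamma> * p < p - 1" using r(3) p by (simp add: \<gamma>_def pos_less_divide_eq)
  then have e: "e < 0" by (simp add: e_def left_diff_distrib)
  define C1 where "C1 = \<gamma> powr p / (- e)"
  have C1: "C1 > 0" using g0 e by (simp add: C1_def divide_pos_neg)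
  define C where "C = 2 powr t * ((C1 / \<Lambda>) powr (t / p) + measure M (space M)) + 1"
  have C: "C > 0" by (simp add: C_def add_nonneg_pos)
  show ?thesis
  proof (intro exI[of _ C] conjI allI impI C)
    fix g u :: "'a \<Rightarrow> real"
    assume g: "integrable M g" and um[measurable]: "u \<in> borel_measurable M" and eb: "energy_bound M p t \<Lambda> g u"
    define m0 where "m0 = (\<integral>x. \<bar>g x\<bar> \<partial>M) powr (1 / (p - 1))"
    have m0: "m0 \<ge> 0" by (simp add: m0_def)
    have m0p: "m0 powr (p - 1) = (\<integral>x. \<bar>g x\<bar> \<partial>M)" using p by (simp add: m0_def powr_powr)
    have bd: "(\<integral>x. (1 + min (max (u x) 0) k / m) powr r \<partial>M) \<le> C" if m: "m > m0" and k: "k > 0" for m k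
    proof -
      have mpos: "m > 0" using m m0 by simp
      define V where "V = (\<lambda>x. 1 + min (max x 0) k / m)"
      have V: "1 \<le> V x" "V x \<le> 1 + k / m" for x using mpos k by (auto simp: V_def divide_right_mono)
      have [measurable]: "V \<in> borel_measurable borel" unfolding V_def by measurable
      define \<phi> where "\<phi> = (\<lambda>x. (\<gamma> / m) powr p * (m / e) * (V x powr e - 1))"
      have [measurable]: "\<phi> \<in> borel_measurable borel" unfolding \<phi>_def by measurable
      have mpow: "(\<gamma> / m) powr p * (m / (- e)) = C1 * m powr (1 - p)"
        using mpos by (simp add: C1_def powr_divide powr_diff)
      have phi: "0 \<le> \<phi> x \<and> \<phi> x \<le> C1 * m powr (1 - p)" for x
      proof -
        have "V x powr e \<le> 1" using V(1)[of x] e powr_mono[of e 0 "V x"] by simp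
        then have 1: "0 \<le> 1 - V x powr e" "1 - V x powr e \<le> 1" by auto
        have "\<phi> x = (\<gamma> / m) powr p * (m / (- e)) * (1 - V x powr e)" using e by (simp add: \<phi>_def field_simps)
        also have "\<dots> = C1 * m powr (1 - p) * (1 - V x powr e)" by (simp only: mpow)
        finally have "\<phi> x = C1 * m powr (1 - p) * (1 - V x powr e)" .
        moreover have "C1 * m powr (1 - p) * (1 - V x powr e) \<le> C1 * m powr (1 - p) * 1"
          using 1 C1 by (intro mult_left_mono) auto
        ultimately show ?thesis using 1 C1 by auto
      qed
      have "(\<integral>x. g x * \<phi> (u x) \<partial>M) \<le> (\<integral>x. \<bar>g x\<bar> * (C1 * m powr (1 - p)) \<partial>M)"
      proof (rule integral_mono)
        have le: "\<bar>g x * \<phi> (u x)\<bar> \<le> \<bar>g x\<bar> * (C1 * m powr (1 - p))" for x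
          using phi[of "u x"] by (auto simp: abs_mult intro!: mult_left_mono)
        show "integrable M (\<lambda>x. \<bar>g x\<bar> * (C1 * m powr (1 - p)))" using g by simp
        then show "integrable M (\<lambda>x. g x * \<phi> (u x))"
          by (rule Bochner_Integration.integrable_bound) (use g le C1 in \<open>auto intro!: AE_I2 order_trans[OF le]\<close>)
        show "g x * \<phi> (u x) \<le> \<bar>g x\<bar> * (C1 * m powr (1 - p))" for x using le[of x] by linarith
      qed
      also have "\<dots> = (\<integral>x. \<bar>g x\<bar> \<partial>M) * (C1 * m powr (1 - p))" using g by simp
      \<comment> \<open>Here the unit m removes g: the L1 norm is m0^(p - 1) \<le> m^(p - 1), and
        the powers of m cancel.\<close>
      also have "\<dots> \<le> m powr (p - 1) * (C1 * m powr (1 - p))"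
        unfolding m0p[symmetric] using m m0 p C1 by (intro mult_right_mono powr_mono2) auto
      also have "\<dots> = C1" using mpos powr_add[of m "p - 1" "1 - p"] by simp
      finally have "(\<integral>x. V (u x) powr (\<gamma> * t) \<partial>M) \<le> 2 powr t * ((C1 / \<Lambda>) powr (t / p) + measure M (space M))"
        unfolding V_def \<phi>_def using e by (intro power_energy_estimate[OF p L r(2) g0 mpos k e_def _ um eb]) auto
      also have "\<dots> \<le> C" by (simp add: C_def)
      finally show ?thesis using r by (simp add: V_def \<gamma>_def)
    qed
    have "integrable M (\<lambda>x. max (u x) 0 powr r) \<and> (\<integral>x. max (u x) 0 powr r \<partial>M) \<le> C * m0 powr r"
      using power_estimate_limit[OF um r(1) m0 bd] .
    then show "integrable M (\<lambda>x. max (u x) 0 powr r)"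
      "(\<integral>x. max (u x) 0 powr r \<partial>M) \<le> C * (\<integral>x. \<bar>g x\<bar> \<partial>M) powr (r / (p - 1))"
      by (auto simp: m0_def powr_powr)
  qed
qed

text \<open>Hoelder's inequality for g against h, with h then replaced by its majorant K f. The
  bound B makes the powers of f and h integrable.\<close>

lemma (in finite_measure) integral_mult_dominated_le:
  fixes g h f :: "'a \<Rightarrow> real"
  assumes [measurable]: "g \<in> borel_measurable M" "h \<in> borel_measurable M" "f \<in> borel_measurable M"
    and q: "q > 1" and g: "integrable M (\<lambda>x. \<bar>g x\<bar> powr q)" and K: "K \<ge> 0"
    and h: "\<And>x. 0 \<le> h x" "\<And>x. h x \<le> K * f x" and f: "\<And>x. 0 \<le> f x" "\<And>x. f x \<le> B"
  shows "(\<integral>x. g x * h x \<partial>M) \<le> Lp_norm M q g * (K * (\<integral>x. f x powr (q / (q - 1)) \<partial>M) powr (1 - 1 / q))"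
proof -
  define q' where "q' = q / (q - 1)"
  have q': "q' > 0" "q' * (1 - 1 / q) = 1" "1 - 1 / q > 0" using q by (auto simp: q'_def field_simps)
  have hB: "h x \<le> K * B" for x using h(2)[of x] mult_left_mono[OF f(2) K, of x] by linarith
  have ih: "integrable M (\<lambda>x. h x powr q')"
    using h hB q' by (intro integrable_bounded[where B = "(K * B) powr q'"]) (auto intro!: powr_mono2)
  have i_f: "integrable M (\<lambda>x. f x powr q')"
    using f q' by (intro integrable_bounded[where B = "B powr q'"]) (auto intro!: powr_mono2)
  have "(\<integral>x. h x powr q' \<partial>M) \<le> (\<integral>x. K powr q' * f x powr q' \<partial>M)"
  proof (intro integral_mono ih)
    fix x
    have "h x powr q' \<le> (K * f x) powr q'" using h q' by (intro powr_mono2) auto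
    then show "h x powr q' \<le> K powr q' * f x powr q'" by (simp add: powr_mult)
  qed (use i_f in simp)
  also have "\<dots> = K powr q' * (\<integral>x. f x powr q' \<partial>M)" by simp
  finally have "(\<integral>x. h x powr q' \<partial>M) powr (1 - 1 / q) \<le> (K powr q' * (\<integral>x. f x powr q' \<partial>M)) powr (1 - 1 / q)"
    using q' by (intro powr_mono2) auto
  also have "\<dots> = K * (\<integral>x. f x powr q' \<partial>M) powr (1 - 1 / q)"
    using q' K by (simp add: powr_mult powr_powr)
  finally have *: "(\<integral>x. h x powr q' \<partial>M) powr (1 - 1 / q) \<le> K * (\<integral>x. f x powr q' \<partial>M) powr (1 - 1 / q)" .
  have "q' > 1" "1 / q + 1 / q' = 1" "1 / q' = 1 - 1 / q" using q by (auto simp: q'_def field_simps)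
  note H = integral_Holder_powr[OF q this(1,2) assms(1,2) g, unfolded this(3)]
  have "(\<integral>x. g x * h x \<partial>M) \<le> (\<integral>x. \<bar>g x * h x\<bar> \<partial>M)"
    using H(1) h ih by (intro integral_mono) auto
  also have "\<dots> \<le> Lp_norm M q g * (\<integral>x. h x powr q' \<partial>M) powr (1 - 1 / q)"
    using H(2) h ih by (simp add: Lp_norm_def)
  also have "\<dots> \<le> Lp_norm M q g * (K * (\<integral>x. f x powr q' \<partial>M) powr (1 - 1 / q))"
    using * by (intro mult_left_mono) (auto simp: Lp_norm_def)
  finally show ?thesis by (simp add: q'_def)
qed

lemma Lp_norm_nonneg [simp]: "0 \<le> Lp_norm M r f"
  by (simp add: Lp_norm_def)

text \<open>The relation \<gamma> t = e q', with q' = q / (q - 1), makes Hoelder's inequality on the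
  right produce the same integral X as the Sobolev inequality on the left, whence X \<le> a
  X^\<theta> + b. The exponent \<theta> = t / (p q') is below 1 exactly when t < p q'.\<close>

lemma (in finite_measure) Lq_power_estimate:
  assumes p: "p > 1" and q: "q > 1" and t: "t > 0" "t < p * (q / (q - 1))" and L: "\<Lambda> > 0"
    and \<gamma>: "\<gamma> > 0" "e = (\<gamma> - 1) * p + 1" "e > 0" "\<gamma> * t = e * (q / (q - 1))"
  shows "\<exists>C>0. \<forall>g u. g \<in> borel_measurable M \<longrightarrow> integrable M (\<lambda>x. \<bar>g x\<bar> powr q) \<longrightarrow>
     u \<in> borel_measurable M \<longrightarrow> energy_bound M p t \<Lambda> g u \<longrightarrow>
     integrable M (\<lambda>x. max (u x) 0 powr (\<gamma> * t)) \<and>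
     (\<integral>x. max (u x) 0 powr (\<gamma> * t) \<partial>M) \<le> C * Lp_norm M q g powr (\<gamma> * t / (p - 1))"
proof -
  define C1 where "C1 = \<gamma> powr p / e"
  have C1: "C1 > 0" using \<gamma> by (simp add: C1_def)
  define \<theta> where "\<theta> = (1 - 1 / q) * (t / p)"
  have th: "\<theta> < 1" using t p q by (simp add: \<theta>_def field_simps)
  define a where "a = 2 powr t * (C1 / \<Lambda>) powr (t / p)"
  define b where "b = 2 powr t * measure M (space M)"
  define C where "C = 2 * b + (2 * a) powr (1 / (1 - \<theta>)) + 1"
  have C: "C > 0" by (simp add: C_def b_def add_nonneg_pos)
  show ?thesis
  proof (intro exI[of _ C] conjI allI impI C)
    fix g u :: "'a \<Rightarrow> real"
    assume gm[measurable]: "g \<in> borel_measurable M" and g: "integrable M (\<lambda>x. \<bar>g x\<bar> powr q)"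
      and um[measurable]: "u \<in> borel_measurable M" and eb: "energy_bound M p t \<Lambda> g u"
    define m0 where "m0 = Lp_norm M q g powr (1 / (p - 1))"
    have m0: "m0 \<ge> 0" by (simp add: m0_def)
    have m0p: "m0 powr (p - 1) = Lp_norm M q g" using p by (simp add: m0_def powr_powr)
    have bd: "(\<integral>x. (1 + min (max (u x) 0) k / m) powr (\<gamma> * t) \<partial>M) \<le> C" if m: "m > m0" and k: "k > 0" for m k
    proof -
      have mpos: "m > 0" using m m0 by simp
      define V where "V = (\<lambda>x. 1 + min (max x 0) k / m)"
      have V: "1 \<le> V x" "V x \<le> 1 + k / m" for x using mpos k by (auto simp: V_def divide_right_mono)
      have [measurable]: "V \<in> borel_measurable borel" unfolding V_def by measurable
      define \<phi> where "\<phi> = (\<lambda>x. (\<gamma> / m) powr p * (m / e) * (V x powr e - 1))"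
      have [measurable]: "\<phi> \<in> borel_measurable borel" unfolding \<phi>_def by measurable
      have mpow: "(\<gamma> / m) powr p * (m / e) = C1 * m powr (1 - p)"
        using mpos by (simp add: C1_def powr_divide powr_diff)
      have phi: "0 \<le> \<phi> x \<and> \<phi> x \<le> C1 * m powr (1 - p) * V x powr e" for x
      proof -
        have "V x powr e \<ge> 1" using V(1)[of x] \<gamma> by (simp add: ge_one_powr_ge_zero)
        moreover have "\<phi> x = C1 * m powr (1 - p) * (V x powr e - 1)" by (simp only: mpow \<phi>_def)
        ultimately show ?thesis using C1 by (auto intro!: mult_left_mono)
      qed
      define X where "X = (\<integral>x. V (u x) powr (\<gamma> * t) \<partial>M)"
      have X0: "X \<ge> 0" by (simp add: X_def)
      have "(\<integral>x. g x * \<phi> (u x) \<partial>M) \<le> Lp_norm M q g * (C1 * m powr (1 - p) * (\<integral>x. (V (u x) powr e) powr (q / (q - 1)) \<partial>M) powr (1 - 1 / q))"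
      proof (rule integral_mult_dominated_le)
        show "V (u x) powr e \<le> (1 + k / m) powr e" for x using V[of "u x"] \<gamma> by (intro powr_mono2) auto
      qed (use g q C1 phi in auto)
      also have "(\<integral>x. (V (u x) powr e) powr (q / (q - 1)) \<partial>M) = X"
        unfolding X_def powr_powr \<gamma>(4) ..
      also have "Lp_norm M q g * (C1 * m powr (1 - p) * X powr (1 - 1 / q)) \<le> m powr (p - 1) * (C1 * m powr (1 - p) * X powr (1 - 1 / q))"
        unfolding m0p[symmetric] using m m0 p C1 by (intro mult_right_mono powr_mono2) auto
      also have "\<dots> = C1 * X powr (1 - 1 / q)" using mpos powr_add[of m "p - 1" "1 - p"] by simp
      finally have "X \<le> 2 powr t * ((C1 * X powr (1 - 1 / q) / \<Lambda>) powr (t / p) + measure M (space M))"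
        unfolding X_def V_def \<phi>_def using \<gamma>(3)
        by (intro power_energy_estimate[OF p L t(1) \<gamma>(1) mpos k \<gamma>(2) _ um eb]) auto
      also have "(C1 * X powr (1 - 1 / q) / \<Lambda>) powr (t / p) = (C1 / \<Lambda>) powr (t / p) * X powr \<theta>"
        using powr_mult[of "C1 / \<Lambda>" "X powr (1 - 1 / q)" "t / p"] by (simp add: powr_powr \<theta>_def)
      also have "2 powr t * ((C1 / \<Lambda>) powr (t / p) * X powr \<theta> + measure M (space M)) = a * X powr \<theta> + b" by (simp add: a_def b_def algebra_simps)
      finally have "X \<le> 2 * b + (2 * a) powr (1 / (1 - \<theta>))"
        using X0 th by (intro sublinear_absorb) (auto simp: a_def b_def)
      also have "\<dots> \<le> C" by (simp add: C_def)
      finally show ?thesis by (simp add: V_def X_def)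
    qed
    have "integrable M (\<lambda>x. max (u x) 0 powr (\<gamma> * t)) \<and> (\<integral>x. max (u x) 0 powr (\<gamma> * t) \<partial>M) \<le> C * m0 powr (\<gamma> * t)"
      using \<gamma>(1) t(1) by (intro power_estimate_limit[OF um _ m0 bd]) auto
    then show "integrable M (\<lambda>x. max (u x) 0 powr (\<gamma> * t))"
      "(\<integral>x. max (u x) 0 powr (\<gamma> * t) \<partial>M) \<le> C * Lp_norm M q g powr (\<gamma> * t / (p - 1))"
      by (auto simp: m0_def powr_powr)
  qed
qed

section \<open>Critical data and exponential integrability\<close>

text \<open>The p-th power of G' is (\<beta> / p)^p exp(\<beta> x), so without truncation \<phi> /
  G^p tends to (\<beta> / p)^p / \<beta> = \<beta>^(p - 1) / p^p. This limit is the source of p^p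
  and of the root 1 / (p - 1) in the bound on the exponent.\<close>

lemma test_pair_exp:
  fixes \<beta> k p :: real
  assumes p: "p > 1" and "\<beta> > 0" "k > 0"
  shows "test_pair p (\<lambda>x. (\<beta> / p) powr p / \<beta> * (exp (\<beta> * min (max x 0) k) - 1)) (\<lambda>x. exp (\<beta> / p * min (max x 0) k) - 1)"
proof (rule test_pair_truncation[where G' = "\<lambda>x. \<beta> / p * exp (\<beta> / p * x)" and B = "\<beta> / p * exp (\<beta> / p * k)"])
  fix x :: real assume x: "0 \<le> x" "x \<le> k"
  show "((\<lambda>x. exp (\<beta> / p * x) - 1) has_real_derivative \<beta> / p * exp (\<beta> / p * x)) (at x)"
    using assms by (auto intro!: derivative_eq_intros)
  have "((\<lambda>x. (\<beta> / p) powr p / \<beta> * (exp (\<beta> * x) - 1)) has_real_derivative (\<beta> / p) powr p * exp (\<beta> * x)) (at x)"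
    using assms by (auto intro!: derivative_eq_intros)
  also have "(\<beta> / p) powr p * exp (\<beta> * x) = (\<beta> / p * exp (\<beta> / p * x)) powr p"
    using powr_mult[of "\<beta> / p" "exp (\<beta> / p * x)" p] p by (simp add: exp_powr_real mult.commute)
  finally show "((\<lambda>x. (\<beta> / p) powr p / \<beta> * (exp (\<beta> * x) - 1)) has_real_derivative (\<beta> / p * exp (\<beta> / p * x)) powr p) (at x)" .
  have "exp (\<beta> / p * x) \<le> exp (\<beta> / p * k)" using x assms by (auto intro!: divide_right_mono)
  then show "0 \<le> \<beta> / p * exp (\<beta> / p * x) \<and> \<beta> / p * exp (\<beta> / p * x) \<le> \<beta> / p * exp (\<beta> / p * k)"
    using assms by (intro conjI mult_left_mono) auto
qed (use assms in auto)

text \<open>Refines \<open>powr_le_shift\<close>: under a sharp smallness condition a fixed factor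
  such as 2^t cannot be afforded. With \<eta>^t = \<theta>, the inequality \<eta> x \<le> x - 1
  holds from x = 1 / (1 - \<eta>) on; smaller x are paid by c.\<close>

lemma powr_le_shift_near_1:
  fixes \<theta> t :: real
  assumes th: "0 < \<theta>" "\<theta> < 1" and t: "t > 0"
  shows "\<exists>c\<ge>0. \<forall>x\<ge>1. \<theta> * x powr t \<le> (x - 1) powr t + c"
proof -
  define \<eta> where "\<eta> = \<theta> powr (1 / t)"
  have eta: "0 < \<eta>" "\<eta> < 1" "\<eta> powr t = \<theta>"
    using th t powr_less_mono2[of "1 / t" \<theta> 1] by (auto simp: \<eta>_def powr_powr)
  show ?thesis
  proof (intro exI[of _ "(1 / (1 - \<eta>)) powr t"] conjI allI impI)
    fix x :: real assume x: "x \<ge> 1"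
    show "\<theta> * x powr t \<le> (x - 1) powr t + (1 / (1 - \<eta>)) powr t"
    proof (cases "x \<le> 1 / (1 - \<eta>)")
      case True
      then have "x powr t \<le> (1 / (1 - \<eta>)) powr t" using x t by (intro powr_mono2) auto
      moreover have "\<theta> * x powr t \<le> 1 * x powr t" using th by (intro mult_right_mono) auto
      moreover have "0 \<le> (x - 1) powr t" by simp
      ultimately show ?thesis by linarith
    next
      case False
      then have "\<eta> * x \<le> x - 1" using eta by (simp add: field_simps)
      then have "(\<eta> * x) powr t \<le> (x - 1) powr t" using eta x t by (intro powr_mono2) auto
      moreover have "(\<eta> * x) powr t = \<theta> * x powr t" using eta(3) powr_mult[of \<eta> x t] by simp
      moreover have "0 \<le> (1 / (1 - \<eta>)) powr t" by simp
      ultimately show ?thesis by linarith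
    qed
  qed auto
qed

text \<open>At t = p q' the absorption is linear: the estimate reads \<theta> X \<le> \<kappa> X +
  const and is useful only if \<kappa> < 1. The assumption \<open>small\<close> says just that, as
  \<kappa> is a positive power of ||g|| K / \<Lambda> and K = \<beta>^(p - 1) / p^p.\<close>

lemma (in finite_measure) exp_estimate:
  fixes g u :: "'a \<Rightarrow> real"
  assumes p: "p > 1" and q: "q > 1" and t: "t = p * (q / (q - 1))" and L: "\<Lambda> > 0" and \<beta>: "\<beta> > 0"
    and small: "\<beta> powr (p - 1) * Lp_norm M q g < p powr p * \<Lambda>"
    and gm[measurable]: "g \<in> borel_measurable M" and g: "integrable M (\<lambda>x. \<bar>g x\<bar> powr q)"
    and um[measurable]: "u \<in> borel_measurable M" and eb: "energy_bound M p t \<Lambda> g u"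
  shows "integrable M (\<lambda>x. exp (\<beta> * (q / (q - 1)) * max (u x) 0))"
proof -
  define K where "K = (\<beta> / p) powr p / \<beta>"
  have K: "K > 0" using \<beta> p by (simp add: K_def)
  have K': "K = \<beta> powr (p - 1) / p powr p"
    using \<beta> p by (simp add: K_def powr_divide powr_diff)
  have q': "q / (q - 1) > 1" using q by (simp add: field_simps)
  have t0: "t > 0" using p q by (simp add: t)
  have pt: "p / t = 1 - 1 / q" using p q by (simp add: t field_simps)
  define \<kappa> where "\<kappa> = (Lp_norm M q g * K / \<Lambda>) powr (t / p)"
  have "Lp_norm M q g * K / \<Lambda> < 1"
    using small p L by (simp add: K' field_simps)
  then have kap: "0 \<le> \<kappa>" "\<kappa> < 1"
    using powr_less_mono2[of "t / p" "Lp_norm M q g * K / \<Lambda>" 1] K L p t0 by (auto simp: \<kappa>_def)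
  \<comment> \<open>The gap between \<kappa> and 1 pays for the passage from (Z - 1)^t back to Z^t,
    which costs the factor \<theta> and the constant c.\<close>
  then obtain \<theta> where th: "\<kappa> < \<theta>" "\<theta> < 1" using dense by blast
  obtain c where c: "c \<ge> 0" "\<And>x. x \<ge> 1 \<Longrightarrow> \<theta> * x powr t \<le> (x - 1) powr t + c"
    using powr_le_shift_near_1[of \<theta> t] th kap t0 by auto
  define B where "B = c * measure M (space M) / (\<theta> - \<kappa>)"
  define F where "F = (\<lambda>n x. exp (\<beta> * (q / (q - 1)) * min (max (u x) 0) (real (Suc n))))"
  have Ft: "F n x = exp (\<beta> / p * min (max (u x) 0) (real (Suc n))) powr t" for n x
    using p by (simp add: F_def exp_powr_real t)
  have nn: "0 \<le> F n x" for n x by (simp add: F_def)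
  have int: "integrable M (F n)" for n
  proof (rule integrable_bounded[where B = "exp (\<beta> * (q / (q - 1)) * real (Suc n))"])
    fix x
    have "0 \<le> \<beta> * (q / (q - 1))" using \<beta> q by simp
    then show "F n x \<le> exp (\<beta> * (q / (q - 1)) * real (Suc n))"
      unfolding F_def exp_le_cancel_iff by (intro mult_left_mono) auto
  qed (auto simp: F_def)
  have bd: "(\<integral>x. F n x \<partial>M) \<le> B" for n
  proof -
    define k where "k = real (Suc n)"
    have k: "k > 0" by (simp add: k_def)
    define Z where "Z = (\<lambda>x. exp (\<beta> / p * min (max x 0) k))"
    have Z: "1 \<le> Z x" "Z x \<le> exp (\<beta> / p * k)" for x
      using \<beta> p k by (auto simp: Z_def intro!: divide_right_mono)
    have [measurable]: "Z \<in> borel_measurable borel" unfolding Z_def by measurable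
    define \<phi> where "\<phi> = (\<lambda>x. K * (exp (\<beta> * min (max x 0) k) - 1))"
    have [measurable]: "\<phi> \<in> borel_measurable borel" unfolding \<phi>_def by measurable
    have tp: "test_pair p \<phi> (\<lambda>x. Z x - 1)"
      unfolding \<phi>_def Z_def K_def by (rule test_pair_exp[OF p \<beta> k])
    have Zp: "exp (\<beta> * min (max x 0) k) = Z x powr p" for x
      using p by (simp add: Z_def exp_powr_real)
    have phi: "0 \<le> \<phi> x \<and> \<phi> x \<le> K * Z x powr p" for x
    proof -
      have "Z x powr p \<ge> 1" using Z(1)[of x] p by (simp add: ge_one_powr_ge_zero)
      then show ?thesis using K by (auto simp: \<phi>_def Zp intro!: mult_left_mono)
    qed
    define X where "X = (\<integral>x. F n x \<partial>M)"
    have XZ: "X = (\<integral>x. Z (u x) powr t \<partial>M)" by (simp add: X_def Ft Z_def k_def)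
    have X0: "X \<ge> 0" by (simp add: XZ)
    have "\<Lambda> * (\<integral>x. \<bar>Z (u x) - 1\<bar> powr t \<partial>M) powr (p / t) \<le> (\<integral>x. g x * \<phi> (u x) \<partial>M)"
    proof -
      have "\<bar>Z x - 1\<bar> \<le> exp (\<beta> / p * k)" for x using Z[of x] by (simp add: abs_le_iff)
      then show ?thesis using eb tp unfolding energy_bound_def by blast
    qed
    also have "\<dots> \<le> Lp_norm M q g * (K * (\<integral>x. (Z (u x) powr p) powr (q / (q - 1)) \<partial>M) powr (1 - 1 / q))"
    proof (rule integral_mult_dominated_le)
      show "Z (u x) powr p \<le> exp (\<beta> / p * k) powr p" for x using Z[of "u x"] p by (intro powr_mono2) auto
    qed (use g q K phi in auto)
    also have "(\<integral>x. (Z (u x) powr p) powr (q / (q - 1)) \<partial>M) = X"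
      unfolding XZ powr_powr t ..
    finally have "(\<integral>x. \<bar>Z (u x) - 1\<bar> powr t \<partial>M) powr (p / t) \<le> Lp_norm M q g * K / \<Lambda> * X powr (p / t)"
      using L by (simp add: pt pos_le_divide_eq mult.commute mult.left_commute)
    then have "((\<integral>x. \<bar>Z (u x) - 1\<bar> powr t \<partial>M) powr (p / t)) powr (t / p) \<le> (Lp_norm M q g * K / \<Lambda> * X powr (p / t)) powr (t / p)"
      using p t0 by (intro powr_mono2) auto
    also have "\<dots> = \<kappa> * (X powr (p / t)) powr (t / p)" unfolding \<kappa>_def by (rule powr_mult)
    finally have I: "(\<integral>x. (Z (u x) - 1) powr t \<partial>M) \<le> \<kappa> * X"
      using p t0 Z X0 by (simp add: powr_powr)
    have i1: "integrable M (\<lambda>x. (Z (u x) - 1) powr t)"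
    proof (rule integrable_bounded[where B = "exp (\<beta> / p * k) powr t"])
      fix x
      have "0 \<le> Z (u x) - 1" "Z (u x) - 1 \<le> exp (\<beta> / p * k)" using Z[of "u x"] by linarith+
      then show "(Z (u x) - 1) powr t \<le> exp (\<beta> / p * k) powr t" using t0 by (intro powr_mono2) auto
    qed auto
    have i2: "integrable M (\<lambda>x. Z (u x) powr t)" using int[of n] by (simp add: Ft[abs_def] Z_def k_def)
    have "\<theta> * X = (\<integral>x. \<theta> * Z (u x) powr t \<partial>M)" by (simp add: XZ)
    also have "\<dots> \<le> (\<integral>x. (Z (u x) - 1) powr t + c \<partial>M)"
      using i1 i2 c(2) Z by (intro integral_mono) auto
    also have "\<dots> = (\<integral>x. (Z (u x) - 1) powr t \<partial>M) + c * measure M (space M)" using i1 by simp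
    finally have "(\<theta> - \<kappa>) * X \<le> c * measure M (space M)" using I by (simp add: left_diff_distrib)
    then show ?thesis using th by (simp add: B_def X_def pos_le_divide_eq mult.commute)
  qed
  have lim: "(\<lambda>n. F n x) \<longlonglongrightarrow> exp (\<beta> * (q / (q - 1)) * max (u x) 0)" for x
    unfolding F_def by (rule tendsto_truncation)
  show ?thesis by (rule integral_bound_of_tendsto(1)[OF int nn lim bd])
qed

section \<open>Supercritical data and the decay of level sets\<close>

text \<open>The measure A h of the level set u \<ge> h is at most a constant times (m / (h -
  k))^\<sigma> (A k)^\<delta>, and \<delta> = t / (p q') > 1 by the choice of t. Such a superlinear
  recursion reaches 0 at a finite height; heights measured in units of m give the height C m with C
  independent of g.\<close>

lemma (in finite_measure) Linf_estimate:
  assumes p: "p > 1" and q: "q > 1" and t: "p * (q / (q - 1)) < t" and L: "\<Lambda> > 0"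
  shows "\<exists>C>0. \<forall>g u. g \<in> borel_measurable M \<longrightarrow> integrable M (\<lambda>x. \<bar>g x\<bar> powr q) \<longrightarrow>
     u \<in> borel_measurable M \<longrightarrow> energy_bound M p t \<Lambda> g u \<longrightarrow>
     (AE x in M. u x \<le> C * Lp_norm M q g powr (1 / (p - 1)))"
proof -
  have q': "q / (q - 1) > 1" using q by (simp add: field_simps)
  have "p * (q / (q - 1)) > 0" using p q by simp
  then have t0: "t > 0" using t by simp
  define \<delta> where "\<delta> = (1 - 1 / q) * (t / p)"
  have de: "\<delta> > 1" using t p q by (simp add: \<delta>_def field_simps)
  define \<sigma> where "\<sigma> = (p - 1) * t / p"
  have si: "\<sigma> > 0" using p t0 by (simp add: \<sigma>_def)
  define \<mu> where "\<mu> = measure M (space M) + 1"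
  have mu: "\<mu> > 0" by (simp add: \<mu>_def add_nonneg_pos)
  \<comment> \<open>The ratio of the geometric decay: the factor 2^\<sigma> lost at each halving of
    the gap is balanced by lam^(\<delta> - 1).\<close>
  define lam :: real where "lam = 2 powr (- (\<sigma> / (\<delta> - 1)))"
  have lam: "0 < lam" "lam < 1" using si de by (auto simp: lam_def powr_less_one)
  have lam': "2 powr \<sigma> * lam powr (\<delta> - 1) = 1"
    using de by (simp add: lam_def powr_powr powr_add[symmetric])
  \<comment> \<open>The value of C^(-\<sigma>) for which the recursion reproduces the bound \<mu>
    lam^n exactly; it determines C.\<close>
  define b where "b = lam * \<mu> powr (1 - \<delta>) * \<Lambda> powr (t / p) * 2 powr (- \<sigma>)"
  have b: "b > 0" using lam mu L by (simp add: b_def)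
  define C where "C = b powr (- (1 / \<sigma>))"
  have C: "C > 0" using b by (simp add: C_def)
  have Cb: "C powr (- \<sigma>) = b" using b si by (simp add: C_def powr_powr)
  show ?thesis
  proof (intro exI[of _ C] conjI allI impI C)
    fix g u :: "'a \<Rightarrow> real"
    assume gm[measurable]: "g \<in> borel_measurable M" and g: "integrable M (\<lambda>x. \<bar>g x\<bar> powr q)"
      and um[measurable]: "u \<in> borel_measurable M" and eb: "energy_bound M p t \<Lambda> g u"
    define m0 where "m0 = Lp_norm M q g powr (1 / (p - 1))"
    have m0: "m0 \<ge> 0" by (simp add: m0_def)
    have m0p: "m0 powr (p - 1) = Lp_norm M q g" using p by (simp add: m0_def powr_powr)
    define A where "A h = measure M {x \<in> space M. u x \<ge> h}" for h
    have A0: "A h \<ge> 0" for h by (simp add: A_def)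
    \<comment> \<open>One step of the recursion. The test function \<open>f\<close> is u - k cut to
      [0, h - k]: it equals h - k where u \<ge> h, which bounds the Sobolev side from below, and it
      is at most h - k and supported where u \<ge> k, which bounds the side of g.\<close>
    have step: "A h \<le> (m / (h - k)) powr \<sigma> * \<Lambda> powr (- (t / p)) * A k powr \<delta>" if kh: "0 \<le> k" "k < h" and m: "m > m0" for k h m
    proof -
      have mpos: "m > 0" using m m0 by simp
      define f where "f = (\<lambda>x. min (max (x - k) 0) (h - k))"
      have [measurable]: "f \<in> borel_measurable borel" unfolding f_def by measurable
      have tp: "test_pair p f f"
        using kh p by (intro test_pair_contraction) (auto simp: f_def)
      have f: "0 \<le> f x" "f x \<le> h - k" for x using kh by (auto simp: f_def)
      have "(h - k) powr t * A h = (\<integral>x. (h - k) powr t * indicator {x \<in> space M. u x \<ge> h} x \<partial>M)"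
        by (simp add: A_def)
      also have "\<dots> \<le> (\<integral>x. \<bar>f (u x)\<bar> powr t \<partial>M)"
      proof (rule integral_mono)
        show "integrable M (\<lambda>x. \<bar>f (u x)\<bar> powr t)"
          using f t0 by (intro integrable_bounded[where B = "(h - k) powr t"]) (auto intro!: powr_mono2)
        show "(h - k) powr t * indicator {x \<in> space M. u x \<ge> h} x \<le> \<bar>f (u x)\<bar> powr t" for x
          using kh by (auto simp: f_def indicator_def)
        show "integrable M (\<lambda>x. (h - k) powr t * indicator {x \<in> space M. u x \<ge> h} x)"
          by (intro integrable_bounded[where B = "(h - k) powr t"]) (auto simp: indicator_def)
      qed
      finally have "((h - k) powr t * A h) powr (p / t) \<le> (\<integral>x. \<bar>f (u x)\<bar> powr t \<partial>M) powr (p / t)"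
        using p t0 A0 by (intro powr_mono2) auto
      then have "\<Lambda> * ((h - k) powr t * A h) powr (p / t) \<le> \<Lambda> * (\<integral>x. \<bar>f (u x)\<bar> powr t \<partial>M) powr (p / t)"
        using L by simp
      also have "\<dots> \<le> (\<integral>x. g x * f (u x) \<partial>M)"
      proof -
        have "\<bar>f x\<bar> \<le> h - k" for x using f[of x] by simp
        then show ?thesis using eb tp unfolding energy_bound_def by blast
      qed
      also have "\<dots> \<le> Lp_norm M q g * ((h - k) * (\<integral>x. indicator {k..} (u x) powr (q / (q - 1)) \<partial>M) powr (1 - 1 / q))"
      proof (rule integral_mult_dominated_le)
        show "f (u x) \<le> (h - k) * indicator {k..} (u x)" for x
          using kh by (auto simp: f_def indicator_def)
        show "indicator {k..} (u x) \<le> (1::real)" for x by (simp add: indicator_def)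
      qed (use g q kh f in auto)
      also have "(\<integral>x. indicator {k..} (u x) powr (q / (q - 1)) \<partial>M) = (\<integral>x. indicator {x \<in> space M. u x \<ge> k} x \<partial>M)"
        by (intro Bochner_Integration.integral_cong) (auto simp: indicator_def)
      also have "\<dots> = A k" by (simp add: A_def)
      also have "Lp_norm M q g * ((h - k) * A k powr (1 - 1 / q)) \<le> m powr (p - 1) * ((h - k) * A k powr (1 - 1 / q))"
        unfolding m0p[symmetric] using m m0 p kh by (intro mult_right_mono powr_mono2) auto
      finally have "((h - k) powr t * A h) powr (p / t) \<le> m powr (p - 1) * ((h - k) * A k powr (1 - 1 / q)) / \<Lambda>"
        using L by (simp add: pos_le_divide_eq mult.commute)
      moreover have "((h - k) powr t * A h) powr (p / t) = (h - k) powr p * A h powr (p / t)"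
        using t0 powr_mult[of "(h - k) powr t" "A h" "p / t"] by (simp add: powr_powr)
      ultimately have "(h - k) powr p * A h powr (p / t) \<le> m powr (p - 1) * ((h - k) * A k powr (1 - 1 / q)) / \<Lambda>" by simp
      then have "A h powr (p / t) \<le> m powr (p - 1) * ((h - k) * A k powr (1 - 1 / q)) / \<Lambda> / (h - k) powr p"
        using kh by (subst pos_le_divide_eq) (simp_all add: mult.commute)
      also have "\<dots> = (m powr (p - 1) / (h - k) powr (p - 1)) * (1 / \<Lambda>) * A k powr (1 - 1 / q)"
        using kh by (simp add: powr_diff field_simps)
      also have "m powr (p - 1) / (h - k) powr (p - 1) = (m / (h - k)) powr (p - 1)"
        using kh mpos by (simp add: powr_divide)
      finally have "(A h powr (p / t)) powr (t / p) \<le> ((m / (h - k)) powr (p - 1) * (1 / \<Lambda>) * A k powr (1 - 1 / q)) powr (t / p)"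
        using p t0 by (intro powr_mono2) auto
      also have "\<dots> = ((m / (h - k)) powr (p - 1)) powr (t / p) * (1 / \<Lambda>) powr (t / p) * (A k powr (1 - 1 / q)) powr (t / p)"
        by (simp only: powr_mult)
      also have "\<dots> = (m / (h - k)) powr \<sigma> * \<Lambda> powr (- (t / p)) * A k powr \<delta>"
        using L by (simp add: powr_powr \<sigma>_def \<delta>_def powr_divide powr_minus inverse_eq_divide)
      finally show ?thesis using p t0 A0 by (simp add: powr_powr)
    qed
    have "AE x in M. u x \<le> C * m" if m: "m > m0" for m
    proof -
      have mpos: "m > 0" using m m0 by simp
      define d where "d = C * m"
      have d: "d > 0" using C mpos by (simp add: d_def)
      \<comment> \<open>Levels rising from 0 to d, the gap after level n being d / 2^(n +
        1).\<close>
      define h where "h n = d * (1 - (1/2) ^ n)" for n :: nat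
      have hle: "h n \<le> d" for n using d by (simp add: h_def mult_le_cancel_left1)
      have h0: "0 \<le> h n" for n using d by (simp add: h_def power_le_one)
      have hd: "h (Suc n) - h n = d * (1/2) ^ Suc n" for n by (simp add: h_def algebra_simps)
      have An: "A (h n) \<le> \<mu> * lam ^ n" for n
      proof (induction n)
        case 0
        have "A (h 0) \<le> measure M (space M)" unfolding A_def by (rule bounded_measure)
        then show ?case by (simp add: \<mu>_def)
      next
        case (Suc n)
        have "0 < d * (1/2) ^ Suc n" using d by simp
        then have lt: "h n < h (Suc n)" using hd[of n] by linarith
        have "A (h (Suc n)) \<le> (m / (h (Suc n) - h n)) powr \<sigma> * \<Lambda> powr (- (t / p)) * A (h n) powr \<delta>"
          by (rule step[OF h0 lt m])
        also have "\<dots> \<le> (m / (h (Suc n) - h n)) powr \<sigma> * \<Lambda> powr (- (t / p)) * (\<mu> * lam ^ n) powr \<delta>"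
          using Suc A0 de by (intro mult_left_mono powr_mono2) auto
        also have "m / (h (Suc n) - h n) = 2 ^ Suc n / C"
          unfolding hd d_def using mpos C by (simp add: power_one_over field_simps)
        also have "(2 ^ Suc n / C) powr \<sigma> = (2 powr \<sigma>) ^ Suc n * b"
        proof -
          have "(2 ^ Suc n / C) powr \<sigma> = (2 ^ Suc n) powr \<sigma> * C powr (- \<sigma>)"
            using powr_divide[of "2 ^ Suc n" C \<sigma>] C by (simp add: powr_minus_divide del: power_Suc)
          also have "(2 ^ Suc n) powr \<sigma> = (2 powr \<sigma>) ^ Suc n"
            by (simp add: powr_realpow[symmetric] powr_powr mult.commute del: power_Suc)
          finally show ?thesis by (simp only: Cb)
        qed
        also have "(\<mu> * lam ^ n) powr \<delta> = \<mu> powr \<delta> * (lam powr \<delta>) ^ n"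
        proof -
          have "(lam ^ n) powr \<delta> = (lam powr \<delta>) ^ n"
            using lam by (simp add: powr_realpow[symmetric] powr_powr mult.commute)
          then show ?thesis using powr_mult[of \<mu> "lam ^ n" \<delta>] by simp
        qed
        also have "(2 powr \<sigma>) ^ Suc n * b * \<Lambda> powr (- (t / p)) * (\<mu> powr \<delta> * (lam powr \<delta>) ^ n)
          = (2 powr \<sigma> * 2 powr (- \<sigma>)) * (\<mu> powr (1 - \<delta>) * \<mu> powr \<delta>) * (\<Lambda> powr (t / p) * \<Lambda> powr (- (t / p)))
             * lam * (2 powr \<sigma> * lam powr \<delta>) ^ n"
          by (simp add: b_def power_mult_distrib mult_ac)
        also have "2 powr \<sigma> * lam powr \<delta> = lam"
          using lam' lam by (simp add: powr_diff field_simps)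
        also have "\<mu> powr (1 - \<delta>) * \<mu> powr \<delta> = \<mu>" using mu by (simp add: powr_add[symmetric])
        also have "\<Lambda> powr (t / p) * \<Lambda> powr (- (t / p)) = 1" using L by (simp add: powr_add[symmetric])
        also have "2 powr \<sigma> * 2 powr (- \<sigma>) = (1::real)" by (simp add: powr_add[symmetric])
        finally show ?case by simp
      qed
      have "A d \<le> \<mu> * lam ^ n" for n
      proof -
        have "A d \<le> A (h n)" unfolding A_def using hle[of n] by (intro finite_measure_mono) auto
        then show ?thesis using An[of n] by simp
      qed
      moreover have "(\<lambda>n. \<mu> * lam ^ n) \<longlonglongrightarrow> \<mu> * 0"
        using lam by (intro tendsto_intros LIMSEQ_realpow_zero) auto
      ultimately have "A d \<le> 0" by (intro LIMSEQ_le_const[where X = "\<lambda>n. \<mu> * lam ^ n"]) auto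
      then have "emeasure M {x \<in> space M. u x \<ge> d} = 0"
        using A0[of d] by (simp add: A_def emeasure_eq_measure order_antisym)
      then have "AE x in M. \<not> u x \<ge> d"
        by (subst AE_iff_measurable[OF _ refl]) auto
      then show ?thesis unfolding d_def by eventually_elim auto
    qed
    \<comment> \<open>The exceptional null set depends on m, so m descends to m0 along a
      sequence.\<close>
    then have "AE x in M. \<forall>n. u x \<le> C * (m0 + 1 / real (Suc n))"
      by (intro AE_all_countable[THEN iffD2] allI) auto
    then show "AE x in M. u x \<le> C * Lp_norm M q g powr (1 / (p - 1))"
    proof eventually_elim
      case (elim x)
      have "(\<lambda>n. C * (m0 + 1 / real (Suc n))) \<longlonglongrightarrow> C * (m0 + 0)"
        by (intro tendsto_intros LIMSEQ_Suc[OF lim_1_over_n])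
      then have "u x \<le> C * (m0 + 0)"
        using elim by (intro LIMSEQ_le_const[where X = "\<lambda>n. C * (m0 + 1 / real (Suc n))"]) auto
      then show ?case by (simp add: m0_def)
    qed
  qed
qed

section \<open>The fractional Morrey inequality\<close>

lemma powr_subadditive:
  fixes a b \<alpha> :: real
  assumes "0 \<le> a" "0 \<le> b" "0 < \<alpha>" "\<alpha> \<le> 1"
  shows "(a + b) powr \<alpha> \<le> a powr \<alpha> + b powr \<alpha>"
proof (cases "a = 0 \<or> b = 0")
  case False
  then have ab: "a > 0" "b > 0" using assms by auto
  have *: "x * (a + b) powr (\<alpha> - 1) \<le> x powr \<alpha>" if "0 < x" "x \<le> a + b" for x
  proof -
    have "x * (a + b) powr (\<alpha> - 1) \<le> x * x powr (\<alpha> - 1)"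
      using that assms by (intro mult_left_mono powr_mono2') auto
    also have "\<dots> = x powr \<alpha>" using that powr_mult_base[of x "\<alpha> - 1"] by simp
    finally show ?thesis .
  qed
  have "(a + b) powr \<alpha> = (a + b) * (a + b) powr (\<alpha> - 1)"
    using ab powr_mult_base[of "a + b" "\<alpha> - 1"] by simp
  also have "\<dots> = a * (a + b) powr (\<alpha> - 1) + b * (a + b) powr (\<alpha> - 1)" by (simp add: distrib_right)
  also have "\<dots> \<le> a powr \<alpha> + b powr \<alpha>" using ab by (intro add_mono *) auto
  finally show ?thesis .
qed (use assms in auto)

text \<open>McShane's extension: \<alpha> \<le> 1 makes \<open>dist\<close> to the power \<alpha> a
  metric, so the infimum of Lipschitz functions in that metric keeps the constant H. It turns an
  estimate on a set of full measure into a representative defined everywhere.\<close>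

lemma Holder_extension:
  fixes u :: "'a::metric_space \<Rightarrow> real"
  assumes X: "X \<noteq> {}" and H: "H \<ge> 0" and \<alpha>: "0 < \<alpha>" "\<alpha> \<le> 1"
    and u: "\<And>x y. x \<in> X \<Longrightarrow> y \<in> X \<Longrightarrow> \<bar>u x - u y\<bar> \<le> H * dist x y powr \<alpha>"
  shows "\<exists>w. (\<forall>x\<in>X. w x = u x) \<and> (\<forall>x y. \<bar>w x - w y\<bar> \<le> H * dist x y powr \<alpha>)"
proof -
  define w where "w x = (INF y\<in>X. u y + H * dist x y powr \<alpha>)" for x
  obtain y0 where y0: "y0 \<in> X" using X by auto
  have tri: "H * dist x z powr \<alpha> \<le> H * dist x y powr \<alpha> + H * dist y z powr \<alpha>" for x y z
  proof -
    have "dist x z powr \<alpha> \<le> (dist x y + dist y z) powr \<alpha>"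
      using \<alpha> by (intro powr_mono2 dist_triangle) auto
    also have "\<dots> \<le> dist x y powr \<alpha> + dist y z powr \<alpha>" using \<alpha> by (intro powr_subadditive) auto
    finally show ?thesis using H mult_left_mono by (fastforce simp flip: distrib_left)
  qed
  have bdd: "bdd_below ((\<lambda>y. u y + H * dist x y powr \<alpha>) ` X)" for x
  proof (rule bdd_belowI2)
    fix y assume "y \<in> X"
    then have "u y0 - u y \<le> H * dist y0 y powr \<alpha>" using u[OF y0, of y] by linarith
    then show "u y0 - H * dist y0 x powr \<alpha> \<le> u y + H * dist x y powr \<alpha>"
      using tri[of y0 y x] by linarith
  qed
  have le: "w x \<le> w y + H * dist x y powr \<alpha>" for x y
  proof -
    have "w x - H * dist x y powr \<alpha> \<le> w y"
      unfolding w_def[of y]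
    proof (rule cINF_greatest[OF X])
      fix z assume "z \<in> X"
      then have "w x \<le> u z + H * dist x z powr \<alpha>" unfolding w_def by (intro cINF_lower bdd)
      then show "w x - H * dist x y powr \<alpha> \<le> u z + H * dist y z powr \<alpha>" using tri[of x z y] by linarith
    qed
    then show ?thesis by linarith
  qed
  have "w x = u x" if "x \<in> X" for x
  proof (rule antisym)
    have "w x \<le> u x + H * dist x x powr \<alpha>" unfolding w_def using that by (intro cINF_lower bdd)
    then show "w x \<le> u x" by simp
    show "u x \<le> w x" unfolding w_def
    proof (rule cINF_greatest[OF X])
      fix y assume "y \<in> X"
      then show "u x \<le> u y + H * dist x y powr \<alpha>" using u[OF that, of y] by linarith
    qed
  qed
  moreover have "\<bar>w x - w y\<bar> \<le> H * dist x y powr \<alpha>" for x y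
    using le[of x y] le[of y x] by (simp add: abs_le_iff dist_commute)
  ultimately show ?thesis by blast
qed

text \<open>If F exceeded J / m on all of S, its integral over S would be at least J.\<close>

lemma exists_le_of_nn_integral_less:
  fixes F :: "'a \<Rightarrow> ennreal"
  assumes S: "S \<in> sets M" "emeasure M S = ennreal m" "m > 0"
    and I: "(\<integral>\<^sup>+x. F x * indicator S x \<partial>M) < ennreal J"
  shows "\<exists>x\<in>S. F x \<le> ennreal (J / m)"
proof (rule ccontr)
  assume "\<not> ?thesis"
  then have F: "ennreal (J / m) \<le> F x" if "x \<in> S" for x using that by force
  have "ennreal J = ennreal (J / m) * emeasure M S"
    using S by (simp add: ennreal_mult'[symmetric] ennreal_mult''[symmetric])
  also have "\<dots> = (\<integral>\<^sup>+x. ennreal (J / m) * indicator S x \<partial>M)"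
    using S by (simp add: nn_integral_cmult_indicator)
  also have "\<dots> \<le> (\<integral>\<^sup>+x. F x * indicator S x \<partial>M)"
    using F by (intro nn_integral_mono) (auto simp: indicator_def)
  finally show False using I by simp
qed

text \<open>Both values are compared with u y for one y in the ball of radius \<rho> about z.
  Distances to y are at most 2 \<rho>, so the kernel is bounded below and the point energies control
  the integral over y of |u z - u y|^p + |u z' - u y|^p; a suitable y exists by averaging.\<close>

lemma diff_le_point_energy:
  fixes u :: "'a::euclidean_space \<Rightarrow> real" and s p N \<omega> :: real
  defines "N \<equiv> real DIM('a)" and "\<omega> \<equiv> unit_ball_vol (real DIM('a))"
  assumes [measurable]: "u \<in> borel_measurable borel" and sp: "0 < s" "0 < p"
    and d: "d > 0" "point_energy s p u z \<le> ennreal d" "point_energy s p u z' \<le> ennreal d"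
    and \<rho>: "\<rho> > 0" "dist z z' \<le> \<rho>"
  shows "\<bar>u z - u z'\<bar> \<le> 2 * (3 * 2 powr (N + s * p) / \<omega>) powr (1 / p) * (\<rho> powr s * d powr (1 / p))"
proof -
  have N: "N > 0" and om: "\<omega> > 0" by (simp_all add: N_def \<omega>_def)
  define R where "R = (2 * \<rho>) powr (N + s * p)"
  have R: "R > 0" using \<rho> by (simp add: R_def)
  define m where "m = \<omega> * \<rho> ^ DIM('a)"
  have m: "m > 0" using om \<rho> by (simp add: m_def)
  define B where "B = ball z \<rho>"
  have B: "B \<in> sets lborel" "emeasure lborel B = ennreal m"
    using \<rho> by (simp_all add: B_def m_def \<omega>_def emeasure_ball)
  define F where "F y = ennreal (\<bar>u z - u y\<bar> powr p) + ennreal (\<bar>u z' - u y\<bar> powr p)" for y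
  have ptw: "\<bar>u x - u y\<bar> powr p \<le> R * gagliardo_integrand s p u (x, y)" if "dist x y \<le> 2 * \<rho>" for x y
  proof (cases "x = y")
    case False
    have "norm (x - y) powr (N + s * p) \<le> R"
      unfolding R_def using that N sp by (intro powr_mono2) (auto simp: dist_norm)
    moreover have "norm (x - y) powr (N + s * p) > 0" using False by simp
    moreover have "0 \<le> \<bar>u x - u y\<bar> powr p" by simp
    ultimately have "\<bar>u x - u y\<bar> powr p * norm (x - y) powr (N + s * p) \<le> R * \<bar>u x - u y\<bar> powr p"
      by (metis mult.commute mult_right_mono)
    then show ?thesis using \<open>norm (x - y) powr (N + s * p) > 0\<close>
      by (simp add: gagliardo_integrand_def N_def pos_le_divide_eq)
  qed (use sp R in \<open>auto intro!: mult_nonneg_nonneg\<close>)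
  have "(\<integral>\<^sup>+y. F y * indicator B y \<partial>lborel) \<le>
    (\<integral>\<^sup>+y. ennreal R * ennreal (gagliardo_integrand s p u (z, y)) + ennreal R * ennreal (gagliardo_integrand s p u (z', y)) \<partial>lborel)"
  proof (rule nn_integral_mono)
    fix y
    show "F y * indicator B y \<le> ennreal R * ennreal (gagliardo_integrand s p u (z, y)) + ennreal R * ennreal (gagliardo_integrand s p u (z', y))"
    proof (cases "y \<in> B")
      case True
      then have "dist z y \<le> 2 * \<rho>" "dist z' y \<le> 2 * \<rho>"
        using \<rho> dist_triangle[of z' y z] by (auto simp: B_def dist_commute)
      then show ?thesis using True R ptw
        by (auto simp: F_def ennreal_mult[symmetric] intro!: add_mono ennreal_leI)
    qed simp
  qed
  also have "\<dots> = ennreal R * point_energy s p u z + ennreal R * point_energy s p u z'"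
    unfolding point_energy_def by (simp add: nn_integral_add nn_integral_cmult)
  also have "\<dots> \<le> ennreal R * ennreal d + ennreal R * ennreal d"
    using d by (intro add_mono mult_left_mono) auto
  also have "\<dots> = ennreal (2 * R * d)"
    using R d by (simp add: ennreal_mult[symmetric] ennreal_plus[symmetric] del: ennreal_plus)
  \<comment> \<open>The 3 in place of 2 gives the strict inequality that the selection of y
    requires.\<close>
  also have "\<dots> < ennreal (3 * R * d)" using R d by (intro ennreal_lessI) auto
  finally obtain y where y: "F y \<le> ennreal (3 * R * d / m)"
    using exists_le_of_nn_integral_less[OF B m] by blast
  define c where "c = (3 * R * d / m) powr (1 / p)"
  have bd: "\<bar>u x - u y\<bar> \<le> c" if "x = z \<or> x = z'" for x
  proof -
    have "ennreal (\<bar>u x - u y\<bar> powr p) \<le> F y" using that by (auto simp: F_def add_increasing add_increasing2)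
    then have "ennreal (\<bar>u x - u y\<bar> powr p) \<le> ennreal (3 * R * d / m)" using y by simp
    then have "\<bar>u x - u y\<bar> powr p \<le> 3 * R * d / m" using R d m by (subst (asm) ennreal_le_iff) auto
    then have "(\<bar>u x - u y\<bar> powr p) powr (1 / p) \<le> c" unfolding c_def using sp by (intro powr_mono2) auto
    then show ?thesis using sp by (simp add: powr_powr)
  qed
  have le: "\<bar>u z - u z'\<bar> \<le> 2 * c" using bd[OF disjI1[OF refl]] bd[OF disjI2[OF refl]] by linarith
  have "3 * R * d / m = (3 * 2 powr (N + s * p) / \<omega>) * (\<rho> powr (s * p) * d)"
  proof -
    have "\<rho> ^ DIM('a) = \<rho> powr N" using \<rho> by (simp add: N_def powr_realpow)
    moreover have "R = 2 powr (N + s * p) * (\<rho> powr N * \<rho> powr (s * p))"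
      unfolding R_def by (simp add: powr_mult powr_add)
    ultimately show ?thesis using \<rho> om by (simp add: m_def field_simps)
  qed
  then have "c = (3 * 2 powr (N + s * p) / \<omega>) powr (1 / p) * ((\<rho> powr (s * p)) powr (1 / p) * d powr (1 / p))"
    unfolding c_def by (simp only: powr_mult)
  also have "(\<rho> powr (s * p)) powr (1 / p) = \<rho> powr s" using sp by (simp add: powr_powr)
  finally show ?thesis using le by simp
qed

lemma exists_point_energy_le:
  fixes u :: "'a::euclidean_space \<Rightarrow> real"
  assumes um: "u \<in> borel_measurable borel" and E: "nonlocal_energy s p u < ennreal e" and r: "r > 0"
  shows "\<exists>z\<in>ball x r. point_energy s p u z \<le> ennreal (e / (unit_ball_vol (real DIM('a)) * r powr (real DIM('a))))"
proof (rule exists_le_of_nn_integral_less)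
  show "emeasure lborel (ball x r) = ennreal (unit_ball_vol (real DIM('a)) * r powr (real DIM('a)))"
    using r by (simp add: emeasure_ball powr_realpow)
  have "(\<integral>\<^sup>+y. point_energy s p u y * indicator (ball x r) y \<partial>lborel) \<le> nonlocal_energy s p u"
    unfolding nonlocal_energy_eq_point_energy(1)[OF um] by (intro nn_integral_mono) (auto simp: indicator_def)
  then show "(\<integral>\<^sup>+y. point_energy s p u y * indicator (ball x r) y \<partial>lborel) < ennreal e"
    using E by simp
qed (use r in auto)

text \<open>
  The chain of points \<open>z n \<rightarrow> x\<close> with small point energy replaces the averages of the usual Campanato
  argument.
\<close>

lemma point_energy_chain:
  fixes u :: "'a::euclidean_space \<Rightarrow> real" and s p N \<omega> :: real
  defines "N \<equiv> real DIM('a)" and "\<omega> \<equiv> unit_ball_vol (real DIM('a))"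
  assumes sp: "0 < s" "0 < p" "N < s * p"
  shows "\<exists>C>0. \<forall>u e \<rho> x. u \<in> borel_measurable borel \<longrightarrow> nonlocal_energy s p u < ennreal e \<longrightarrow> 0 < \<rho> \<longrightarrow>
     point_energy s p u (x::'a) < \<infinity> \<longrightarrow>
     (\<exists>z\<in>ball x \<rho>. point_energy s p u z \<le> ennreal (e / (\<omega> * \<rho> powr N)) \<and>
        \<bar>u x - u z\<bar> \<le> C * (\<rho> powr (s - N / p) * e powr (1 / p)))"
proof -
  define C0 where "C0 = 2 * (3 * 2 powr (N + s * p) / \<omega>) powr (1 / p)"
  define \<alpha> where "\<alpha> = s - N / p"
  \<comment> \<open>The ratio of successive links of the chain, below 1 because s p > N; C below is
    the sum of the resulting geometric series.\<close>
  define \<kappa> :: real where "\<kappa> = 2 powr (- \<alpha>)"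
  define C2 where "C2 = C0 * 4 powr s * (1 / \<omega>) powr (1 / p)"
  define C where "C = C2 * \<kappa> / (1 - \<kappa>)"
  have N: "N > 0" and om: "\<omega> > 0" by (simp_all add: N_def \<omega>_def)
  have al: "\<alpha> > 0" using sp by (simp add: \<alpha>_def field_simps)
  have kap: "0 < \<kappa>" "\<kappa> < 1" using al by (auto simp: \<kappa>_def powr_less_one)
  have C0: "C0 > 0" using om by (simp add: C0_def)
  have C2: "C2 > 0" using C0 om by (simp add: C2_def)
  have C: "C > 0" using C2 kap by (simp add: C_def)
  show ?thesis
  proof (intro exI[of _ C] conjI allI impI C)
    fix u :: "'a \<Rightarrow> real" and e \<rho> :: real and x :: 'a
    assume um: "u \<in> borel_measurable borel" and E: "nonlocal_energy s p u < ennreal e" and \<rho>: "0 < \<rho>"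
      and x: "point_energy s p u x < \<infinity>"
    have e: "e > 0" using E by (cases "e > 0") (auto simp: ennreal_neg)
    define r where "r n = \<rho> * (1/2) ^ n" for n :: nat
    have r: "r n > 0" for n using \<rho> by (simp add: r_def)
    have rS: "r n = 2 * r (Suc n)" for n by (simp add: r_def)
    define d where "d n = e / (\<omega> * r n powr N)" for n
    have d: "d n > 0" for n using e om r[of n] by (simp add: d_def)
    have dmono: "d n \<le> d (Suc n)" for n
      unfolding d_def using e om r[of n] r[of "Suc n"] N rS[of n]
      by (intro divide_left_mono mult_left_mono powr_mono2) auto
    have "\<exists>z\<in>ball x (r n). point_energy s p u z \<le> ennreal (d n)" for n
      using exists_point_energy_le[OF um E r, of x n] by (simp add: d_def N_def \<omega>_def)
    then obtain z where z: "\<And>n. z n \<in> ball x (r n)" "\<And>n. point_energy s p u (z n) \<le> ennreal (d n)" by metis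
    have rpow: "r n powr b = \<rho> powr b * (2 powr (- b)) ^ n" for n b
    proof -
      have "((1/2::real) ^ n) powr b = (2 powr (- b)) ^ n"
        by (simp add: powr_realpow[symmetric] powr_powr powr_divide powr_minus field_simps)
      then show ?thesis by (simp add: r_def powr_mult)
    qed
    \<comment> \<open>The point energies along the chain may grow like r^(-N), but r^s outweighs the
      p-th root of this growth; the remaining power is \<alpha> = s - N / p.\<close>
    have rd: "r n powr s * d n powr (1 / p) = (1 / \<omega>) powr (1 / p) * e powr (1 / p) * r n powr \<alpha>" for n
    proof -
      have "d n = (1 / \<omega>) * e * r n powr (- N)" by (simp add: d_def powr_minus field_simps)
      then have "d n powr (1 / p) = (1 / \<omega>) powr (1 / p) * e powr (1 / p) * r n powr (- N * (1 / p))"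
        by (simp only: powr_mult powr_powr)
      then show ?thesis by (simp add: \<alpha>_def powr_diff powr_minus divide_inverse)
    qed
    have step: "\<bar>u (z n) - u (z (Suc n))\<bar> \<le> C2 * e powr (1 / p) * \<rho> powr \<alpha> * \<kappa> ^ Suc n" for n
    proof -
      have "dist (z n) (z (Suc n)) \<le> dist (z n) x + dist x (z (Suc n))" by (rule dist_triangle)
      also have "\<dots> \<le> 4 * r (Suc n)"
        using z(1)[of n] z(1)[of "Suc n"] rS[of n] r[of "Suc n"] by (auto simp: dist_commute)
      finally have "\<bar>u (z n) - u (z (Suc n))\<bar> \<le> C0 * ((4 * r (Suc n)) powr s * d (Suc n) powr (1 / p))"
        unfolding C0_def N_def \<omega>_def using sp um d r z(2)[of n] z(2)[of "Suc n"] dmono[of n]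
        by (intro diff_le_point_energy) (auto intro: order_trans ennreal_leI)
      also have "(4 * r (Suc n)) powr s * d (Suc n) powr (1 / p) = 4 powr s * (r (Suc n) powr s * d (Suc n) powr (1 / p))"
        by (simp add: powr_mult)
      also have "\<dots> = 4 powr s * ((1 / \<omega>) powr (1 / p) * e powr (1 / p) * (\<rho> powr \<alpha> * \<kappa> ^ Suc n))"
        unfolding rd unfolding rpow \<kappa>_def ..
      finally show ?thesis by (simp add: C2_def mult_ac)
    qed
    define L where "L = C * (\<rho> powr \<alpha> * e powr (1 / p))"
    have L0: "L \<ge> 0" using C by (simp add: L_def)
    have tele: "\<bar>u (z 0) - u (z n)\<bar> \<le> L * (1 - \<kappa> ^ n)" for n
    proof (induction n)
      case (Suc n)
      have "\<bar>u (z 0) - u (z (Suc n))\<bar> \<le> L * (1 - \<kappa> ^ n) + C2 * e powr (1 / p) * \<rho> powr \<alpha> * \<kappa> ^ Suc n"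
        using Suc step[of n] by linarith
      also have "C2 * e powr (1 / p) * \<rho> powr \<alpha> * \<kappa> ^ Suc n = L * (1 - \<kappa>) * \<kappa> ^ n"
        using kap by (simp add: L_def C_def)
      also have "L * (1 - \<kappa> ^ n) + L * (1 - \<kappa>) * \<kappa> ^ n = L * (1 - \<kappa> ^ Suc n)" by (simp add: algebra_simps)
      finally show ?case .
    qed simp
    define dx where "dx = enn2real (point_energy s p u x)"
    have dx: "dx \<ge> 0" "point_energy s p u x = ennreal dx" using x by (auto simp: dx_def)
    \<comment> \<open>Finite point energy at x ties the chain to x: x and z n both have point energy
      at most dx + d n. This takes the place of a Lebesgue point argument.\<close>
    have near: "\<bar>u x - u (z n)\<bar> \<le> C0 * (r n powr s * (dx + d n) powr (1 / p))" for n
    proof -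
      have "point_energy s p u (z n) \<le> ennreal (dx + d n)"
        by (rule order_trans[OF z(2) ennreal_leI]) (use dx in simp)
      moreover have "point_energy s p u x \<le> ennreal (dx + d n)"
        unfolding dx(2) using d[of n] by (intro ennreal_leI) simp
      moreover have "dist x (z n) \<le> r n" using z(1)[of n] by simp
      ultimately show ?thesis
        unfolding C0_def N_def \<omega>_def using sp um d[of n] dx(1) r
        by (intro diff_le_point_energy) auto
    qed
    have conv: "(\<lambda>n. C0 * (r n powr s * (dx + d n) powr (1 / p))) \<longlonglongrightarrow> C0 * 0"
    proof (intro tendsto_mult tendsto_const)
      have eq: "r n powr s * (dx + d n) powr (1 / p) = (\<rho> powr (s * p) * dx * (2 powr (- (s * p))) ^ n
          + e / \<omega> * \<rho> powr (s * p - N) * (2 powr (- (s * p - N))) ^ n) powr (1 / p)" for n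
      proof -
        have "r n powr s = (r n powr (s * p)) powr (1 / p)" using sp by (simp add: powr_powr)
        then have "r n powr s * (dx + d n) powr (1 / p) = (r n powr (s * p) * (dx + d n)) powr (1 / p)"
          by (simp only: powr_mult)
        also have "r n powr (s * p) * (dx + d n) = r n powr (s * p) * dx + e / \<omega> * r n powr (s * p - N)"
          by (simp add: d_def powr_diff distrib_left)
        also have "\<dots> = \<rho> powr (s * p) * dx * (2 powr (- (s * p))) ^ n
          + e / \<omega> * \<rho> powr (s * p - N) * (2 powr (- (s * p - N))) ^ n" unfolding rpow by simp
        finally show ?thesis .
      qed
      have "(\<lambda>n. (\<rho> powr (s * p) * dx * (2 powr (- (s * p))) ^ n
          + e / \<omega> * \<rho> powr (s * p - N) * (2 powr (- (s * p - N))) ^ n) powr (1 / p))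
        \<longlonglongrightarrow> (\<rho> powr (s * p) * dx * 0 + e / \<omega> * \<rho> powr (s * p - N) * 0) powr (1 / p)"
      proof (intro tendsto_powr' tendsto_add tendsto_mult tendsto_const LIMSEQ_realpow_zero)
        show "2 powr - (s * p) < (1::real)" "2 powr - (s * p - N) < (1::real)"
          using sp N by (intro powr_less_one; simp)+
        show "\<rho> powr (s * p) * dx * 0 + e / \<omega> * \<rho> powr (s * p - N) * 0 \<noteq> 0 \<or> 0 < 1 / p \<and>
          (\<forall>\<^sub>F n in sequentially. 0 \<le> \<rho> powr (s * p) * dx * (2 powr - (s * p)) ^ n
             + e / \<omega> * \<rho> powr (s * p - N) * (2 powr - (s * p - N)) ^ n)"
          using sp dx e om by auto
      qed (use \<rho> in auto)
      then show "(\<lambda>n. r n powr s * (dx + d n) powr (1 / p)) \<longlonglongrightarrow> 0" unfolding eq by simp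
    qed
    have "\<bar>u x - u (z 0)\<bar> \<le> C0 * (r n powr s * (dx + d n) powr (1 / p)) + L" for n
    proof -
      have "L * (1 - \<kappa> ^ n) \<le> L * 1" using L0 kap by (intro mult_left_mono) auto
      then show ?thesis using near[of n] tele[of n] by linarith
    qed
    moreover have "(\<lambda>n. C0 * (r n powr s * (dx + d n) powr (1 / p)) + L) \<longlonglongrightarrow> C0 * 0 + L"
      by (intro tendsto_add conv tendsto_const)
    ultimately have "\<bar>u x - u (z 0)\<bar> \<le> C0 * 0 + L"
      by (intro LIMSEQ_le_const[where X = "\<lambda>n. C0 * (r n powr s * (dx + d n) powr (1 / p)) + L"]) auto
    then have "\<bar>u x - u (z 0)\<bar> \<le> C * (\<rho> powr (s - N / p) * e powr (1 / p))"
      by (simp add: L_def \<alpha>_def)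
    then show "\<exists>z\<in>ball x \<rho>. point_energy s p u z \<le> ennreal (e / (\<omega> * \<rho> powr N)) \<and>
        \<bar>u x - u z\<bar> \<le> C * (\<rho> powr (s - N / p) * e powr (1 / p))"
      using z(1)[of 0] z(2)[of 0] by (intro bexI[of _ "z 0"]) (auto simp: r_def d_def)
  qed
qed

text \<open>The chains for x and y at scale dist x y provide z and z' at most three times that
  distance apart, and \<open>diff_le_point_energy\<close> closes the gap. The chain asks for energy
  strictly below e; letting e decrease to the energy removes this.\<close>

lemma Morrey_pointwise:
  fixes s p N :: real
  defines "N \<equiv> real DIM('a::euclidean_space)"
  assumes sp: "0 < s" "0 < p" "N < s * p"
  shows "\<exists>C>0. \<forall>u x (y::'a). u \<in> borel_measurable borel \<longrightarrow> nonlocal_energy s p u < \<infinity> \<longrightarrow>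
     point_energy s p u x < \<infinity> \<longrightarrow> point_energy s p u y < \<infinity> \<longrightarrow>
     \<bar>u x - u y\<bar> \<le> C * enn2real (nonlocal_energy s p u) powr (1 / p) * dist x y powr (s - N / p)"
proof -
  define \<omega> where "\<omega> = unit_ball_vol (real DIM('a))"
  define C0 where "C0 = 2 * (3 * 2 powr (N + s * p) / \<omega>) powr (1 / p)"
  have om: "\<omega> > 0" by (simp add: \<omega>_def)
  obtain C1 where C1: "C1 > 0" and chain: "\<And>u e \<rho> (x::'a). u \<in> borel_measurable borel \<Longrightarrow> nonlocal_energy s p u < ennreal e \<Longrightarrow> 0 < \<rho> \<Longrightarrow>
     point_energy s p u x < \<infinity> \<Longrightarrow>
     (\<exists>z\<in>ball x \<rho>. point_energy s p u z \<le> ennreal (e / (\<omega> * \<rho> powr N)) \<and>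
        \<bar>u x - u z\<bar> \<le> C1 * (\<rho> powr (s - N / p) * e powr (1 / p)))"
    using point_energy_chain[where 'a='a, OF sp(1,2)] sp(3) unfolding N_def \<omega>_def by metis
  define C where "C = 2 * C1 + C0 * 3 powr s * (1 / \<omega>) powr (1 / p)"
  have C: "C > 0" using C1 om by (simp add: C_def C0_def add_pos_nonneg)
  show ?thesis
  proof (intro exI[of _ C] conjI allI impI C)
    fix u and x y :: 'a
    assume um: "u \<in> borel_measurable borel" and E: "nonlocal_energy s p u < \<infinity>"
      and x: "point_energy s p u x < \<infinity>" and y: "point_energy s p u y < \<infinity>"
    define E0 where "E0 = enn2real (nonlocal_energy s p u)"
    show "\<bar>u x - u y\<bar> \<le> C * enn2real (nonlocal_energy s p u) powr (1 / p) * dist x y powr (s - N / p)"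
    proof (cases "x = y")
      case False
      define \<rho> where "\<rho> = dist x y"
      have rho: "\<rho> > 0" using False by (simp add: \<rho>_def)
      have "\<bar>u x - u y\<bar> \<le> C * \<rho> powr (s - N / p) * e powr (1 / p)" if e: "e > E0" for e
      proof -
        have e0: "e > 0" using e by (simp add: E0_def le_less_trans[OF enn2real_nonneg])
        have Ee: "nonlocal_energy s p u < ennreal e"
          using e E e0 by (cases "nonlocal_energy s p u") (auto simp: E0_def intro!: ennreal_lessI)
        obtain z where z: "z \<in> ball x \<rho>" "point_energy s p u z \<le> ennreal (e / (\<omega> * \<rho> powr N))"
           "\<bar>u x - u z\<bar> \<le> C1 * (\<rho> powr (s - N / p) * e powr (1 / p))"
          using chain[OF um Ee rho x] by blast
        obtain z' where z': "z' \<in> ball y \<rho>" "point_energy s p u z' \<le> ennreal (e / (\<omega> * \<rho> powr N))"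
           "\<bar>u y - u z'\<bar> \<le> C1 * (\<rho> powr (s - N / p) * e powr (1 / p))"
          using chain[OF um Ee rho y] by blast
        have "dist z z' \<le> dist z x + dist x y + dist y z'"
          by (metis add.commute add_left_mono dist_triangle order_trans)
        also have "\<dots> \<le> 3 * \<rho>" using z(1) z'(1) by (simp add: \<rho>_def dist_commute)
        finally have "\<bar>u z - u z'\<bar> \<le> C0 * ((3 * \<rho>) powr s * (e / (\<omega> * \<rho> powr N)) powr (1 / p))"
          unfolding C0_def using sp um e0 om rho z(2) z'(2) unfolding N_def \<omega>_def
          by (intro diff_le_point_energy) auto
        also have "(3 * \<rho>) powr s * (e / (\<omega> * \<rho> powr N)) powr (1 / p)
          = 3 powr s * (1 / \<omega>) powr (1 / p) * (\<rho> powr (s - N / p) * e powr (1 / p))"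
        proof -
          have "e / (\<omega> * \<rho> powr N) = (1 / \<omega>) * e * \<rho> powr (- N)" by (simp add: powr_minus field_simps)
          then have "(e / (\<omega> * \<rho> powr N)) powr (1 / p) = (1 / \<omega>) powr (1 / p) * e powr (1 / p) * \<rho> powr (- N * (1 / p))"
            by (simp only: powr_mult powr_powr)
          then show ?thesis by (simp add: powr_mult powr_diff powr_minus divide_inverse)
        qed
        finally have "\<bar>u z - u z'\<bar> \<le> C0 * 3 powr s * (1 / \<omega>) powr (1 / p) * (\<rho> powr (s - N / p) * e powr (1 / p))"
          by (simp add: mult_ac)
        then have "\<bar>u x - u y\<bar> \<le> C * (\<rho> powr (s - N / p) * e powr (1 / p))"
          using z(3) z'(3) unfolding C_def distrib_right by linarith
        then show ?thesis by (simp add: mult_ac)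
      qed
      then have "\<bar>u x - u y\<bar> \<le> C * \<rho> powr (s - N / p) * E0 powr (1 / p)"
        using sp by (intro le_powr_of_gt[where ?m0.0 = E0]) (auto simp: E0_def)
      then show ?thesis by (simp add: \<rho>_def E0_def mult_ac)
    qed simp
  qed
qed

text \<open>The representative w is the extension of u from the full-measure set X on which the
  pointwise estimate is available. Its size is bounded through a zero: u vanishes at the points of X
  outside \<Omega>, and one of them at bounded distance turns the Hoelder estimate into a bound on
  |w|.\<close>

lemma Morrey_embedding:
  fixes s p N \<alpha> :: real and \<Omega> :: "'a::euclidean_space set"
  defines "N \<equiv> real DIM('a)" and "\<alpha> \<equiv> (s * p - N) / p"
  assumes sp: "0 < s" "s < 1" "0 < p" "N < s * p" and \<Omega>: "bounded \<Omega>"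
  shows "\<exists>C>0. \<forall>u. u \<in> borel_measurable borel \<longrightarrow> nonlocal_energy s p u < \<infinity> \<longrightarrow>
     (AE x in lborel. x \<notin> \<Omega> \<longrightarrow> u x = 0) \<longrightarrow>
     (\<exists>w. (AE x in lborel. w x = u x) \<and>
        (\<forall>x y. \<bar>w x - w y\<bar> \<le> C * enn2real (nonlocal_energy s p u) powr (1 / p) * dist x y powr \<alpha>) \<and>
        (\<forall>x\<in>closure \<Omega>. \<bar>w x\<bar> \<le> C * enn2real (nonlocal_energy s p u) powr (1 / p)))"
  (is "\<exists>C>0. \<forall>u. _ \<longrightarrow> _ \<longrightarrow> _ \<longrightarrow> ?P C u")
proof -
  have al: "\<alpha> = s - N / p" "0 < \<alpha>" "\<alpha> \<le> 1"
  proof -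
    have "N \<ge> 0" by (simp add: N_def)
    then have "N / p \<ge> 0" using sp by simp
    then show "\<alpha> = s - N / p" "0 < \<alpha>" "\<alpha> \<le> 1" using sp by (auto simp: \<alpha>_def diff_divide_distrib pos_divide_less_eq)
  qed
  obtain C1 where C1: "C1 > 0" and M: "\<And>u x (y::'a). u \<in> borel_measurable borel \<Longrightarrow> nonlocal_energy s p u < \<infinity> \<Longrightarrow>
     point_energy s p u x < \<infinity> \<Longrightarrow> point_energy s p u y < \<infinity> \<Longrightarrow>
     \<bar>u x - u y\<bar> \<le> C1 * enn2real (nonlocal_energy s p u) powr (1 / p) * dist x y powr \<alpha>"
    using Morrey_pointwise[where 'a='a, of s p] sp unfolding al(1) N_def by blast
  have "bounded (closure \<Omega>)" using \<Omega> by (rule bounded_closure)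
  then obtain R where R: "R > 0" "\<And>x. x \<in> closure \<Omega> \<Longrightarrow> norm x \<le> R" using bounded_pos by blast
  define C where "C = C1 * (1 + (2 * R + 2) powr \<alpha>)"
  have C: "C > 0" using C1 by (simp add: C_def add_pos_nonneg)
  have CC1: "C1 \<le> C" using C1 by (simp add: C_def)
  show ?thesis
  proof (intro exI[of _ C] conjI allI impI C)
    fix u :: "'a \<Rightarrow> real"
    assume um: "u \<in> borel_measurable borel" and E: "nonlocal_energy s p u < \<infinity>"
      and u0: "AE x in lborel. x \<notin> \<Omega> \<longrightarrow> u x = 0"
    define E1 where "E1 = enn2real (nonlocal_energy s p u) powr (1 / p)"
    have E1: "E1 \<ge> 0" by (simp add: E1_def)
    define X where "X = {x. point_energy s p u x < \<infinity> \<and> (x \<notin> \<Omega> \<longrightarrow> u x = 0)}"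
    have "AE x in lborel. point_energy s p u x \<noteq> \<infinity>"
      using E nonlocal_energy_eq_point_energy[OF um, of s p] by (intro nn_integral_PInf_AE) auto
    then have aeX: "AE x in lborel. x \<in> X"
      using u0 by eventually_elim (auto simp: X_def less_top)
    obtain b :: 'a where b: "b \<in> Basis" by (meson nonempty_Basis ex_in_conv)
    \<comment> \<open>The unit ball about \<open>c\<close> contains only points of norm above R,
      hence none of \<Omega>; having positive measure, it meets X.\<close>
    define c where "c = (R + 1) *\<^sub>R b"
    have nc: "norm c = R + 1" using R b by (simp add: c_def)
    have "\<exists>x0. x0 \<in> ball c 1 \<inter> X"
    proof (rule ccontr)
      assume "\<not> ?thesis"
      then have "AE x in lborel. x \<notin> ball c 1" using aeX by (auto elim!: eventually_mono)
      then have "emeasure lborel (ball c 1) = 0" by (subst (asm) AE_iff_measurable[OF _ refl]) (auto simp: ball_def)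
      then show False
        using unit_ball_vol_pos[of "real DIM('a)"]
        by (auto simp: emeasure_ball ennreal_eq_0_iff simp del: unit_ball_vol_pos)
    qed
    then obtain x0 where x0: "x0 \<in> X" "dist c x0 < 1" by auto
    have nx0: "norm x0 > R" "norm x0 < R + 2"
      using x0(2) nc norm_triangle_ineq2[of c x0] norm_triangle_ineq2[of x0 c] by (auto simp: dist_norm norm_minus_commute)
    then have "x0 \<notin> \<Omega>" using R(2)[of x0] closure_subset[of \<Omega>] by auto
    then have ux0: "u x0 = 0" using x0 by (simp add: X_def)
    obtain w where w: "\<And>x. x \<in> X \<Longrightarrow> w x = u x" "\<And>x y. \<bar>w x - w y\<bar> \<le> C1 * E1 * dist x y powr \<alpha>"
    proof -
      have "\<exists>w. (\<forall>x\<in>X. w x = u x) \<and> (\<forall>x y. \<bar>w x - w y\<bar> \<le> C1 * E1 * dist x y powr \<alpha>)"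
        by (rule Holder_extension) (use x0 C1 E1 al M[OF um E] in \<open>auto simp: X_def E1_def\<close>)
      then show thesis using that by blast
    qed
    show "?P C u"
      unfolding E1_def[symmetric]
    proof (intro exI[of _ w] conjI allI ballI)
      show "AE x in lborel. w x = u x" using aeX by eventually_elim (rule w(1))
      show "\<bar>w x - w y\<bar> \<le> C * E1 * dist x y powr \<alpha>" for x y
      proof -
        have "C1 * E1 * dist x y powr \<alpha> \<le> C * E1 * dist x y powr \<alpha>"
          using CC1 E1 by (intro mult_right_mono) auto
        then show ?thesis using w(2)[of x y] by linarith
      qed
      fix x assume "x \<in> closure \<Omega>"
      then have "dist x x0 \<le> 2 * R + 2"
        using R(2)[of x] nx0 norm_triangle_ineq4[of x x0] by (simp add: dist_norm)
      then have "dist x x0 powr \<alpha> \<le> (2 * R + 2) powr \<alpha>"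
        using al by (intro powr_mono2) auto
      then have "dist x x0 powr \<alpha> \<le> 1 + (2 * R + 2) powr \<alpha>" by simp
      then have "C1 * E1 * dist x x0 powr \<alpha> \<le> C1 * E1 * (1 + (2 * R + 2) powr \<alpha>)"
        using C1 E1 by (intro mult_left_mono) auto
      also have "\<dots> = C * E1" by (simp add: C_def mult_ac)
      finally show "\<bar>w x\<bar> \<le> C * E1" using w(2)[of x x0] w(1)[OF x0(1)] ux0 by simp
    qed
  qed
qed

section \<open>Weak solutions\<close>

lemma finite_measure_lebesgue_on_open:
  fixes \<Omega> :: "'a::euclidean_space set"
  assumes "open \<Omega>" "bounded \<Omega>"
  shows "finite_measure (lebesgue_on \<Omega>)"
  using assms by (intro finite_measure_lebesgue_on lmeasurable_open)

lemma AE_lebesgue_on: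
  fixes A :: "'a::euclidean_space set"
  assumes "A \<in> sets borel" "AE x in lborel. P x"
  shows "AE x in lebesgue_on A. P x"
proof -
  have "AE x in lebesgue. P x" using assms by (simp add: AE_completion_iff)
  then show ?thesis using assms by (subst AE_restrict_space_iff) auto
qed

lemma borel_measurable_lebesgue_on:
  fixes u :: "'a::euclidean_space \<Rightarrow> real"
  assumes "u \<in> borel_measurable borel"
  shows "u \<in> borel_measurable (lebesgue_on A)"
  using assms by (simp add: measurable_completion measurable_restrict_space1)

lemma Lp_norm_minus [simp]: "Lp_norm M r (\<lambda>x. - f x) = Lp_norm M r f"
  by (simp add: Lp_norm_def)

lemma Lp_space_minus: "f \<in> Lp_space M r \<Longrightarrow> (\<lambda>x. - f x) \<in> Lp_space M r"
  by (auto simp: Lp_space_def)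

text \<open>Hoelder's inequality against the constant 1; q = 1 is separate because its conjugate
  exponent is infinite.\<close>

lemma (in finite_measure) L1_le_Lp_norm:
  assumes q: "q \<ge> 1"
  shows "\<exists>C>0. \<forall>g\<in>Lp_space M q. integrable M g \<and> (\<integral>x. \<bar>g x\<bar> \<partial>M) \<le> C * Lp_norm M q g"
proof (cases "q = 1")
  case True
  show ?thesis
  proof (intro exI[of _ 1] conjI ballI)
    fix g assume "g \<in> Lp_space M q"
    then have g: "g \<in> borel_measurable M" "integrable M (\<lambda>x. \<bar>g x\<bar>)" using True by (auto simp: Lp_space_def)
    then show "integrable M g" by (simp add: integrable_abs_iff)
    show "(\<integral>x. \<bar>g x\<bar> \<partial>M) \<le> 1 * Lp_norm M q g" using True by (simp add: Lp_norm_def)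
  qed simp
next
  case False
  then have q1: "q > 1" using q by simp
  have q': "q / (q - 1) > 1" "1 / q + 1 / (q / (q - 1)) = 1" using q1 by (auto simp: field_simps)
  define C where "C = measure M (space M) powr (1 / (q / (q - 1))) + 1"
  show ?thesis
  proof (intro exI[of _ C] conjI ballI)
    show "C > 0" by (simp add: C_def add_nonneg_pos)
    fix g assume "g \<in> Lp_space M q"
    then have g: "g \<in> borel_measurable M" "integrable M (\<lambda>x. \<bar>g x\<bar> powr q)" by (auto simp: Lp_space_def)
    have one: "(\<lambda>x. 1::real) \<in> borel_measurable M" "integrable M (\<lambda>x. \<bar>1::real\<bar> powr (q / (q - 1)))" by auto
    note H = integral_Holder_powr[OF q1 q' g(1) one(1) g(2) one(2)]
    show "integrable M g" using H(1) by simp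
    have "(\<integral>x. \<bar>g x\<bar> \<partial>M) \<le> Lp_norm M q g * measure M (space M) powr (1 / (q / (q - 1)))"
      using H(2) by (simp add: Lp_norm_def)
    also have "\<dots> \<le> Lp_norm M q g * C" by (intro mult_left_mono) (auto simp: C_def)
    finally show "(\<integral>x. \<bar>g x\<bar> \<partial>M) \<le> C * Lp_norm M q g" by (simp add: mult.commute)
  qed
qed

lemma weak_solution_measurable:
  assumes "weak_solution s p \<Omega> g u"
  shows "u \<in> borel_measurable (lebesgue_on A)"
  using assms by (auto simp: weak_solution_def Wsp0_def Wsp_def Lp_space_def intro: measurable_restrict_space1)

lemma weak_solution_borel_representative:
  fixes u :: "'a::euclidean_space \<Rightarrow> real"
  assumes "weak_solution s p \<Omega> g u"
  obtains u' where "weak_solution s p \<Omega> g u'" "u' \<in> borel_measurable borel" "AE x in lborel. u x = u' x"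
proof -
  have "u \<in> borel_measurable lebesgue"
    using assms by (auto simp: weak_solution_def Wsp0_def Wsp_def Lp_space_def)
  then show thesis using borel_representative weak_solution_AE_cong[OF assms] that by metis
qed

text \<open>
  The estimates are proved for the positive part of a Borel solution; the negative part is the positive
  part of \<open>-u\<close>, which solves the equation with \<open>-g\<close>.
\<close>

lemma Lp_estimate_of_positive_part:
  fixes \<Omega> :: "'a::euclidean_space set"
  assumes \<Omega>: "open \<Omega>" and r: "r > 0"
    and est: "\<exists>C>0. \<forall>g u. g \<in> Lp_space (lebesgue_on \<Omega>) q \<longrightarrow> weak_solution s p \<Omega> g u \<longrightarrow> u \<in> borel_measurable borel \<longrightarrow>
      integrable (lebesgue_on \<Omega>) (\<lambda>x. max (u x) 0 powr r) \<and>
      (\<integral>x. max (u x) 0 powr r \<partial>lebesgue_on \<Omega>) \<le> C * Lp_norm (lebesgue_on \<Omega>) q g powr (r / (p - 1))"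
  shows "\<exists>C>0. \<forall>g u. g \<in> Wsp0_dual s p \<Omega> \<inter> Lp_space (lebesgue_on \<Omega>) q \<longrightarrow> weak_solution s p \<Omega> g u \<longrightarrow>
      u \<in> Lp_space (lebesgue_on \<Omega>) r \<and>
      Lp_norm (lebesgue_on \<Omega>) r u \<le> C * Lp_norm (lebesgue_on \<Omega>) q g powr (1 / (p - 1))"
proof -
  let ?M = "lebesgue_on \<Omega>"
  obtain C where C: "C > 0" and est: "\<And>g u. g \<in> Lp_space ?M q \<Longrightarrow> weak_solution s p \<Omega> g u \<Longrightarrow> u \<in> borel_measurable borel \<Longrightarrow>
      integrable ?M (\<lambda>x. max (u x) 0 powr r) \<and>
      (\<integral>x. max (u x) 0 powr r \<partial>?M) \<le> C * Lp_norm ?M q g powr (r / (p - 1))"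
    using est by blast
  show ?thesis
  proof (intro exI[of _ "(2 * C) powr (1 / r)"] conjI allI impI)
    show "(2 * C) powr (1 / r) > 0" using C by simp
    fix g u assume g: "g \<in> Wsp0_dual s p \<Omega> \<inter> Lp_space ?M q" and ws: "weak_solution s p \<Omega> g u"
    obtain v where v: "weak_solution s p \<Omega> g v" "v \<in> borel_measurable borel" "AE x in lborel. u x = v x"
      using weak_solution_borel_representative[OF ws] .
    have e1: "integrable ?M (\<lambda>x. max (v x) 0 powr r)"
        "(\<integral>x. max (v x) 0 powr r \<partial>?M) \<le> C * Lp_norm ?M q g powr (r / (p - 1))"
      using est[OF _ v(1,2)] g by auto
    have "integrable ?M (\<lambda>x. max (- v x) 0 powr r) \<and>
        (\<integral>x. max (- v x) 0 powr r \<partial>?M) \<le> C * Lp_norm ?M q (\<lambda>x. - g x) powr (r / (p - 1))"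
      using est[OF Lp_space_minus weak_solution_minus[OF v(1)]] g v(2) by auto
    then have e2: "integrable ?M (\<lambda>x. max (- v x) 0 powr r)"
        "(\<integral>x. max (- v x) 0 powr r \<partial>?M) \<le> C * Lp_norm ?M q g powr (r / (p - 1))" by auto
    \<comment> \<open>At each point one of the two parts vanishes, so the r-th powers add exactly,
      also for r < 1 where the triangle inequality fails.\<close>
    have split: "\<bar>v x\<bar> powr r = max (v x) 0 powr r + max (- v x) 0 powr r" for x
      by (cases "v x \<ge> 0") (auto simp: max_def)
    have um: "u \<in> borel_measurable ?M" using ws by (rule weak_solution_measurable)
    have vm: "v \<in> borel_measurable ?M" using v(2) by (rule borel_measurable_lebesgue_on)
    have ae: "AE x in ?M. u x = v x" using \<Omega> v(3) by (intro AE_lebesgue_on) auto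
    have iv: "integrable ?M (\<lambda>x. \<bar>v x\<bar> powr r)" unfolding split using e1 e2 by simp
    have aer: "AE x in ?M. \<bar>v x\<bar> powr r = \<bar>u x\<bar> powr r" using ae by eventually_elim auto
    have iu: "integrable ?M (\<lambda>x. \<bar>u x\<bar> powr r)"
      by (rule integrable_cong_AE_imp[OF iv _ aer]) (use um in measurable)
    show "u \<in> Lp_space ?M r" using um iu by (simp add: Lp_space_def)
    have "(\<integral>x. \<bar>u x\<bar> powr r \<partial>?M) = (\<integral>x. \<bar>v x\<bar> powr r \<partial>?M)"
      by (rule integral_cong_AE[OF _ _ AE_symmetric[OF aer]]) (use um vm in measurable)
    also have "\<dots> = (\<integral>x. max (v x) 0 powr r \<partial>?M) + (\<integral>x. max (- v x) 0 powr r \<partial>?M)"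
      unfolding split using e1 e2 by simp
    also have "\<dots> \<le> 2 * C * Lp_norm ?M q g powr (r / (p - 1))" using e1 e2 by simp
    finally have "Lp_norm ?M r u \<le> (2 * C * Lp_norm ?M q g powr (r / (p - 1))) powr (1 / r)"
      unfolding Lp_norm_def[of ?M r u] using r by (intro powr_mono2) auto
    also have "\<dots> = (2 * C) powr (1 / r) * Lp_norm ?M q g powr (1 / (p - 1))"
      using r by (simp add: powr_mult powr_powr)
    finally show "Lp_norm ?M r u \<le> (2 * C) powr (1 / r) * Lp_norm ?M q g powr (1 / (p - 1))" .
  qed
qed

section \<open>The estimates for weak solutions\<close>

text \<open>The exponent t stays free in the Sobolev range: the critical one serves N > s p, a large
  one serves N = s p.\<close>

lemma Lp_bound_of_L1_data:
  fixes s p r :: real and \<Omega> :: "'a::euclidean_space set"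
  assumes sp: "0 < s" "1 < p" and \<Omega>: "open \<Omega>" "bounded \<Omega>"
    and t: "0 < t" "t * (real DIM('a) - s * p) \<le> real DIM('a) * p" and r: "0 < r" "r / t < (p - 1) / p"
  shows "\<exists>C>0. \<forall>g u. g \<in> Wsp0_dual s p \<Omega> \<inter> Lp_space (lebesgue_on \<Omega>) 1 \<longrightarrow> weak_solution s p \<Omega> g u \<longrightarrow>
      u \<in> Lp_space (lebesgue_on \<Omega>) r \<and>
      Lp_norm (lebesgue_on \<Omega>) r u \<le> C * Lp_norm (lebesgue_on \<Omega>) 1 g powr (1 / (p - 1))"
proof (rule Lp_estimate_of_positive_part[OF \<Omega>(1) r(1)], goal_cases)
  interpret finite_measure "lebesgue_on \<Omega>" using \<Omega> by (rule finite_measure_lebesgue_on_open)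
  let ?M = "lebesgue_on \<Omega>"
  obtain \<Lambda> where L: "\<Lambda> > 0" and eb: "\<And>g u. weak_solution s p \<Omega> g u \<Longrightarrow> u \<in> borel_measurable borel \<Longrightarrow>
     energy_bound ?M p t \<Lambda> g u"
    using Sobolev_energy_bound[OF sp t \<Omega>] by blast
  obtain C where C: "C > 0" and est: "\<And>g u. integrable ?M g \<Longrightarrow> u \<in> borel_measurable ?M \<Longrightarrow> energy_bound ?M p t \<Lambda> g u \<Longrightarrow>
     integrable ?M (\<lambda>x. max (u x) 0 powr r) \<and>
     (\<integral>x. max (u x) 0 powr r \<partial>?M) \<le> C * (\<integral>x. \<bar>g x\<bar> \<partial>?M) powr (r / (p - 1))"
    using L1_estimate[OF sp(2) r(1) t(1) r(2) L] by blast
  case 1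
  show ?case
  proof (intro exI[of _ C] conjI[OF C] allI impI)
    fix g u assume g: "g \<in> Lp_space ?M 1" and ws: "weak_solution s p \<Omega> g u" and um: "u \<in> borel_measurable borel"
    have "integrable ?M (\<lambda>x. \<bar>g x\<bar>)" "g \<in> borel_measurable ?M" using g by (auto simp: Lp_space_def)
    then have "integrable ?M g" by (simp add: integrable_abs_iff)
    moreover have "Lp_norm ?M 1 g = (\<integral>x. \<bar>g x\<bar> \<partial>?M)" by (simp add: Lp_norm_def)
    ultimately show "integrable ?M (\<lambda>x. max (u x) 0 powr r) \<and>
      (\<integral>x. max (u x) 0 powr r \<partial>?M) \<le> C * Lp_norm ?M 1 g powr (r / (p - 1))"
      using est[OF _ borel_measurable_lebesgue_on[OF um] eb[OF ws um]] by simp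
  qed
qed

text \<open>With the critical t and q' = q / (q - 1), the relation \<gamma> t = e q', e = (\<gamma>
  - 1) p + 1, is linear in \<gamma>; its solution gives \<gamma> t = N (p - 1) q / (N - s p q). The
  condition s p q < N is equivalent to t < p q'.\<close>

lemma Lp_bound_of_Lq_data:
  fixes s p q N :: real and \<Omega> :: "'a::euclidean_space set"
  defines "N \<equiv> real DIM('a)"
  assumes sp: "0 < s" "1 < p" and \<Omega>: "open \<Omega>" "bounded \<Omega>" and q: "1 < q" "s * p * q < N"
  shows "\<exists>C>0. \<forall>g u. g \<in> Wsp0_dual s p \<Omega> \<inter> Lp_space (lebesgue_on \<Omega>) q \<longrightarrow> weak_solution s p \<Omega> g u \<longrightarrow>
      u \<in> Lp_space (lebesgue_on \<Omega>) (N * (p - 1) * q / (N - s * p * q)) \<and>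
      Lp_norm (lebesgue_on \<Omega>) (N * (p - 1) * q / (N - s * p * q)) u \<le> C * Lp_norm (lebesgue_on \<Omega>) q g powr (1 / (p - 1))"
proof -
  let ?M = "lebesgue_on \<Omega>"
  interpret finite_measure ?M using \<Omega> by (rule finite_measure_lebesgue_on_open)
  have N: "N > 0" by (simp add: N_def)
  have "0 < s * p" using sp by simp
  then have "s * p * 1 < s * p * q" using q(1) by (intro mult_strict_left_mono) auto
  then have Nsp: "N - s * p > 0" using q(2) by simp
  define D where "D = N - s * p * q"
  have D: "D > 0" using q by (simp add: D_def)
  define t where "t = N * p / (N - s * p)"
  have t: "t > 0" "t * (N - s * p) \<le> N * p" using N Nsp sp by (auto simp: t_def)
  define R where "R = N * (p - 1) * q / D"
  have R: "R > 0" using N sp q D by (simp add: R_def)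
  define \<gamma> where "\<gamma> = R / t"
  define e where "e = (\<gamma> - 1) * p + 1"
  have gt: "\<gamma> * t = R" using t by (simp add: \<gamma>_def)
  have gp: "\<gamma> * p = (p - 1) * q * (N - s * p) / D" using N Nsp sp D by (simp add: \<gamma>_def R_def t_def)
  have "q * (N - s * p) - D = N * (q - 1)" by (simp add: D_def algebra_simps)
  then have "(p - 1) * q * (N - s * p) - (p - 1) * D = (p - 1) * (N * (q - 1))"
    by (metis mult.assoc right_diff_distrib)
  moreover have "e * D = (p - 1) * q * (N - s * p) - (p - 1) * D"
  proof -
    have "e = \<gamma> * p - (p - 1)" by (simp add: e_def algebra_simps)
    then have "e * D = \<gamma> * p * D - (p - 1) * D" by (simp only: left_diff_distrib)
    moreover have "\<gamma> * p * D = (p - 1) * q * (N - s * p)" unfolding gp using D by simp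
    ultimately show ?thesis by simp
  qed
  ultimately have "e * D = (p - 1) * (N * (q - 1))" by simp
  then have e: "e = (p - 1) * (N * (q - 1)) / D" using D by (simp add: field_simps)
  have e0: "e > 0" unfolding e using sp N q D by simp
  have ge: "\<gamma> * t = e * (q / (q - 1))" unfolding gt e R_def using q D by (simp add: field_simps)
  have g0: "\<gamma> > 0" using R t by (simp add: \<gamma>_def)
  have "N * (q - 1) < q * (N - s * p)" using q(2) by (simp add: algebra_simps)
  then have tq: "t < p * (q / (q - 1))" using q sp Nsp by (simp add: t_def field_simps)
  obtain \<Lambda> where L: "\<Lambda> > 0" and eb: "\<And>g u. weak_solution s p \<Omega> g u \<Longrightarrow> u \<in> borel_measurable borel \<Longrightarrow>
     energy_bound ?M p t \<Lambda> g u"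
    using Sobolev_energy_bound[OF sp t(1) t(2)[unfolded N_def] \<Omega>] by blast
  obtain C where C: "C > 0" and est: "\<And>g u. g \<in> borel_measurable ?M \<Longrightarrow> integrable ?M (\<lambda>x. \<bar>g x\<bar> powr q) \<Longrightarrow> u \<in> borel_measurable ?M \<Longrightarrow> energy_bound ?M p t \<Lambda> g u \<Longrightarrow>
     integrable ?M (\<lambda>x. max (u x) 0 powr R) \<and>
     (\<integral>x. max (u x) 0 powr R \<partial>?M) \<le> C * Lp_norm ?M q g powr (R / (p - 1))"
    using Lq_power_estimate[OF sp(2) q(1) t(1) tq L g0 e_def e0 ge] unfolding gt by blast
  show ?thesis
    unfolding D_def[symmetric] R_def[symmetric]
  proof (rule Lp_estimate_of_positive_part[OF \<Omega>(1) R], goal_cases)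
    case 1
    show ?case
    proof (intro exI[of _ C] conjI[OF C] allI impI)
      fix g u assume "g \<in> Lp_space ?M q" "weak_solution s p \<Omega> g u" "u \<in> borel_measurable borel"
      then show "integrable ?M (\<lambda>x. max (u x) 0 powr R) \<and>
          (\<integral>x. max (u x) 0 powr R \<partial>?M) \<le> C * Lp_norm ?M q g powr (R / (p - 1))"
        by (intro est[OF _ _ borel_measurable_lebesgue_on eb]) (auto simp: Lp_space_def)
    qed
  qed
qed

lemma Linf_bound_of_Lq_data:
  fixes s p q t :: real and \<Omega> :: "'a::euclidean_space set"
  assumes sp: "0 < s" "1 < p" and \<Omega>: "open \<Omega>" "bounded \<Omega>" and q: "1 < q"
    and t: "p * (q / (q - 1)) < t" "t * (real DIM('a) - s * p) \<le> real DIM('a) * p"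
  shows "\<exists>C>0. \<forall>g u. g \<in> Wsp0_dual s p \<Omega> \<inter> Lp_space (lebesgue_on \<Omega>) q \<longrightarrow> weak_solution s p \<Omega> g u \<longrightarrow>
      Linf_norm (lebesgue_on \<Omega>) u \<le> ereal (C * Lp_norm (lebesgue_on \<Omega>) q g powr (1 / (p - 1)))"
proof -
  let ?M = "lebesgue_on \<Omega>"
  interpret finite_measure ?M using \<Omega> by (rule finite_measure_lebesgue_on_open)
  have "0 < p * (q / (q - 1))" using sp q by simp
  then have t0: "t > 0" using t by simp
  obtain \<Lambda> where L: "\<Lambda> > 0" and eb: "\<And>g u. weak_solution s p \<Omega> g u \<Longrightarrow> u \<in> borel_measurable borel \<Longrightarrow>
     energy_bound ?M p t \<Lambda> g u"
    using Sobolev_energy_bound[OF sp t0 t(2) \<Omega>] by blast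
  obtain C where C: "C > 0" and est: "\<And>g u. g \<in> borel_measurable ?M \<Longrightarrow> integrable ?M (\<lambda>x. \<bar>g x\<bar> powr q) \<Longrightarrow> u \<in> borel_measurable ?M \<Longrightarrow> energy_bound ?M p t \<Lambda> g u \<Longrightarrow>
     (AE x in ?M. u x \<le> C * Lp_norm ?M q g powr (1 / (p - 1)))"
    using Linf_estimate[OF sp(2) q t(1) L] by blast
  show ?thesis
  proof (intro exI[of _ C] conjI[OF C] allI impI)
    fix g u assume g: "g \<in> Wsp0_dual s p \<Omega> \<inter> Lp_space ?M q" and ws: "weak_solution s p \<Omega> g u"
    obtain v where v: "weak_solution s p \<Omega> g v" "v \<in> borel_measurable borel" "AE x in lborel. u x = v x"
      using weak_solution_borel_representative[OF ws] .
    define K where "K = C * Lp_norm ?M q g powr (1 / (p - 1))"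
    have gD: "g \<in> borel_measurable ?M" "integrable ?M (\<lambda>x. \<bar>g x\<bar> powr q)" using g by (auto simp: Lp_space_def)
    have 1: "AE x in ?M. v x \<le> K"
      unfolding K_def by (rule est[OF gD borel_measurable_lebesgue_on[OF v(2)] eb[OF v(1,2)]])
    have "AE x in ?M. - v x \<le> C * Lp_norm ?M q (\<lambda>x. - g x) powr (1 / (p - 1))"
    proof (rule est)
      show "energy_bound ?M p t \<Lambda> (\<lambda>x. - g x) (\<lambda>x. - v x)"
        using v(2) by (intro eb weak_solution_minus[OF v(1)]) auto
      show "(\<lambda>x. - v x) \<in> borel_measurable ?M" using v(2) by (intro borel_measurable_lebesgue_on) auto
    qed (use gD in auto)
    then have 2: "AE x in ?M. - v x \<le> K" by (simp add: K_def)
    have um: "u \<in> borel_measurable ?M" using ws by (rule weak_solution_measurable)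
    have 3: "AE x in ?M. u x = v x" using \<Omega> v(3) by (intro AE_lebesgue_on) auto
    have "AE x in ?M. ereal \<bar>u x\<bar> \<le> ereal K" using 1 2 3 by eventually_elim auto
    then show "Linf_norm ?M u \<le> ereal (C * Lp_norm ?M q g powr (1 / (p - 1)))"
      unfolding Linf_norm_def K_def[symmetric] using um by (intro esssup_I) auto
  qed
qed

text \<open>The case distinction makes a proof that S is positive unnecessary. For a vanishing norm
  of g every \<Lambda> > 0 satisfies the smallness condition, so the crude Sobolev constant
  suffices; otherwise the bound on \<alpha> itself excludes S = 0.\<close>

lemma exp_estimate_weak_solution:
  fixes s p q N \<alpha> :: real and \<Omega> :: "'a::euclidean_space set"
  defines "N \<equiv> real DIM('a)"
  assumes sp: "0 < s" "1 < p" and \<Omega>: "open \<Omega>" "bounded \<Omega>" and q: "q = N / (s * p)" "1 < q"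
    and g: "g \<in> Lp_space (lebesgue_on \<Omega>) q" and ws: "weak_solution s p \<Omega> g u" and um: "u \<in> borel_measurable borel"
    and \<alpha>: "0 < \<alpha>" "Lp_norm (lebesgue_on \<Omega>) q g \<noteq> 0 \<Longrightarrow>
          \<alpha> < N / (N - s * p) * (p powr p * sobolev_const TYPE('a) s p / Lp_norm (lebesgue_on \<Omega>) q g) powr (1 / (p - 1))"
  shows "integrable (lebesgue_on \<Omega>) (\<lambda>x. exp (\<alpha> * max (u x) 0))"
proof -
  let ?M = "lebesgue_on \<Omega>"
  define S where "S = sobolev_const TYPE('a) s p"
  interpret finite_measure ?M using \<Omega> by (rule finite_measure_lebesgue_on_open)
  have N: "N > 0" by (simp add: N_def)
  have sp0: "s * p > 0" using sp by simp
  have Nsp: "s * p < N" using q sp0 by (simp add: pos_less_divide_eq)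
  have q': "q / (q - 1) = N / (N - s * p)" using q sp sp0 Nsp by (simp add: field_simps)
  define t where "t = p * (q / (q - 1))"
  have ts: "t = sobolev_exponent TYPE('a) s p" by (simp add: t_def q' sobolev_exponent_def N_def mult.commute)
  have t: "t > 0" "t * (N - s * p) \<le> N * p" using Nsp N sp by (auto simp: t_def q')
  have gD: "g \<in> borel_measurable ?M" "integrable ?M (\<lambda>x. \<bar>g x\<bar> powr q)" using g by (auto simp: Lp_space_def)
  have um': "u \<in> borel_measurable ?M" using um by (rule borel_measurable_lebesgue_on)
  define \<beta> where "\<beta> = \<alpha> / (q / (q - 1))"
  have q'0: "q / (q - 1) > 0" using q(2) by simp
  have be: "\<beta> > 0" "\<beta> * (q / (q - 1)) = \<alpha>" using \<alpha> q'0 q(2) by (auto simp: \<beta>_def)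
  consider "Lp_norm ?M q g = 0" | "Lp_norm ?M q g > 0" "S < 0" | "Lp_norm ?M q g > 0" "S \<ge> 0"
    using Lp_norm_nonneg[of ?M q g] by linarith
  then show ?thesis
  proof cases
    case 1
    obtain \<Lambda> where L: "\<Lambda> > 0" and eb: "energy_bound ?M p t \<Lambda> g u"
      using Sobolev_energy_bound[OF sp t(1) t(2)[unfolded N_def] \<Omega>] ws um by blast
    have "integrable ?M (\<lambda>x. exp (\<beta> * (q / (q - 1)) * max (u x) 0))"
      by (rule exp_estimate[OF sp(2) q(2) t_def L be(1) _ gD um' eb]) (use 1 sp L in simp)
    then show ?thesis by (simp only: be(2))
  next
    case 2
    define G where "G = (\<lambda>x::real. min (max x 0) 1)"
    have tp: "test_pair p G G" using sp by (intro test_pair_contraction) (auto simp: G_def)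
    have "(\<lambda>x. G (u x)) \<in> Dsp s p"
    proof (rule test_pair_in_Dsp(1)[OF sp(2) Nsp[unfolded N_def] \<Omega> ws um tp])
      show "\<exists>k. \<forall>x. \<bar>G x\<bar> \<le> k" by (rule exI[of _ 1]) (auto simp: G_def)
    qed
    \<comment> \<open>All quotients in the infimum are nonnegative, so S < 0 can only be the
      unspecified infimum of the empty set. Thus G(u) cannot be a candidate and vanishes almost
      everywhere, which means u \<le> 0.\<close>
    have "AE x in lebesgue. G (u x) = 0"
    proof (rule ccontr)
      assume "\<not> ?thesis"
      then have "0 \<le> S" unfolding S_def sobolev_const_def using \<open>(\<lambda>x. G (u x)) \<in> Dsp s p\<close>
        by (intro cINF_greatest) auto
      then show False using 2 by simp
    qed
    then have "AE x in lborel. G (u x) = 0" by (simp add: AE_completion_iff)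
    then have "AE x in ?M. G (u x) = 0" using \<Omega> by (intro AE_lebesgue_on) auto
    then have "AE x in ?M. 1 = exp (\<alpha> * max (u x) 0)"
      by eventually_elim (auto simp: G_def min_def max_def split: if_splits)
    then show ?thesis
      by (rule integrable_cong_AE_imp[rotated 2]) (use um' in measurable)
  next
    case 3
    define n where "n = Lp_norm ?M q g"
    have n: "n > 0" using 3 by (simp add: n_def)
    have "\<alpha> < q / (q - 1) * (p powr p * S / n) powr (1 / (p - 1))"
      using \<alpha>(2) 3 by (simp add: q' S_def n_def)
    then have lt: "\<beta> < (p powr p * S / n) powr (1 / (p - 1))"
      using q'0 be(2) by (metis mult.commute mult_less_cancel_left_pos)
    \<comment> \<open>For S = 0 the upper bound on \<beta> would be 0, against \<beta> > 0.\<close>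
    then have "S \<noteq> 0" using be by auto
    then have S: "S > 0" using 3 by simp
    have "\<beta> powr (p - 1) < ((p powr p * S / n) powr (1 / (p - 1))) powr (p - 1)"
      using lt be sp by (intro powr_less_mono2) auto
    also have "\<dots> = p powr p * S / n" using sp S n by (simp add: powr_powr)
    finally have small: "\<beta> powr (p - 1) * n < p powr p * S" using n by (simp add: pos_less_divide_eq)
    have eb: "energy_bound ?M p t S g u"
      unfolding ts S_def by (rule sobolev_const_energy_bound[OF sp(2) Nsp[unfolded N_def] \<Omega> ws um])
    have "integrable ?M (\<lambda>x. exp (\<beta> * (q / (q - 1)) * max (u x) 0))"
      by (rule exp_estimate[OF sp(2) q(2) t_def S be(1) _ gD um' eb]) (use small in \<open>simp add: n_def\<close>)
    then show ?thesis by (simp only: be(2))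
  qed
qed

lemma exp_integrable_of_critical_data:
  fixes s p q N \<alpha> :: real and \<Omega> :: "'a::euclidean_space set"
  defines "N \<equiv> real DIM('a)"
  assumes sp: "0 < s" "1 < p" and \<Omega>: "open \<Omega>" "bounded \<Omega>" and q: "q = N / (s * p)" "1 < q"
    and g: "g \<in> Lp_space (lebesgue_on \<Omega>) q" and ws: "weak_solution s p \<Omega> g u"
    and \<alpha>: "Lp_norm (lebesgue_on \<Omega>) q g \<noteq> 0 \<longrightarrow>
          \<alpha> < N / (N - s * p) * (p powr p * sobolev_const TYPE('a) s p / Lp_norm (lebesgue_on \<Omega>) q g) powr (1 / (p - 1))"
  shows "integrable (lebesgue_on \<Omega>) (\<lambda>x. exp (\<alpha> * \<bar>u x\<bar>))"
proof -
  let ?M = "lebesgue_on \<Omega>"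
  interpret finite_measure ?M using \<Omega> by (rule finite_measure_lebesgue_on_open)
  have um[measurable]: "u \<in> borel_measurable ?M" using ws by (rule weak_solution_measurable)
  show ?thesis
  proof (cases "\<alpha> \<le> 0")
    case True
    then show ?thesis by (intro integrable_bounded[where B = 1]) (auto simp: mult_nonpos_nonneg)
  next
    case False
    then have a: "\<alpha> > 0" by simp
    obtain v where v: "weak_solution s p \<Omega> g v" "v \<in> borel_measurable borel" "AE x in lborel. u x = v x"
      using weak_solution_borel_representative[OF ws] .
    have vm[measurable]: "v \<in> borel_measurable ?M" using v(2) by (rule borel_measurable_lebesgue_on)
    have 1: "integrable ?M (\<lambda>x. exp (\<alpha> * max (v x) 0))"
      using exp_estimate_weak_solution[OF sp \<Omega> q[unfolded N_def] g v(1,2) a] \<alpha> unfolding N_def by blast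
    have 2: "integrable ?M (\<lambda>x. exp (\<alpha> * max (- v x) 0))"
    proof (rule exp_estimate_weak_solution[OF sp \<Omega> q[unfolded N_def] Lp_space_minus[OF g] weak_solution_minus[OF v(1)] _ a])
    qed (use v(2) \<alpha> in \<open>auto simp: N_def\<close>)
    have ae: "AE x in ?M. u x = v x" using \<Omega> v(3) by (intro AE_lebesgue_on) auto
    show ?thesis
    proof (rule Bochner_Integration.integrable_bound)
      show "integrable ?M (\<lambda>x. exp (\<alpha> * max (v x) 0) + exp (\<alpha> * max (- v x) 0))" using 1 2 by simp
      show "(\<lambda>x. exp (\<alpha> * \<bar>u x\<bar>)) \<in> borel_measurable ?M" by measurable
      have "exp (\<alpha> * \<bar>y\<bar>) \<le> exp (\<alpha> * max y 0) + exp (\<alpha> * max (- y) 0)" for y :: real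
        by (cases "y \<ge> 0") (auto simp: max_def)
      note le = this
      show "AE x in ?M. norm (exp (\<alpha> * \<bar>u x\<bar>)) \<le> norm (exp (\<alpha> * max (v x) 0) + exp (\<alpha> * max (- v x) 0))"
        using ae by eventually_elim (use le in \<open>simp add: abs_of_nonneg add_nonneg_nonneg\<close>)
    qed
  qed
qed

text \<open>Energy and height bound each other. For the positive part v with energy e, Morrey gives
  |v| \<le> C1 e^(1/p) almost everywhere on \<Omega>, and the equation gives e \<le> ||g||_1 C1
  e^(1/p). Cancelling e^(1/p) bounds e. Only the L1 norm of g enters, hence every q \<ge> 1 is
  allowed.\<close>

lemma Holder_estimate_of_positive_part:
  fixes s p q N :: real and \<Omega> :: "'a::euclidean_space set"
  defines "N \<equiv> real DIM('a)"
  assumes sp: "0 < s" "s < 1" "1 < p" "N < s * p" and \<Omega>: "open \<Omega>" "bounded \<Omega>" and q: "1 \<le> q"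
  shows "\<exists>C>0. \<forall>g u. g \<in> Lp_space (lebesgue_on \<Omega>) q \<longrightarrow> weak_solution s p \<Omega> g u \<longrightarrow> u \<in> borel_measurable borel \<longrightarrow>
     (\<exists>w. (AE x in lborel. w x = max (u x) 0) \<and>
        (\<forall>x y. \<bar>w x - w y\<bar> \<le> C * Lp_norm (lebesgue_on \<Omega>) q g powr (1 / (p - 1)) * dist x y powr ((s * p - N) / p)) \<and>
        (\<forall>x\<in>closure \<Omega>. \<bar>w x\<bar> \<le> C * Lp_norm (lebesgue_on \<Omega>) q g powr (1 / (p - 1))))"
  (is "\<exists>C>0. \<forall>g u. _ \<longrightarrow> _ \<longrightarrow> _ \<longrightarrow> ?P C g u")
proof -
  let ?M = "lebesgue_on \<Omega>"
  interpret finite_measure ?M using \<Omega> by (rule finite_measure_lebesgue_on_open)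
  have p0: "0 < p" using sp by simp
  obtain C1 where C1: "C1 > 0" and morrey: "\<And>u::'a \<Rightarrow> real. u \<in> borel_measurable borel \<Longrightarrow> nonlocal_energy s p u < \<infinity> \<Longrightarrow>
     (AE x in lborel. x \<notin> \<Omega> \<longrightarrow> u x = 0) \<Longrightarrow>
     (\<exists>w. (AE x in lborel. w x = u x) \<and>
        (\<forall>x y. \<bar>w x - w y\<bar> \<le> C1 * enn2real (nonlocal_energy s p u) powr (1 / p) * dist x y powr ((s * p - N) / p)) \<and>
        (\<forall>x\<in>closure \<Omega>. \<bar>w x\<bar> \<le> C1 * enn2real (nonlocal_energy s p u) powr (1 / p)))"
    using Morrey_embedding[OF sp(1,2) p0 sp(4)[unfolded N_def] \<Omega>(2)] unfolding N_def by blast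
  obtain C2 where C2: "C2 > 0" and L1: "\<And>g. g \<in> Lp_space ?M q \<Longrightarrow> integrable ?M g \<and> (\<integral>x. \<bar>g x\<bar> \<partial>?M) \<le> C2 * Lp_norm ?M q g"
    using L1_le_Lp_norm[OF q] by blast
  define C where "C = C1 * (C1 * C2) powr (1 / (p - 1))"
  have C: "C > 0" using C1 C2 by (simp add: C_def)
  show ?thesis
  proof (intro exI[of _ C] conjI[OF C] allI impI)
    fix g u assume g: "g \<in> Lp_space ?M q" and ws: "weak_solution s p \<Omega> g u" and um[measurable]: "u \<in> borel_measurable borel"
    define v where "v = (\<lambda>x. max (u x) 0)"
    have tp: "test_pair p (\<lambda>x. max x 0) (\<lambda>x. max x 0)" using sp by (intro test_pair_contraction) auto
    have vm[measurable]: "v \<in> borel_measurable borel" unfolding v_def by measurable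
    have vW: "v \<in> Wsp0 s p \<Omega>" unfolding v_def by (rule test_pair_energy_le(3)[OF sp(3) ws um tp])
    note vD = Wsp0_borelD[OF vW vm]
    define e where "e = enn2real (nonlocal_energy s p v)"
    have e0: "e \<ge> 0" by (simp add: e_def)
    obtain w where w: "AE x in lborel. w x = v x"
       "\<And>x y. \<bar>w x - w y\<bar> \<le> C1 * e powr (1 / p) * dist x y powr ((s * p - N) / p)"
       "\<And>x. x \<in> closure \<Omega> \<Longrightarrow> \<bar>w x\<bar> \<le> C1 * e powr (1 / p)"
      using morrey[OF vm vD(1,2)] unfolding e_def by blast
    have gi: "integrable ?M g" using L1[OF g] by simp
    have aev: "AE x in ?M. \<bar>v x\<bar> \<le> C1 * e powr (1 / p)"
    proof -
      have 1: "AE x in ?M. w x = v x" using \<Omega> w(1) by (intro AE_lebesgue_on) auto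
      have 2: "AE x in ?M. x \<in> \<Omega>" by (rule AE_I2) (simp add: space_restrict_space)
      from 1 2 show ?thesis
      proof eventually_elim
        case (elim x)
        then show ?case using w(3)[of x] closure_subset[of \<Omega>] by auto
      qed
    qed
    have le: "AE x in ?M. \<bar>g x * v x\<bar> \<le> \<bar>g x\<bar> * (C1 * e powr (1 / p))"
      using aev by eventually_elim (auto simp: abs_mult intro!: mult_left_mono)
    have ib: "integrable ?M (\<lambda>x. \<bar>g x\<bar> * (C1 * e powr (1 / p)))" using gi by simp
    have vM[measurable]: "v \<in> borel_measurable ?M" using vm by (rule borel_measurable_lebesgue_on)
    have gM[measurable]: "g \<in> borel_measurable ?M" using gi by auto
    have igv: "integrable ?M (\<lambda>x. g x * v x)"
    proof (rule Bochner_Integration.integrable_bound[OF ib])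
      show "AE x in ?M. norm (g x * v x) \<le> norm (\<bar>g x\<bar> * (C1 * e powr (1 / p)))"
        using le by eventually_elim auto
    qed measurable
    have "e \<le> (\<integral>x. g x * v x \<partial>?M)"
      unfolding e_def v_def using test_pair_energy_le(1,2)[OF sp(3) ws um tp] by (intro enn2real_leI) auto
    also have "\<dots> \<le> (\<integral>x. \<bar>g x\<bar> * (C1 * e powr (1 / p)) \<partial>?M)"
      by (rule integral_mono_AE[OF igv ib]) (use le in \<open>eventually_elim, linarith\<close>)
    also have "\<dots> = (\<integral>x. \<bar>g x\<bar> \<partial>?M) * (C1 * e powr (1 / p))" using gi by simp
    also have "\<dots> \<le> C2 * Lp_norm ?M q g * (C1 * e powr (1 / p))"
      using L1[OF g] C1 by (intro mult_right_mono) auto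
    finally have ele: "e \<le> C1 * C2 * Lp_norm ?M q g * e powr (1 / p)" by (simp add: mult_ac)
    have e1: "e powr (1 / p) \<le> (C1 * C2) powr (1 / (p - 1)) * Lp_norm ?M q g powr (1 / (p - 1))"
    proof (cases "e = 0")
      case False
      then have "e > 0" using e0 by simp
      have "1 - 1 / p = (p - 1) / p" using p0 by (simp add: diff_divide_distrib)
      have "e powr (1 - 1 / p) \<le> C1 * C2 * Lp_norm ?M q g"
        using ele \<open>e > 0\<close> by (simp add: powr_diff pos_divide_le_eq)
      then have "(e powr (1 - 1 / p)) powr (1 / (p - 1)) \<le> (C1 * C2 * Lp_norm ?M q g) powr (1 / (p - 1))"
        using sp by (intro powr_mono2) auto
      also have "\<dots> = (C1 * C2) powr (1 / (p - 1)) * Lp_norm ?M q g powr (1 / (p - 1))" by (rule powr_mult)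
      also have "(e powr (1 - 1 / p)) powr (1 / (p - 1)) = e powr (1 / p)"
        unfolding powr_powr \<open>1 - 1 / p = (p - 1) / p\<close> using sp by simp
      finally show ?thesis .
    qed simp
    then have H: "C1 * e powr (1 / p) \<le> C * Lp_norm ?M q g powr (1 / (p - 1))"
      using C1 by (simp add: C_def mult.assoc)
    show "?P C g u"
    proof (intro exI[of _ w] conjI allI ballI)
      show "AE x in lborel. w x = max (u x) 0" using w(1) by (simp add: v_def)
      show "\<bar>w x - w y\<bar> \<le> C * Lp_norm (lebesgue_on \<Omega>) q g powr (1 / (p - 1)) * dist x y powr ((s * p - N) / p)" for x y
        using w(2)[of x y] H by (rule order_trans[OF _ mult_right_mono]) simp
      show "\<bar>w x\<bar> \<le> C * Lp_norm (lebesgue_on \<Omega>) q g powr (1 / (p - 1))" if "x \<in> closure \<Omega>" for x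
        using w(3)[OF that] H by linarith
    qed
  qed
qed

lemma holder_norm_le:
  fixes f :: "'a::metric_space \<Rightarrow> real"
  assumes H: "H \<ge> 0" and f: "\<And>x y. \<bar>f x - f y\<bar> \<le> H * dist x y powr \<alpha>" "\<And>x. x \<in> A \<Longrightarrow> \<bar>f x\<bar> \<le> H"
  shows "holder_norm A \<alpha> f \<le> ennreal (2 * H)"
proof -
  have "(SUP x\<in>A. ennreal \<bar>f x\<bar>) \<le> ennreal H"
    using f(2) by (intro SUP_least ennreal_leI)
  moreover have "(SUP x\<in>A. SUP y\<in>A - {x}. ennreal (\<bar>f x - f y\<bar> / dist x y powr \<alpha>)) \<le> ennreal H"
  proof (intro SUP_least ennreal_leI)
    fix x y assume "x \<in> A" "y \<in> A - {x}"
    then have "x \<noteq> y" by auto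
    then have "dist x y powr \<alpha> > 0" by simp
    then show "\<bar>f x - f y\<bar> / dist x y powr \<alpha> \<le> H" using f(1)[of x y] by (simp add: pos_divide_le_eq)
  qed
  ultimately have "holder_norm A \<alpha> f \<le> ennreal H + ennreal H"
    unfolding holder_norm_def by (rule add_mono)
  also have "\<dots> = ennreal (2 * H)" using H by (simp add: ennreal_plus[symmetric] del: ennreal_plus)
  finally show ?thesis .
qed

lemma Holder_bound_of_Lq_data:
  fixes s p q N :: real and \<Omega> :: "'a::euclidean_space set"
  defines "N \<equiv> real DIM('a)"
  assumes sp: "0 < s" "s < 1" "1 < p" "N < s * p" and \<Omega>: "open \<Omega>" "bounded \<Omega>" and q: "1 \<le> q"
  shows "\<exists>C>0. \<forall>g u. g \<in> Wsp0_dual s p \<Omega> \<inter> Lp_space (lebesgue_on \<Omega>) q \<longrightarrow> weak_solution s p \<Omega> g u \<longrightarrow>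
      (\<exists>w. (AE x in lebesgue_on (closure \<Omega>). w x = u x) \<and>
          holder_norm (closure \<Omega>) ((s * p - N) / p) w
            \<le> ennreal (C * Lp_norm (lebesgue_on \<Omega>) q g powr (1 / (p - 1))))"
proof -
  let ?M = "lebesgue_on \<Omega>"
  obtain C where C: "C > 0" and est: "\<And>g u. g \<in> Lp_space ?M q \<Longrightarrow> weak_solution s p \<Omega> g u \<Longrightarrow> u \<in> borel_measurable borel \<Longrightarrow>
     (\<exists>w. (AE x in lborel. w x = max (u x) 0) \<and>
        (\<forall>x y. \<bar>w x - w y\<bar> \<le> C * Lp_norm ?M q g powr (1 / (p - 1)) * dist x y powr ((s * p - N) / p)) \<and>
        (\<forall>x\<in>closure \<Omega>. \<bar>w x\<bar> \<le> C * Lp_norm ?M q g powr (1 / (p - 1))))"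
    using Holder_estimate_of_positive_part[OF sp[unfolded N_def] \<Omega> q] unfolding N_def by blast
  show ?thesis
  \<comment> \<open>The two parts of u contribute H each, and the sum of supremum and seminorm in
    \<open>holder_norm\<close> doubles the result.\<close>
  proof (intro exI[of _ "4 * C"] conjI allI impI)
    show "4 * C > 0" using C by simp
    fix g u assume g: "g \<in> Wsp0_dual s p \<Omega> \<inter> Lp_space ?M q" and ws: "weak_solution s p \<Omega> g u"
    obtain v where v: "weak_solution s p \<Omega> g v" "v \<in> borel_measurable borel" "AE x in lborel. u x = v x"
      using weak_solution_borel_representative[OF ws] .
    define H where "H = C * Lp_norm ?M q g powr (1 / (p - 1))"
    have H: "H \<ge> 0" using C by (simp add: H_def)
    obtain w1 where w1: "AE x in lborel. w1 x = max (v x) 0"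
       "\<And>x y. \<bar>w1 x - w1 y\<bar> \<le> H * dist x y powr ((s * p - N) / p)" "\<And>x. x\<in>closure \<Omega> \<Longrightarrow> \<bar>w1 x\<bar> \<le> H"
      using est[OF _ v(1,2)] g unfolding H_def by blast
    have "(\<lambda>x. - v x) \<in> borel_measurable borel" using v(2) by simp
    then obtain w2 where w2: "AE x in lborel. w2 x = max (- v x) 0"
       "\<And>x y. \<bar>w2 x - w2 y\<bar> \<le> H * dist x y powr ((s * p - N) / p)" "\<And>x. x\<in>closure \<Omega> \<Longrightarrow> \<bar>w2 x\<bar> \<le> H"
      using est[OF Lp_space_minus weak_solution_minus[OF v(1)]] g unfolding H_def Lp_norm_minus by blast
    have "AE x in lborel. w1 x - w2 x = u x" using w1(1) w2(1) v(3) by eventually_elim (auto simp: max_def)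
    then have ae: "AE x in lebesgue_on (closure \<Omega>). w1 x - w2 x = u x" by (intro AE_lebesgue_on) auto
    have "holder_norm (closure \<Omega>) ((s * p - N) / p) (\<lambda>x. w1 x - w2 x) \<le> ennreal (2 * (2 * H))"
    proof (rule holder_norm_le)
      show "\<bar>w1 x - w2 x - (w1 y - w2 y)\<bar> \<le> 2 * H * dist x y powr ((s * p - N) / p)" for x y
        using w1(2)[of x y] w2(2)[of x y] by linarith
      show "\<bar>w1 x - w2 x\<bar> \<le> 2 * H" if "x \<in> closure \<Omega>" for x
        using w1(3)[OF that] w2(3)[OF that] by linarith
    qed (use H in simp)
    then show "\<exists>w. (AE x in lebesgue_on (closure \<Omega>). w x = u x) \<and>
          holder_norm (closure \<Omega>) ((s * p - N) / p) w \<le> ennreal (4 * C * Lp_norm ?M q g powr (1 / (p - 1)))"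
      using ae by (intro exI[of _ "\<lambda>x. w1 x - w2 x"]) (simp add: H_def mult.assoc)
  qed
qed

theorem proposition1p12:
  fixes s p q N :: real and \<Omega> :: "'a::euclidean_space set"
  assumes "N = real DIM('a)"
    and "0 < s" "s < 1" "1 < p"
    and "open \<Omega>" "connected \<Omega>" "\<Omega> \<noteq> {}" "bounded \<Omega>"
    and "1 \<le> q"
  shows
    "(q = 1 \<longrightarrow>
      (\<forall>r. (s * p < N \<and> 0 < r \<and> r < N * (p - 1) / (N - s * p)) \<or> (N = s * p \<and> 1 \<le> r) \<longrightarrow>
        (\<exists>C>0. \<forall>g u. g \<in> Wsp0_dual s p \<Omega> \<inter> Lp_space (lebesgue_on \<Omega>) q \<longrightarrow>
           weak_solution s p \<Omega> g u \<longrightarrow>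
           u \<in> Lp_space (lebesgue_on \<Omega>) r \<and>
           Lp_norm (lebesgue_on \<Omega>) r u \<le> C * Lp_norm (lebesgue_on \<Omega>) 1 g powr (1 / (p - 1)))))
    \<and>
     (1 < q \<and> q < N / (s * p) \<longrightarrow>
      (\<exists>C>0. \<forall>g u. g \<in> Wsp0_dual s p \<Omega> \<inter> Lp_space (lebesgue_on \<Omega>) q \<longrightarrow>
        weak_solution s p \<Omega> g u \<longrightarrow>
        u \<in> Lp_space (lebesgue_on \<Omega>) (N * (p - 1) * q / (N - s * p * q)) \<and>
        Lp_norm (lebesgue_on \<Omega>) (N * (p - 1) * q / (N - s * p * q)) u
          \<le> C * Lp_norm (lebesgue_on \<Omega>) q g powr (1 / (p - 1))))
    \<and>
     (q = N / (s * p) \<and> 1 < q \<longrightarrow>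
      (\<forall>g u \<alpha>\<^sub>0. g \<in> Wsp0_dual s p \<Omega> \<inter> Lp_space (lebesgue_on \<Omega>) q \<longrightarrow>
        weak_solution s p \<Omega> g u \<longrightarrow>
        (Lp_norm (lebesgue_on \<Omega>) q g \<noteq> 0 \<longrightarrow>
          \<alpha>\<^sub>0 < N / (N - s * p) *
            (p powr p * sobolev_const TYPE('a) s p / Lp_norm (lebesgue_on \<Omega>) q g)
              powr (1 / (p - 1))) \<longrightarrow>
        integrable (lebesgue_on \<Omega>) (\<lambda>x. exp (\<alpha>\<^sub>0 * \<bar>u x\<bar>))))
    \<and>
     (N / (s * p) < q \<and> 1 \<le> N / (s * p) \<longrightarrow>
      (\<exists>C>0. \<forall>g u. g \<in> Wsp0_dual s p \<Omega> \<inter> Lp_space (lebesgue_on \<Omega>) q \<longrightarrow>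
        weak_solution s p \<Omega> g u \<longrightarrow>
        Linf_norm (lebesgue_on \<Omega>) u
          \<le> ereal (C * Lp_norm (lebesgue_on \<Omega>) q g powr (1 / (p - 1)))))
    \<and>
     (N / (s * p) < 1 \<longrightarrow>
      (\<exists>C>0. \<forall>g u. g \<in> Wsp0_dual s p \<Omega> \<inter> Lp_space (lebesgue_on \<Omega>) q \<longrightarrow>
        weak_solution s p \<Omega> g u \<longrightarrow>
        (\<exists>w. (AE x in lebesgue_on (closure \<Omega>). w x = u x) \<and>
          holder_norm (closure \<Omega>) ((s * p - N) / p) w
            \<le> ennreal (C * Lp_norm (lebesgue_on \<Omega>) q g powr (1 / (p - 1))))))"
proof -
  let ?N = "real DIM('a)"
  have sp: "0 < s" "1 < p" and sp0: "0 < s * p" using assms by auto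
  have \<Omega>: "open \<Omega>" "bounded \<Omega>" using assms by auto
  have N0: "?N > 0" by simp
  show ?thesis
    unfolding assms(1)
  proof (intro conjI impI allI, goal_cases)
    case (1 r)
    note q = 1(1) and r = 1(2)
    obtain t where t: "0 < t" "t * (?N - s * p) \<le> ?N * p" "0 < r" "r / t < (p - 1) / p"
    proof (cases "s * p < ?N")
      case True
      \<comment> \<open>The critical Sobolev exponent; for it, the bound on r is equivalent to r / t
        < (p - 1) / p.\<close>
      define t where "t = ?N * p / (?N - s * p)"
      have "r * (?N - s * p) < ?N * (p - 1)" using r True by (simp add: pos_less_divide_eq)
      then have "r * (?N - s * p) / ?N < p - 1" using N0 by (simp add: pos_divide_less_eq mult.commute)
      then have "r * (?N - s * p) / ?N / p < (p - 1) / p" using sp by (intro divide_strict_right_mono) auto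
      moreover have "r * (?N - s * p) / ?N / p = r / t" by (simp add: t_def)
      ultimately have "r / t < (p - 1) / p" by simp
      moreover have "0 < t" "t * (?N - s * p) \<le> ?N * p" using True sp by (auto simp: t_def)
      moreover have "0 < r" using r True by simp
      ultimately show thesis by (intro that)
    next
      case False
      then have r: "?N = s * p" "1 \<le> r" using r by auto
      \<comment> \<open>For N = s p every t > 0 is a Sobolev exponent; this one makes r / t half of
        (p - 1) / p.\<close>
      define t where "t = 2 * r * p / (p - 1)"
      have "0 < t" using r sp by (simp add: t_def)
      moreover have "r / t < (p - 1) / p"
      proof -
        have "z / 2 < z" if "z > 0" for z :: real using that by simp
        moreover have "(p - 1) / p > 0" using sp by simp
        moreover have "r / t = (p - 1) / p / 2" using r(2) sp by (simp add: t_def)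
        ultimately show ?thesis by simp
      qed
      moreover have "t * (?N - s * p) \<le> ?N * p" unfolding r(1) using sp0 sp by simp
      moreover have "0 < r" using r(2) by simp
      ultimately show thesis by (intro that)
    qed
    show ?case unfolding q by (rule Lp_bound_of_L1_data[OF sp \<Omega> t])
  next
    case q: 2
    then have "s * p * q < ?N" using sp0 by (simp add: pos_less_divide_eq mult.commute)
    then show ?case using Lp_bound_of_Lq_data[OF sp \<Omega>] q by blast
  next
    case (3 g u \<alpha>\<^sub>0)
    then show ?case
      using exp_integrable_of_critical_data[OF sp \<Omega>, of q g u \<alpha>\<^sub>0] by blast
  next
    case a: 4
    then have q: "1 < q" by linarith
    have sN: "s * p \<le> ?N" using a sp0 by (simp add: pos_le_divide_eq)
    have Nq: "?N < q * (s * p)" using a sp0 by (simp add: pos_divide_less_eq)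
    obtain t where t: "p * (q / (q - 1)) < t" "t * (?N - s * p) \<le> ?N * p"
    proof (cases "s * p < ?N")
      case True
      \<comment> \<open>Equivalent to q > N / (s p), and after division to the critical Sobolev
        exponent exceeding p q / (q - 1).\<close>
      have "q * (?N - s * p) < ?N * (q - 1)" using Nq by (simp add: algebra_simps)
      then have "p * (q / (q - 1)) < ?N * p / (?N - s * p)" using True q sp by (simp add: field_simps)
      then show thesis using that[of "?N * p / (?N - s * p)"] True by simp
    next
      case False
      then have eq: "?N - s * p = 0" using sN by simp
      have "(p * (q / (q - 1)) + 1) * (?N - s * p) \<le> ?N * p" unfolding eq using sp by simp
      then show thesis using that[of "p * (q / (q - 1)) + 1"] by simp
    qed
    show ?case by (rule Linf_bound_of_Lq_data[OF sp \<Omega> q t])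
  next
    case 5
    then have "?N < s * p" using sp0 by (simp add: pos_divide_less_eq)
    then show ?case by (intro Holder_bound_of_Lq_data assms \<Omega>)
  qed
qed

end
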